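(* Let $1<p<\infty$, $p\ne2$, and $q=\max\{1,p-1\}$. Assume that $|F|\in L^{q}_{\mathrm{loc}}(\Omega_T)$ and that $u\in L^q_{\mathrm{loc}}(0,T;W^{1,q}_{\mathrm{loc}}(\Omega;\mathbb{R}^N))$ satisfies $$\iint_{\Omega_T}\bigl(-u\cdot\varphi_t+\mathcal{A}(z,\nabla u)\cdot\nabla\varphi\bigr)\,dz=\iint_{\Omega_T}|F|^{p-2}F\cdot\nabla\varphi\,dz$$ for every $\varphi\in C_0^\infty(\Omega_T;\mathbb{R}^N)$. Then there exists a constant $c=c(n,p,L)$ such that $$\frac{|u(x,t)-u(x,s)|}{|t-s|^{\frac12}}\le c\bigl(g(x,t)+g(x,s)\bigr)$$ for every parabolic cylinder $Q=Q_r=B\times I$ such that $2Q\Subset\Omega_T$ and almost every $x\in B$ and $t,s\in I$, where $$g(x,t)=\begin{cases}\Bigl(M^*\bigl((|\nabla u|+|F|)1_{2Q}\bigr)(x,t)+1\Bigr)^{\frac p2},&1<p<2,\\[1ex]\Bigl(M^*\Bigl(\bigl(\tfrac{|u|}r+|\nabla u|+|F|\bigr)^{p-1}1_{2Q}\Bigr)(x,t)+1\Bigr)^{\frac p{2(p-1)}},&2<p<\infty.\end{cases}$$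
   Context: $\Omega\subset\mathbb{R}^n$, $n\ge1$, is a bounded open domain, $T>0$, $\Omega_T=\Omega\times(0,T)$, $N\ge1$, $0<\nu<L<\infty$. $\mathcal{A}:\Omega_T\times\mathbb{R}^{Nn}\to\mathbb{R}^{Nn}$ is a Carathéodory vector field ($\mathcal{A}(\cdot,\xi)$ measurable for every $\xi$, $\mathcal{A}(z,\cdot)$ continuous for a.e. $z$) with $\nu|\xi|^p\le\mathcal{A}(z,\xi)\cdot\xi$ and $|\mathcal{A}(z,\xi)|\le L|\xi|^{p-1}$ for a.e. $z\in\Omega_T$ and every $\xi\in\mathbb{R}^{Nn}$. $F:\Omega_T\to\mathbb{R}^{Nn}$ is measurable. We write $z=(x,t)$, $dz=dx\,dt$, and $\nabla$ is the gradient in $x$. $u\in L^q_{\mathrm{loc}}(0,T;W^{1,q}_{\mathrm{loc}}(\Omega;\mathbb{R}^N))$ means that for all $\Omega'\Subset\Omega$ and $0<t_1<t_2<T$ one has $u(\cdot,t)\in W^{1,q}(\Omega';\mathbb{R}^N)$ for a.e. $t\in(t_1,t_2)$ and $\int_{t_1}^{t_2}\int_{\Omega'}(|u|^q+|\nabla u|^q)\,dx\,dt<\infty$. Parabolic cylinders: $Q_r=B\times I$ with $B=B_r(x_0)$, $I=(t_0-r^2,t_0+r^2)$, and $2Q_r=B_{2r}(x_0)\times(t_0-(2r)^2,t_0+(2r)^2)$. $2Q\Subset\Omega_T$ means that the closure of $2Q$ is a compact subset of $\Omega_T$. Functions multiplied by $1_{2Q}$ are extended by zero outside $2Q$. The strong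 maximal function of $f\in L^1_{\mathrm{loc}}(\mathbb{R}^{n+1})$ is $M^*f(z)=\sup\frac1{|B'\times I'|}\iint_{B'\times I'}|f|\,d\zeta$, the supremum taken over all cylinders $B'\times I'\ni z$ with $B'\subset\mathbb{R}^n$ an open ball and $I'\subset\mathbb{R}$ a bounded open interval (radius and length independent of each other). *)

theory Defs
  imports "HOL-Analysis.Analysis"
begin

section \<open>Tuples with a variable number of components\<close>

text \<open>
  The target dimension \<open>N\<close> has to be quantified inside the statement, because the constant of the
  estimate must not depend on it; hence \<open>N\<close> cannot be the cardinality of an index type.
  The space of \<open>N\<close>-tuples over \<open>'a\<close> is realised as the set of sequences that vanish
  from index \<open>N\<close> on. For \<open>'a = real\<close> this is \<open>\<real>\<^sup>N\<close>; for \<open>'a = real ^ 'n\<close> it is \<open>\<real>\<^sup>N\<^sup>n\<close>, and the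
  \<open>i\<close>-th entry of \<open>\<nabla>u\<close> is the gradient of the \<open>i\<close>-th component of \<open>u\<close>. The topology it inherits from
  the product topology on \<open>nat \<Rightarrow> 'a\<close> is the usual one of a finite-dimensional space.
\<close>

definition tuples :: "nat \<Rightarrow> (nat \<Rightarrow> 'a::zero) set" where
  "tuples N = {v. \<forall>i\<ge>N. v i = 0}"

definition tnorm :: "nat \<Rightarrow> (nat \<Rightarrow> 'a::real_normed_vector) \<Rightarrow> real" where
  "tnorm N v = L2_set (\<lambda>i. norm (v i)) {..<N}"

definition tinner :: "nat \<Rightarrow> (nat \<Rightarrow> 'a::real_inner) \<Rightarrow> (nat \<Rightarrow> 'a) \<Rightarrow> real" where
  "tinner N v w = (\<Sum>i<N. v i \<bullet> w i)"


section \<open>Test functions\<close>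

definition compactly_contained :: "'a::topological_space set \<Rightarrow> 'a set \<Rightarrow> bool"
    (infix \<open>\<Subset>\<close> 50) where
  "S \<Subset> U \<longleftrightarrow> compact (closure S) \<and> closure S \<subseteq> U"

primrec C_k :: "nat \<Rightarrow> ('a::euclidean_space \<Rightarrow> real) \<Rightarrow> bool" where
  "C_k 0 f \<longleftrightarrow> continuous_on UNIV f"
| "C_k (Suc k) f \<longleftrightarrow>
     (\<forall>x. f differentiable (at x)) \<and> (\<forall>v. C_k k (\<lambda>x. frechet_derivative f (at x) v))"

text \<open>Elements of \<open>C\<^sub>0\<^sup>\<infinity>(U)\<close>, extended by zero to the whole space.\<close>

definition test_fun :: "'a::euclidean_space set \<Rightarrow> ('a \<Rightarrow> real) \<Rightarrow> bool" where
  "test_fun U f \<longleftrightarrow> (\<forall>k. C_k k f) \<and> {x. f x \<noteq> 0} \<Subset> U"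

definition test_tuple :: "nat \<Rightarrow> 'a::euclidean_space set \<Rightarrow> ('a \<Rightarrow> nat \<Rightarrow> real) \<Rightarrow> bool" where
  "test_tuple N U \<phi> \<longleftrightarrow> (\<forall>z. \<phi> z \<in> tuples N) \<and> (\<forall>i<N. test_fun U (\<lambda>z. \<phi> z i))"

definition grad :: "('a::euclidean_space \<Rightarrow> real) \<Rightarrow> 'a \<Rightarrow> 'a" where
  "grad f x = (\<Sum>b\<in>Basis. frechet_derivative f (at x) b *\<^sub>R b)"

definition grad_tuple :: "('a::euclidean_space \<times> real \<Rightarrow> nat \<Rightarrow> real) \<Rightarrow> 'a \<times> real \<Rightarrow> nat \<Rightarrow> 'a" where
  "grad_tuple \<phi> = (\<lambda>(x, t) i. grad (\<lambda>y. \<phi> (y, t) i) x)"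

definition dt_tuple :: "('a::euclidean_space \<times> real \<Rightarrow> nat \<Rightarrow> real) \<Rightarrow> 'a \<times> real \<Rightarrow> nat \<Rightarrow> real" where
  "dt_tuple \<phi> = (\<lambda>(x, t) i. deriv (\<lambda>s. \<phi> (x, s) i) t)"


section \<open>Function spaces\<close>

definition measurable_tuple ::
    "nat \<Rightarrow> 'a::euclidean_space set \<Rightarrow> ('a \<Rightarrow> nat \<Rightarrow> 'b::real_normed_vector) \<Rightarrow> bool" where
  "measurable_tuple N U f \<longleftrightarrow>
     (\<forall>x\<in>U. f x \<in> tuples N) \<and> (\<forall>i<N. (\<lambda>x. f x i) \<in> borel_measurable (lebesgue_on U))"

definition Lq_loc ::
    "nat \<Rightarrow> real \<Rightarrow> 'a::euclidean_space set \<Rightarrow> ('a \<Rightarrow> nat \<Rightarrow> 'b::real_normed_vector) \<Rightarrow> bool" where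
  "Lq_loc N q U f \<longleftrightarrow> measurable_tuple N U f \<and>
     (\<forall>K. compact K \<and> K \<subseteq> U \<longrightarrow> set_integrable lebesgue K (\<lambda>x. tnorm N (f x) powr q))"

definition weak_grad ::
    "'a::euclidean_space set \<Rightarrow> ('a \<Rightarrow> real) \<Rightarrow> ('a \<Rightarrow> 'a) \<Rightarrow> bool" where
  "weak_grad U w G \<longleftrightarrow>
     (\<forall>\<psi>. test_fun U \<psi> \<longrightarrow>
       (LINT x:U|lebesgue. w x *\<^sub>R grad \<psi> x) = - (LINT x:U|lebesgue. \<psi> x *\<^sub>R G x))"

text \<open>\<open>w \<in> W\<^sup>1\<^sup>,\<^sup>q(U; \<real>\<^sup>N)\<close> with weak gradient \<open>G\<close>.\<close>

definition sobolev_W1 ::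
    "nat \<Rightarrow> real \<Rightarrow> 'a::euclidean_space set \<Rightarrow> ('a \<Rightarrow> nat \<Rightarrow> real) \<Rightarrow> ('a \<Rightarrow> nat \<Rightarrow> 'a) \<Rightarrow> bool" where
  "sobolev_W1 N q U w G \<longleftrightarrow>
     measurable_tuple N U w \<and> measurable_tuple N U G \<and>
     set_integrable lebesgue U (\<lambda>x. tnorm N (w x) powr q) \<and>
     set_integrable lebesgue U (\<lambda>x. tnorm N (G x) powr q) \<and>
     (\<forall>i<N. weak_grad U (\<lambda>x. w x i) (\<lambda>x. G x i))"

text \<open>\<open>u \<in> L\<^sup>q\<^sub>l\<^sub>o\<^sub>c(0, T; W\<^sup>1\<^sup>,\<^sup>q\<^sub>l\<^sub>o\<^sub>c(\<Omega>; \<real>\<^sup>N))\<close>, where \<open>Du\<close> is any jointly measurable representative of the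
  spatial weak gradient \<open>\<nabla>u\<close>.\<close>

definition parabolic_sobolev_loc ::
    "nat \<Rightarrow> real \<Rightarrow> 'a::euclidean_space set \<Rightarrow> real \<Rightarrow> ('a \<times> real \<Rightarrow> nat \<Rightarrow> real) \<Rightarrow>
     ('a \<times> real \<Rightarrow> nat \<Rightarrow> 'a) \<Rightarrow> bool" where
  "parabolic_sobolev_loc N q \<Omega> T u Du \<longleftrightarrow>
     measurable_tuple N (\<Omega> \<times> {0<..<T}) u \<and> measurable_tuple N (\<Omega> \<times> {0<..<T}) Du \<and>
     (\<forall>\<Omega>' t1 t2. open \<Omega>' \<and> \<Omega>' \<Subset> \<Omega> \<and> 0 < t1 \<and> t1 < t2 \<and> t2 < T \<longrightarrow>
       (AE t\<in>{t1<..<t2} in lebesgue. sobolev_W1 N q \<Omega>' (\<lambda>x. u (x, t)) (\<lambda>x. Du (x, t))) \<and>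
       set_integrable lebesgue (\<Omega>' \<times> {t1<..<t2})
         (\<lambda>z. tnorm N (u z) powr q + tnorm N (Du z) powr q))"


section \<open>The parabolic system\<close>

definition caratheodory_field ::
    "nat \<Rightarrow> ('a::euclidean_space \<times> real) set \<Rightarrow>
     ('a \<times> real \<Rightarrow> (nat \<Rightarrow> 'a) \<Rightarrow> nat \<Rightarrow> 'a) \<Rightarrow> bool" where
  "caratheodory_field N U A \<longleftrightarrow>
     (\<forall>z\<in>U. \<forall>\<xi>\<in>tuples N. A z \<xi> \<in> tuples N) \<and>
     (\<forall>\<xi>\<in>tuples N. measurable_tuple N U (\<lambda>z. A z \<xi>)) \<and>
     (AE z\<in>U in lebesgue. continuous_on (tuples N) (A z))"

definition p_structure ::
    "nat \<Rightarrow> real \<Rightarrow> real \<Rightarrow> real \<Rightarrow> ('a::euclidean_space \<times> real) set \<Rightarrow>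
     ('a \<times> real \<Rightarrow> (nat \<Rightarrow> 'a) \<Rightarrow> nat \<Rightarrow> 'a) \<Rightarrow> bool" where
  "p_structure N p \<nu> L U A \<longleftrightarrow>
     (AE z\<in>U in lebesgue. \<forall>\<xi>\<in>tuples N.
        \<nu> * tnorm N \<xi> powr p \<le> tinner N (A z \<xi>) \<xi> \<and>
        tnorm N (A z \<xi>) \<le> L * tnorm N \<xi> powr (p - 1))"

text \<open>
  For \<open>p < 2\<close> the field \<open>|F|\<^sup>p\<^sup>-\<^sup>2 F\<close> is \<open>0\<close> where \<open>F = 0\<close>; this agrees with \<open>0 powr (p - 2) = 0\<close>.
\<close>

definition weak_solution ::
    "nat \<Rightarrow> real \<Rightarrow> ('a::euclidean_space \<times> real) set \<Rightarrow>
     ('a \<times> real \<Rightarrow> (nat \<Rightarrow> 'a) \<Rightarrow> nat \<Rightarrow> 'a) \<Rightarrow> ('a \<times> real \<Rightarrow> nat \<Rightarrow> 'a) \<Rightarrow>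
     ('a \<times> real \<Rightarrow> nat \<Rightarrow> real) \<Rightarrow> ('a \<times> real \<Rightarrow> nat \<Rightarrow> 'a) \<Rightarrow> bool" where
  "weak_solution N p U A F u Du \<longleftrightarrow>
     (\<forall>\<phi>. test_tuple N U \<phi> \<longrightarrow>
       (LINT z:U|lebesgue. - tinner N (u z) (dt_tuple \<phi> z) + tinner N (A z (Du z)) (grad_tuple \<phi> z))
       = (LINT z:U|lebesgue. tinner N (\<lambda>i. tnorm N (F z) powr (p - 2) *\<^sub>R F z i) (grad_tuple \<phi> z)))"


section \<open>Parabolic cylinders and the strong maximal function\<close>

definition pint :: "real \<Rightarrow> real \<Rightarrow> real set" where
  "pint t0 r = {t0 - r\<^sup>2<..<t0 + r\<^sup>2}"

definition pcyl :: "'a::euclidean_space \<Rightarrow> real \<Rightarrow> real \<Rightarrow> ('a \<times> real) set" where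
  "pcyl x0 t0 r = ball x0 r \<times> pint t0 r"

text \<open>The strong maximal function takes the value \<open>\<infinity>\<close> in general, already for integrable \<open>f\<close>.\<close>

definition strong_maximal :: "('a::euclidean_space \<times> real \<Rightarrow> real) \<Rightarrow> 'a \<times> real \<Rightarrow> ennreal" where
  "strong_maximal f z =
     (SUP C \<in> {ball y \<rho> \<times> {a<..<b} | y \<rho> a b. z \<in> ball y \<rho> \<times> {a<..<b}}.
        (\<integral>\<^sup>+\<zeta>\<in>C. ennreal \<bar>f \<zeta>\<bar> \<partial>lebesgue) / emeasure lebesgue C)"

text \<open>Real powers with positive exponent, \<open>\<infinity>\<^sup>\<alpha> = \<infinity>\<close>.\<close>

definition ennpowr :: "ennreal \<Rightarrow> real \<Rightarrow> ennreal" where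
  "ennpowr a \<alpha> = (if a = \<infinity> then \<infinity> else ennreal (enn2real a powr \<alpha>))"

definition g_bound ::
    "nat \<Rightarrow> real \<Rightarrow> 'a::euclidean_space \<Rightarrow> real \<Rightarrow> real \<Rightarrow> ('a \<times> real \<Rightarrow> nat \<Rightarrow> 'a) \<Rightarrow>
     ('a \<times> real \<Rightarrow> nat \<Rightarrow> real) \<Rightarrow> ('a \<times> real \<Rightarrow> nat \<Rightarrow> 'a) \<Rightarrow> 'a \<times> real \<Rightarrow> ennreal" where
  "g_bound N p x0 t0 r F u Du z =
     (if p < 2 then
        ennpowr
          (strong_maximal
             (\<lambda>\<zeta>. (tnorm N (Du \<zeta>) + tnorm N (F \<zeta>)) * indicator (pcyl x0 t0 (2 * r)) \<zeta>) z + 1)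
          (p / 2)
      else
        ennpowr
          (strong_maximal
             (\<lambda>\<zeta>. (tnorm N (u \<zeta>) / r + tnorm N (Du \<zeta>) + tnorm N (F \<zeta>)) powr (p - 1)
                  * indicator (pcyl x0 t0 (2 * r)) \<zeta>) z + 1)
          (p / (2 * (p - 1))))"

end

theory Submission
  imports Defs
begin

text \<open>
  Why the estimate holds. Fix a point \<open>x\<close> and times \<open>s < t\<close>, put \<open>\<tau> = t - s\<close>, and let \<open>\<lambda> \<ge> 1\<close> be
  the size that the maximal function at \<open>(x, t)\<close> and \<open>(x, s)\<close> allows for the averages of
  \<open>|\<nabla>u| + |F|\<close>. Replacing \<open>u(x, t)\<close> and \<open>u(x, s)\<close> by means over a ball of radius \<open>\<rho>\<close> at \<open>x\<close> costs
  a multiple of \<open>\<rho> \<lambda>\<close>, by a Poincare type argument in space. The two means differ by a multiple of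
  \<open>\<tau> \<lambda>\<^sup>p\<^sup>-\<^sup>1 / \<rho>\<close>: test the system with a spatial cutoff, whose gradient is of order \<open>1 / \<rho>\<close>,
  and use the growth of the field. The choice \<open>\<rho> = (\<tau> / 2)\<^sup>1\<^sup>/\<^sup>2 \<lambda>\<^sup>(\<^sup>p\<^sup>-\<^sup>2\<^sup>)\<^sup>/\<^sup>2\<close> makes both errors
  equal to \<open>\<tau>\<^sup>1\<^sup>/\<^sup>2 \<lambda>\<^sup>p\<^sup>/\<^sup>2\<close> up to constants, and \<open>\<lambda>\<^sup>p\<^sup>/\<^sup>2\<close> is the larger one of the two values of \<open>g\<close>. If \<open>p < 2\<close>, then \<open>\<lambda> \<ge> 1\<close> and \<open>\<tau> < 2 r\<^sup>2\<close> force
  \<open>\<rho> < r\<close>, so the ball stays inside the cylinder. If \<open>p > 2\<close>, the radius may exceed \<open>r\<close>; in that case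
  \<open>|u| \<le> r \<lambda> \<le> \<rho> \<lambda>\<close> at both points, up to a constant, is already enough, and this is the reason why \<open>|u| / r\<close> enters
  \<open>g\<close> for \<open>p > 2\<close>. The two errors are balanced in
  \<open>pointwise_estimate\<close>.

  All means are taken over space and time, with radius \<open>\<rho>\<close> in space and width \<open>\<epsilon>\<close> in time, and
  \<open>\<epsilon> \<rightarrow> 0\<close> is the very last step. Then every error is an integral over a cylinder that contains one of
  the two points, hence it is controlled by the strong maximal function as it stands, and the only
  exceptional points are those that fail to be Lebesgue points of the components of \<open>u\<close>. In
  particular the null set depends neither on \<open>\<rho>\<close> nor on the direction of \<open>u(x, t) - u(x, s)\<close>, which is
  only known afterwards and along which the system is projected to obtain a constant that is independent
  of \<open>N\<close>.

  The spatial error (\<open>spatial_oscillation\<close>) rests on the identity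
  \<open>d/d\<rho> (\<rho>\<^sup>-\<^sup>n \<eta>((y - x) / \<rho>)) = - div\<^sub>y ((y - x) \<rho>\<^sup>-\<^sup>n\<^sup>-\<^sup>1 \<eta>((y - x) / \<rho>))\<close>: the derivative of a mean with
  respect to its radius is a mean of \<open>\<nabla>u \<bullet> (y - x) / \<rho>\<close>, which is at most a multiple of \<open>\<lambda>\<close>. The
  temporal error is \<open>temporal_oscillation\<close>; to split the weak formulation there, \<open>\<A>(z, \<nabla>u)\<close> must be
  measurable, which is \<open>caratheodory_measurable\<close>.
\<close>

section \<open>Smooth functions and cutoffs\<close>

abbreviation smooth :: "('a::euclidean_space \<Rightarrow> real) \<Rightarrow> bool" where
  "smooth f \<equiv> \<forall>k. C_k k f"

lemma C_k_antimono: "C_k (Suc k) f \<Longrightarrow> C_k k f"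
proof (induction k arbitrary: f)
  case 0
  then show ?case
    by (auto simp: continuous_on_eq_continuous_at differentiable_imp_continuous_within)
next
  case (Suc k)
  then show ?case by simp
qed

lemma frechet_derivative_has: "f differentiable (at x) \<Longrightarrow> (f has_derivative frechet_derivative f (at x)) (at x)"
  by (simp add: frechet_derivative_works)

lemma frechet_derivative_eqI: "(f has_derivative f') (at x) \<Longrightarrow> frechet_derivative f (at x) v = f' v"
  using frechet_derivative_at by metis

lemma C_k_SucI:
  assumes "\<And>x. (f has_derivative f' x) (at x)" "\<And>v. C_k k (\<lambda>x. f' x v)"
  shows "C_k (Suc k) f"
proof -
  have "frechet_derivative f (at x) v = f' x v" for x v
    using frechet_derivative_eqI assms(1) by blast
  moreover have "f differentiable (at x)" for x
    using assms(1) unfolding differentiable_def by blast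
  ultimately show ?thesis using assms(2) by simp
qed

lemma C_k_const: "C_k k (\<lambda>x. c)"
proof (induction k arbitrary: c)
  case 0 then show ?case by simp
next
  case (Suc k)
  show ?case by (rule C_k_SucI[where f'="\<lambda>_ _. 0"]) (use Suc in auto)
qed

lemma C_k_linear:
  assumes "bounded_linear f" shows "C_k k f"
proof (cases k)
  case 0 then show ?thesis using assms by (simp add: linear_continuous_on)
next
  case (Suc m)
  show ?thesis unfolding Suc
    by (rule C_k_SucI[where f'="\<lambda>_. f"]) (use assms in \<open>auto intro: bounded_linear_imp_has_derivative C_k_const\<close>)
qed

lemma C_k_add: "C_k k f \<Longrightarrow> C_k k g \<Longrightarrow> C_k k (\<lambda>x. f x + g x)"
proof (induction k arbitrary: f g)
  case 0 then show ?case by (simp add: continuous_on_add)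
next
  case (Suc k)
  show ?case
    by (rule C_k_SucI[where f'="\<lambda>x v. frechet_derivative f (at x) v + frechet_derivative g (at x) v"])
       (use Suc in \<open>auto intro!: has_derivative_add frechet_derivative_has\<close>)
qed

lemma C_k_mult: "C_k k f \<Longrightarrow> C_k k g \<Longrightarrow> C_k k (\<lambda>x. f x * g x)"
proof (induction k arbitrary: f g)
  case 0 then show ?case by (simp add: continuous_on_mult)
next
  case (Suc k)
  have "C_k k f" "C_k k g" using C_k_antimono Suc.prems by blast+
  then show ?case
    by (intro C_k_SucI[where f'="\<lambda>x v. f x * frechet_derivative g (at x) v + frechet_derivative f (at x) v * g x"])
       (use Suc in \<open>auto intro!: has_derivative_mult frechet_derivative_has C_k_add\<close>)
qed

lemma C_k_sum: "finite I \<Longrightarrow> (\<And>i. i \<in> I \<Longrightarrow> C_k k (f i)) \<Longrightarrow> C_k k (\<lambda>x. \<Sum>i\<in>I. f i x)"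
  by (induction I rule: finite_induct) (auto intro: C_k_const C_k_add)

text \<open>
  The induction needs the derivative \<open>f'(c + l x) (l v)\<close> to be of the same form as the function itself,
  which is why an affine substitution is treated on its own.
\<close>

lemma C_k_affine:
  assumes "bounded_linear l"
  shows "C_k k f \<Longrightarrow> C_k k (\<lambda>x. f (c + l x))"
proof (induction k arbitrary: f)
  case 0
  have "continuous_on UNIV (\<lambda>x. c + l x)"
    using assms by (intro continuous_intros linear_continuous_on)
  with 0 show ?case using continuous_on_compose2[of UNIV f UNIV "\<lambda>x. c + l x"] by simp
next
  case (Suc k)
  have d: "((\<lambda>x. c + l x) has_derivative l) (at x)" for x
    using assms by (auto intro!: derivative_eq_intros bounded_linear_imp_has_derivative)
  have d2: "(f has_derivative frechet_derivative f (at (c + l x))) (at (c + l x))" for x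
    using Suc(2) by (simp add: frechet_derivative_has)
  show ?case
    by (rule C_k_SucI[where f'="\<lambda>x v. frechet_derivative f (at (c + l x)) (l v)"])
       (use has_derivative_compose[OF d d2] Suc in auto)
qed

text \<open>
  A real outer function keeps the chain rule scalar: the derivative is \<open>g'(f x)\<close> times \<open>f'(x) v\<close>, a
  product to which the induction hypothesis applies.
\<close>

lemma C_k_compose_real:
  fixes g :: "real \<Rightarrow> real"
  shows "C_k k f \<Longrightarrow> C_k k g \<Longrightarrow> C_k k (\<lambda>x. g (f x))"
proof (induction k arbitrary: f g)
  case 0 then show ?case using continuous_on_compose2[of UNIV g UNIV f] by simp
next
  case (Suc k)
  have d: "((\<lambda>x. g (f x)) has_derivative (\<lambda>v. frechet_derivative f (at x) v * frechet_derivative g (at (f x)) 1)) (at x)" for x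
  proof -
    have "(f has_derivative frechet_derivative f (at x)) (at x)"
      "(g has_derivative frechet_derivative g (at (f x))) (at (f x))"
      using Suc by (auto intro: frechet_derivative_has)
    then have "((\<lambda>x. g (f x)) has_derivative (\<lambda>v. frechet_derivative g (at (f x)) (frechet_derivative f (at x) v))) (at x)"
      by (rule has_derivative_compose)
    moreover have "frechet_derivative g (at (f x)) (frechet_derivative f (at x) v) = frechet_derivative f (at x) v * frechet_derivative g (at (f x)) 1" for v
      using linear_cmul[OF linear_frechet_derivative[of g "at (f x)"], of "frechet_derivative f (at x) v" 1] Suc(3)
      by simp
    ultimately show ?thesis by simp
  qed
  have "C_k k f" using C_k_antimono Suc.prems by blast
  then have "C_k k (\<lambda>x. frechet_derivative g (at (f x)) 1)"
    using Suc.IH[of f "\<lambda>y. frechet_derivative g (at y) 1"] Suc.prems by simp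
  then show ?case
    by (intro C_k_SucI[OF d]) (use Suc in \<open>auto intro!: C_k_mult\<close>)
qed

text \<open>
  The function \<open>exp (-1/t) t\<^sup>-\<^sup>m\<close> for \<open>t > 0\<close>, extended by zero. The parameter \<open>m\<close> makes the span of the
  family closed under differentiation, so that smoothness of \<open>exp (-1/t)\<close> follows by one induction.
\<close>

definition flat :: "nat \<Rightarrow> real \<Rightarrow> real" where
  "flat m t = (if t \<le> 0 then 0 else exp (- inverse t) * inverse t ^ m)"

lemma flat_lim0: "(flat m \<longlongrightarrow> 0) (at 0)"
proof -
  have "((\<lambda>s::real. s ^ m / exp s) \<longlongrightarrow> 0) at_top"
    by (rule tendsto_power_div_exp_0)
  then have "((\<lambda>t::real. inverse t ^ m / exp (inverse t)) \<longlongrightarrow> 0) (at_right 0)"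
    by (rule filterlim_compose[OF _ filterlim_inverse_at_top_right])
  then have r: "(flat m \<longlongrightarrow> 0) (at_right 0)"
    by (rule Lim_transform_eventually)
       (auto simp: flat_def eventually_at_filter exp_minus field_simps)
  have l: "(flat m \<longlongrightarrow> 0) (at_left 0)"
    by (rule tendsto_eventually) (auto simp: flat_def eventually_at_filter)
  show ?thesis using r l by (simp add: filterlim_at_split)
qed

lemma flat_deriv: "(flat m has_real_derivative (flat (m+2) t - real m * flat (m+1) t)) (at t)"
proof -
  consider "t < 0" | "t = 0" | "t > 0" by linarith
  then show ?thesis
  proof cases
    case 1
    have "((\<lambda>_. 0) has_real_derivative 0) (at t)" by simp
    then have "(flat m has_real_derivative 0) (at t)"
      by (rule DERIV_cong_ev[THEN iffD1, OF refl _ refl, rotated])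
         (use eventually_nhds_in_open[of "{..<0}" t] 1 in \<open>auto simp: flat_def elim!: eventually_mono\<close>)
    then show ?thesis using 1 by (simp add: flat_def)
  next
    case 2
    have "((\<lambda>h. (flat m h - flat m 0) / h) \<longlongrightarrow> 0) (at 0)"
      by (rule Lim_transform_eventually[OF flat_lim0[of "m+1"]])
         (auto simp: flat_def eventually_at_filter field_simps)
    then show ?thesis using 2 by (simp add: DERIV_def flat_def)
  next
    case 3
    have "((\<lambda>t. exp (- inverse t) * inverse t ^ m) has_real_derivative (flat (m+2) t - real m * flat (m+1) t)) (at t)"
    proof -
      have "real m * (inverse t ^ (m - Suc 0) * inverse t) = real m * inverse t ^ m"
        by (cases m) auto
      then show ?thesis using 3
        by (auto intro!: derivative_eq_intros simp: flat_def power2_eq_square algebra_simps)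
    qed
    then show ?thesis
      by (rule DERIV_cong_ev[THEN iffD1, OF refl _ refl, rotated])
         (use eventually_nhds_in_open[of "{0<..}" t] 3 in \<open>auto simp: flat_def elim!: eventually_mono\<close>)
  qed
qed

lemma C_k_flat: "C_k k (flat m)"
proof (induction k arbitrary: m)
  case 0
  show ?case using flat_deriv[THEN DERIV_isCont] by (simp add: continuous_on_eq_continuous_at)
next
  case (Suc k)
  show ?case
  proof (rule C_k_SucI)
    show "(flat m has_derivative (\<lambda>v. (flat (m+2) t + (- real m) * flat (m+1) t) * v)) (at t)" for t
      using flat_deriv[of m t] by (simp add: has_field_derivative_def)
    show "C_k k (\<lambda>x. (flat (m + 2) x + (- real m) * flat (m + 1) x) * v)" for v
      by (intro C_k_mult C_k_add Suc C_k_const)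
  qed
qed

lemma smooth_dist_sq: "C_k k (\<lambda>y::'a::euclidean_space. (y - c) \<bullet> (y - c))"
proof -
  have eq: "(\<lambda>y::'a. (y - c) \<bullet> (y - c)) = (\<lambda>y. \<Sum>b\<in>Basis. (- (c \<bullet> b) + y \<bullet> b) * (- (c \<bullet> b) + y \<bullet> b))"
    by (subst euclidean_inner) (simp add: inner_diff_left)
  show ?thesis unfolding eq
    by (intro C_k_sum finite_Basis C_k_mult C_k_add C_k_const C_k_linear[OF bounded_linear_inner_left])
qed

lemma smooth_differentiable: "smooth f \<Longrightarrow> (f has_derivative frechet_derivative f (at x)) (at x)"
  by (metis C_k.simps(2) frechet_derivative_has)

lemma smooth_continuous: "smooth f \<Longrightarrow> continuous_on UNIV f"
  by (metis C_k.simps(1))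

lemma smooth_frechet: "smooth f \<Longrightarrow> smooth (\<lambda>x. frechet_derivative f (at x) v)"
  by (metis C_k.simps(2))

lemma frechet_zero_outside:
  fixes f :: "'a::euclidean_space \<Rightarrow> real"
  assumes "closed K" "\<And>x. x \<notin> K \<Longrightarrow> f x = 0" "x \<notin> K"
  shows "frechet_derivative f (at x) v = 0"
proof -
  have "(f has_derivative (\<lambda>_. 0)) (at x)"
    by (rule has_derivative_transform_within_open[where f="\<lambda>_. 0" and s="-K"]) (use assms in auto)
  then show ?thesis by (rule frechet_derivative_eqI)
qed

lemma linear_Basis_expansion:
  fixes f :: "'a::euclidean_space \<Rightarrow> real"
  assumes "linear f" shows "f v = (\<Sum>b\<in>Basis. (v \<bullet> b) * f b)"
proof -
  have "f v = f (\<Sum>b\<in>Basis. (v \<bullet> b) *\<^sub>R b)" by (simp only: euclidean_representation)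
  also have "\<dots> = (\<Sum>b\<in>Basis. (v \<bullet> b) * f b)"
    by (simp only: linear_sum[OF assms] linear_cmul[OF assms] real_scaleR_def)
  finally show ?thesis .
qed

text \<open>
  The support is placed in the unit ball and, at the same time, in the cube with corner \<open>0\<close>. The cube
  relates the means to one-sided averages over cubes (\<open>lebesgue_points_AE\<close>), the ball relates them to the
  maximal function, for which it does not matter that the kernel is not centred. A ball of radius
  \<open>1/(3n)\<close> around the point with all coordinates \<open>1/(3n)\<close> fits into both.
\<close>

proposition exists_bump:
  "\<exists>(\<eta> :: 'a::euclidean_space \<Rightarrow> real) M. smooth \<eta> \<and> (\<forall>y. 0 \<le> \<eta> y \<and> \<eta> y \<le> 1) \<and> (\<exists>y. 0 < \<eta> y) \<and> 1 \<le> M \<and>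
    (\<forall>y. \<eta> y \<noteq> 0 \<longrightarrow> norm y < 1 \<and> y \<in> cbox 0 One) \<and>
    (\<forall>y v. \<bar>frechet_derivative \<eta> (at y) v\<bar> \<le> M * norm v \<and> (frechet_derivative \<eta> (at y) v \<noteq> 0 \<longrightarrow> norm y < 1))"
proof -
  define n where "n = real DIM('a)"
  have n: "n \<ge> 1" unfolding n_def by (simp add: DIM_ge_Suc0)
  define a where "a = 1 / (3 * n)"
  have a: "0 < a" "3 * (n * a) = 1" using n by (auto simp: a_def)
  define m :: 'a where "m = a *\<^sub>R One"
  define \<eta> :: "'a \<Rightarrow> real" where "\<eta> y = flat 0 (a\<^sup>2 + (-1) * ((y - m) \<bullet> (y - m)))" for y
  have sm: "smooth \<eta>"
    unfolding \<eta>_def[abs_def] by (intro allI C_k_compose_real[OF _ C_k_flat] C_k_add C_k_mult C_k_const smooth_dist_sq)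
  have supp: "y \<in> ball m a" if "\<eta> y \<noteq> 0" for y
  proof -
    have "(norm (y - m))\<^sup>2 < a\<^sup>2" using that by (auto simp: \<eta>_def flat_def power2_norm_eq_inner split: if_splits)
    then show ?thesis using a by (simp add: dist_norm norm_minus_commute power_less_imp_less_base)
  qed
  have mi: "m \<bullet> b = a" if "b \<in> Basis" for b using that by (simp add: m_def)
  have nm: "norm m \<le> n * a"
    using norm_le_l1[of m] a by (simp add: mi n_def)
  have cb: "norm y < 1 \<and> y \<in> cbox 0 One" if "y \<in> cball m a" for y
  proof
    have d: "norm (y - m) \<le> a" using that by (simp add: dist_norm norm_minus_commute)
    have an: "a \<le> n * a" using n a by simp
    have "norm y \<le> norm m + norm (y - m)" by (metis add.commute diff_add_cancel norm_triangle_ineq)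
    then show "norm y < 1" using d nm a an by linarith
    have "0 \<le> y \<bullet> b \<and> y \<bullet> b \<le> 1" if "b \<in> Basis" for b
    proof -
      have "\<bar>y \<bullet> b - a\<bar> \<le> a"
        using Basis_le_norm[OF that, of "y - m"] d mi[OF that] by (simp add: inner_diff_left)
      then show ?thesis using a an unfolding abs_le_iff by linarith
    qed
    then show "y \<in> cbox 0 One" by (simp add: mem_box)
  qed
  have fz: "frechet_derivative \<eta> (at y) v = 0" if "y \<notin> cball m a" for y v
  proof (rule frechet_zero_outside[OF closed_cball _ that])
    show "\<eta> x = 0" if "x \<notin> cball m a" for x using supp[of x] that by force
  qed
  have "bounded ((\<lambda>y. frechet_derivative \<eta> (at y) b) ` cball m a)" for b
  proof (rule compact_imp_bounded[OF compact_continuous_image])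
    show "continuous_on (cball m a) (\<lambda>y. frechet_derivative \<eta> (at y) b)"
      by (rule continuous_on_subset[OF smooth_continuous[OF smooth_frechet[OF sm]] subset_UNIV])
  qed (rule compact_cball)
  then have "\<exists>B>0. \<forall>y\<in>cball m a. \<bar>frechet_derivative \<eta> (at y) b\<bar> \<le> B" for b
    unfolding bounded_pos by simp
  then have "\<exists>B. \<forall>b. B b > 0 \<and> (\<forall>y\<in>cball m a. \<bar>frechet_derivative \<eta> (at y) b\<bar> \<le> B b)"
    by (intro choice) blast
  then obtain B where B: "\<And>b. B b > 0" "\<And>b y. y \<in> cball m a \<Longrightarrow> \<bar>frechet_derivative \<eta> (at y) b\<bar> \<le> B b"
    by blast
  have B2: "\<bar>frechet_derivative \<eta> (at y) b\<bar> \<le> B b" for b y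
    using B(1)[of b] B(2)[of y b] fz[of y b] by (cases "y \<in> cball m a") (auto simp: less_imp_le)
  define M where "M = 1 + (\<Sum>b\<in>Basis. B b)"
  have M1: "M \<ge> 1" unfolding M_def using sum_nonneg[of Basis B] B(1) by (simp add: less_imp_le)
  have bd: "\<bar>frechet_derivative \<eta> (at y) v\<bar> \<le> M * norm v" for y v
  proof -
    have lin: "linear (frechet_derivative \<eta> (at y))"
      using smooth_differentiable[OF sm] has_derivative_linear by blast
    have "\<bar>frechet_derivative \<eta> (at y) v\<bar> \<le> (\<Sum>b\<in>Basis. \<bar>v \<bullet> b\<bar> * \<bar>frechet_derivative \<eta> (at y) b\<bar>)"
      unfolding linear_Basis_expansion[OF lin, of v]
      by (simp only: abs_mult[symmetric] sum_abs)
    also have "\<dots> \<le> (\<Sum>b\<in>Basis. norm v * B b)"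
      by (intro sum_mono mult_mono Basis_le_norm B2) auto
    also have "\<dots> = (\<Sum>b\<in>Basis. B b) * norm v" by (simp add: sum_distrib_left sum_distrib_right mult.commute)
    also have "\<dots> \<le> M * norm v" by (simp add: M_def mult_right_mono)
    finally show ?thesis .
  qed
  show ?thesis
  proof (rule exI[of _ \<eta>], rule exI[of _ M], intro conjI allI impI exI[of _ m])
    show "C_k k \<eta>" for k using sm by blast
    show "0 \<le> \<eta> y" for y by (simp add: \<eta>_def flat_def)
    show "\<eta> y \<le> 1" for y by (simp add: \<eta>_def flat_def)
    show "0 < \<eta> m" using a by (simp add: \<eta>_def flat_def)
    show "1 \<le> M" by (fact M1)
    show "norm y < 1" "y \<in> cbox 0 One" if "\<eta> y \<noteq> 0" for y
      using subsetD[OF ball_subset_cball supp[OF that]] cb[of y] by blast+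
    show "\<bar>frechet_derivative \<eta> (at y) v\<bar> \<le> M * norm v" for y v by (fact bd)
    show "norm y < 1" if "frechet_derivative \<eta> (at y) v \<noteq> 0" for y v
      using fz[of y v] that cb[of y] by blast
  qed
qed

section \<open>Space-time means and their dependence on the radius\<close>

text \<open>
  If \<open>f\<close> is not integrable, its integral is zero by convention, so the second bound persists.
\<close>

lemma abs_integral_le_nn_integral_AE:
  fixes f g :: "'b \<Rightarrow> real"
  assumes "AE z in M. \<bar>f z\<bar> \<le> c * g z" "(\<integral>\<^sup>+z. ennreal (g z) \<partial>M) \<le> ennreal b" "g \<in> borel_measurable M" "0 \<le> c" "0 \<le> b"
  shows "(\<integral>\<^sup>+z. ennreal \<bar>f z\<bar> \<partial>M) \<le> ennreal (c * b)" "\<bar>\<integral>z. f z \<partial>M\<bar> \<le> c * b"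
proof -
  have "(\<integral>\<^sup>+z. ennreal \<bar>f z\<bar> \<partial>M) \<le> (\<integral>\<^sup>+z. ennreal c * ennreal (g z) \<partial>M)"
    using assms(1,4) by (intro nn_integral_mono_AE) (auto simp: ennreal_mult'[symmetric] intro!: ennreal_leI elim!: eventually_mono)
  also have "\<dots> = ennreal c * (\<integral>\<^sup>+z. ennreal (g z) \<partial>M)"
    using assms(3) by (intro nn_integral_cmult) auto
  also have "\<dots> \<le> ennreal c * ennreal b" by (intro mult_left_mono assms(2)) auto
  finally show 1: "(\<integral>\<^sup>+z. ennreal \<bar>f z\<bar> \<partial>M) \<le> ennreal (c * b)"
    using assms by (simp add: ennreal_mult'[symmetric])
  have "ennreal (norm (\<integral>z. f z \<partial>M)) \<le> (\<integral>\<^sup>+z. ennreal (norm (f z)) \<partial>M)"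
  proof (cases "integrable M f")
    case True then show ?thesis by (rule integral_norm_bound_ennreal)
  next
    case False then show ?thesis by (simp add: not_integrable_integral_eq)
  qed
  with 1 have "ennreal \<bar>\<integral>z. f z \<partial>M\<bar> \<le> ennreal (c * b)" unfolding real_norm_def by (rule order_trans[rotated])
  then show "\<bar>\<integral>z. f z \<partial>M\<bar> \<le> c * b" using assms by (subst (asm) ennreal_le_iff) auto
qed

lemma abs_integral_le_nn_integral:
  fixes f g :: "'b \<Rightarrow> real"
  assumes "\<And>z. \<bar>f z\<bar> \<le> c * g z" "(\<integral>\<^sup>+z. ennreal (g z) \<partial>M) \<le> ennreal b" "g \<in> borel_measurable M" "0 \<le> c" "0 \<le> b"
  shows "\<bar>\<integral>z. f z \<partial>M\<bar> \<le> c * b"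
  using assms by (intro abs_integral_le_nn_integral_AE(2)) auto

lemma integrable_scaleR_bounded:
  fixes g :: "'b \<Rightarrow> 'c::{banach, second_countable_topology}"
  assumes "integrable M g" "f \<in> borel_measurable M" "\<And>z. \<bar>f z\<bar> \<le> C"
  shows "integrable M (\<lambda>z. f z *\<^sub>R g z)"
proof (rule Bochner_Integration.integrable_bound[of M "\<lambda>z. C *\<^sub>R g z"])
  show "AE z in M. norm (f z *\<^sub>R g z) \<le> norm (C *\<^sub>R g z)"
  proof (rule AE_I2)
    fix z
    have "\<bar>f z\<bar> \<le> \<bar>C\<bar>" using assms(3)[of z] by linarith
    then show "norm (f z *\<^sub>R g z) \<le> norm (C *\<^sub>R g z)" by (simp add: mult_right_mono)
  qed
qed (use assms in auto)

lemma integrable_mult_bounded: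
  fixes v f :: "'b \<Rightarrow> real"
  assumes "integrable M v" "f \<in> borel_measurable M" "\<And>z. \<bar>f z\<bar> \<le> C"
  shows "integrable M (\<lambda>z. v z * f z)"
  using integrable_scaleR_bounded[OF assms] by (simp add: mult.commute)

lemma cylinder_measurable: "ball x \<rho> \<times> {a<..<b} \<in> sets (lebesgue :: ('a::euclidean_space \<times> real) measure)"
  by (intro sets_completionI_sets) (auto intro!: borel_open open_Times)

text \<open>
  The difference quotients are dominated by \<open>B |v|\<close>, by the mean value theorem.
\<close>

lemma DERIV_lebesgue_integral:
  fixes k k' :: "real \<Rightarrow> 'b \<Rightarrow> real"
  assumes v: "integrable M v" and \<rho>: "\<rho> \<in> {a<..<b}"
    and d: "\<And>s z. s \<in> {a<..<b} \<Longrightarrow> ((\<lambda>s. k s z) has_real_derivative k' s z) (at s)"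
    and bnd: "\<And>s z. s \<in> {a<..<b} \<Longrightarrow> \<bar>k' s z\<bar> \<le> B"
    and meas: "\<And>s. s \<in> {a<..<b} \<Longrightarrow> k s \<in> borel_measurable M" "k' \<rho> \<in> borel_measurable M"
    and bk: "\<And>s z. s \<in> {a<..<b} \<Longrightarrow> \<bar>k s z\<bar> \<le> C"
  shows "((\<lambda>s. \<integral>z. v z * k s z \<partial>M) has_real_derivative (\<integral>z. v z * k' \<rho> z \<partial>M)) (at \<rho>)"
proof -
  let ?F = "\<lambda>s. \<integral>z. v z * k s z \<partial>M"
  note [measurable] = borel_measurable_integrable[OF v]
  have int: "integrable M (\<lambda>z. v z * k s z)" if "s \<in> {a<..<b}" for s
    by (rule integrable_mult_bounded[OF v meas(1)[OF that] bk[OF that]])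
  have "((\<lambda>y. (?F y - ?F \<rho>) / (y - \<rho>)) \<longlongrightarrow> (\<integral>z. v z * k' \<rho> z \<partial>M)) (at \<rho> within {a<..<b})"
    unfolding tendsto_at_iff_sequentially comp_def
  proof (intro allI impI)
    fix X assume X: "\<forall>i. X i \<in> {a<..<b} - {\<rho>}" "X \<longlonglongrightarrow> \<rho>"
    have "(\<lambda>i. \<integral>z. v z * ((k (X i) z - k \<rho> z) / (X i - \<rho>)) \<partial>M) \<longlonglongrightarrow> (\<integral>z. v z * k' \<rho> z \<partial>M)"
    proof (rule integral_dominated_convergence[where w="\<lambda>z. \<bar>B\<bar> * \<bar>v z\<bar>"])
      have [measurable]: "k (X i) \<in> borel_measurable M" "k \<rho> \<in> borel_measurable M" "k' \<rho> \<in> borel_measurable M" for i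
        using X \<rho> meas by auto
      show "(\<lambda>z. v z * k' \<rho> z) \<in> borel_measurable M" by measurable
      show "(\<lambda>z. v z * ((k (X i) z - k \<rho> z) / (X i - \<rho>))) \<in> borel_measurable M" for i by measurable
      show "integrable M (\<lambda>z. \<bar>B\<bar> * \<bar>v z\<bar>)" using v by simp
      show "AE z in M. (\<lambda>i. v z * ((k (X i) z - k \<rho> z) / (X i - \<rho>))) \<longlonglongrightarrow> v z * k' \<rho> z"
      proof (intro AE_I2 tendsto_mult tendsto_const)
        fix z
        have "((\<lambda>y. (k y z - k \<rho> z) / (y - \<rho>)) \<longlongrightarrow> k' \<rho> z) (at \<rho>)"
          using d[OF \<rho>, of z] by (simp add: has_field_derivative_iff)
        moreover have "filterlim X (at \<rho>) sequentially"
          using X by (auto simp: filterlim_at)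
        ultimately show "(\<lambda>i. (k (X i) z - k \<rho> z) / (X i - \<rho>)) \<longlonglongrightarrow> k' \<rho> z"
          by (rule filterlim_compose)
      qed
      show "AE z in M. norm (v z * ((k (X i) z - k \<rho> z) / (X i - \<rho>))) \<le> \<bar>B\<bar> * \<bar>v z\<bar>" for i
      proof (rule AE_I2)
        fix z
        have Xi: "X i \<in> {a<..<b}" "X i \<noteq> \<rho>" using X by auto
        have "norm (k (X i) z - k \<rho> z) \<le> B * norm (X i - \<rho>)"
          by (rule field_differentiable_bound[of "{a<..<b}" "\<lambda>s. k s z" "\<lambda>s. k' s z"])
             (use Xi \<rho> d bnd in \<open>auto intro: has_field_derivative_at_within\<close>)
        then have "\<bar>(k (X i) z - k \<rho> z) / (X i - \<rho>)\<bar> \<le> B"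
          using Xi by (simp add: field_simps)
        then have "\<bar>(k (X i) z - k \<rho> z) / (X i - \<rho>)\<bar> \<le> \<bar>B\<bar>" by linarith
        then have "\<bar>v z\<bar> * \<bar>(k (X i) z - k \<rho> z) / (X i - \<rho>)\<bar> \<le> \<bar>v z\<bar> * \<bar>B\<bar>"
          by (rule mult_left_mono) simp
        then show "norm (v z * ((k (X i) z - k \<rho> z) / (X i - \<rho>))) \<le> \<bar>B\<bar> * \<bar>v z\<bar>"
          by (simp only: real_norm_def abs_mult mult.commute)
      qed
    qed
    moreover have "(\<integral>z. v z * ((k (X i) z - k \<rho> z) / (X i - \<rho>)) \<partial>M) = (?F (X i) - ?F \<rho>) / (X i - \<rho>)" for i
    proof -
      have "(\<integral>z. v z * ((k (X i) z - k \<rho> z) / (X i - \<rho>)) \<partial>M) = (\<integral>z. (v z * k (X i) z - v z * k \<rho> z) / (X i - \<rho>) \<partial>M)"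
        by (simp add: right_diff_distrib)
      also have "\<dots> = (?F (X i) - ?F \<rho>) / (X i - \<rho>)"
        using int[of "X i"] int[OF \<rho>] X(1) by (simp only: integral_divide_zero Bochner_Integration.integral_diff Diff_iff)
      finally show ?thesis .
    qed
    ultimately show "(\<lambda>i. (?F (X i) - ?F \<rho>) / (X i - \<rho>)) \<longlonglongrightarrow> (\<integral>z. v z * k' \<rho> z \<partial>M)" by (simp only:)
  qed
  then show ?thesis
    using \<rho> at_within_open[of \<rho> "{a<..<b}"] by (simp add: has_field_derivative_iff)
qed

lemma continuous_imp_lebesgue_measurable:
  fixes f :: "'a::euclidean_space \<Rightarrow> 'b::euclidean_space"
  shows "continuous_on UNIV f \<Longrightarrow> f \<in> borel_measurable lebesgue"
  by (intro measurable_completion) (simp add: borel_measurable_continuous_onI)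

lemma test_fun_bounded_derivative:
  assumes "test_fun U f" shows "\<exists>C. \<forall>y. \<bar>frechet_derivative f (at y) b\<bar> \<le> C"
proof -
  let ?K = "closure {y. f y \<noteq> 0}"
  have K: "compact ?K" and f: "smooth f" using assms by (auto simp: test_fun_def compactly_contained_def)
  have "continuous_on ?K (\<lambda>y. frechet_derivative f (at y) b)"
    by (rule continuous_on_subset[OF smooth_continuous[OF smooth_frechet[OF f]] subset_UNIV])
  then have "bounded ((\<lambda>y. frechet_derivative f (at y) b) ` ?K)"
    by (intro compact_imp_bounded compact_continuous_image K)
  then obtain C where C: "C > 0" "\<And>y. y \<in> ?K \<Longrightarrow> \<bar>frechet_derivative f (at y) b\<bar> \<le> C"
    unfolding bounded_pos by auto
  have "frechet_derivative f (at y) b = 0" if "y \<notin> ?K" for y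
    by (rule frechet_zero_outside[OF closed_closure _ that]) (use closure_subset[of "{y. f y \<noteq> 0}"] in blast)
  with C have "\<bar>frechet_derivative f (at y) b\<bar> \<le> C" for y by (cases "y \<in> ?K") auto
  then show ?thesis by blast
qed

lemma test_fun_bounded: "test_fun U f \<Longrightarrow> \<exists>C. \<forall>y. \<bar>f y\<bar> \<le> C"
proof -
  assume "test_fun U f"
  let ?K = "closure {y. f y \<noteq> 0}"
  have K: "compact ?K" and f: "smooth f" using \<open>test_fun U f\<close> by (auto simp: test_fun_def compactly_contained_def)
  have "bounded (f ` ?K)"
    by (intro compact_imp_bounded compact_continuous_image K continuous_on_subset[OF smooth_continuous[OF f] subset_UNIV])
  then obtain C where C: "C > 0" "\<And>y. y \<in> ?K \<Longrightarrow> \<bar>f y\<bar> \<le> C"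
    unfolding bounded_pos by auto
  have "\<bar>f y\<bar> \<le> C" for y
    using C(1) C(2)[of y] closure_subset[of "{y. f y \<noteq> 0}"] by (cases "f y = 0") auto
  then show ?thesis by blast
qed

lemma grad_inner_Basis: "b \<in> Basis \<Longrightarrow> grad f x \<bullet> b = frechet_derivative f (at x) b"
  by (simp add: grad_def inner_sum_left inner_Basis if_distrib sum.delta cong: if_cong)

lemma test_fun_compactI:
  assumes "smooth f" "\<And>y. f y \<noteq> 0 \<Longrightarrow> y \<in> K" "compact K" "K \<subseteq> U"
  shows "test_fun U f"
proof -
  have s: "closure {y. f y \<noteq> 0} \<subseteq> K"
    by (rule closure_minimal) (use assms(2,3) in \<open>auto simp: compact_imp_closed\<close>)
  have "bounded {y. f y \<noteq> 0}" by (rule bounded_subset[OF compact_imp_bounded[OF assms(3)]]) (use assms(2) in blast)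
  then have "compact (closure {y. f y \<noteq> 0})" by (simp only: compact_closure)
  with s assms(1,4) show ?thesis unfolding test_fun_def compactly_contained_def by blast
qed

text \<open>
  A spatial cutoff \<open>\<eta>\<close>, a temporal cutoff \<open>\<kappa>\<close> and a Lipschitz constant of \<open>\<eta>\<close>. All constants of the
  estimate are built from these and from the dimension.
\<close>

locale bumps =
  fixes \<eta> :: "'a::euclidean_space \<Rightarrow> real" and \<kappa> :: "real \<Rightarrow> real" and M :: real
  assumes \<eta>: "smooth \<eta>" "\<And>y. 0 \<le> \<eta> y" "\<And>y. \<eta> y \<le> 1" "\<exists>y. 0 < \<eta> y" "1 \<le> M"
    "\<And>y. \<eta> y \<noteq> 0 \<Longrightarrow> norm y < 1 \<and> y \<in> cbox 0 One"
    "\<And>y v. \<bar>frechet_derivative \<eta> (at y) v\<bar> \<le> M * norm v"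
    "\<And>y v. frechet_derivative \<eta> (at y) v \<noteq> 0 \<Longrightarrow> norm y < 1"
  and \<kappa>: "smooth \<kappa>" "\<And>s. 0 \<le> \<kappa> s" "\<And>s. \<kappa> s \<le> 1" "\<exists>s. 0 < \<kappa> s"
    "\<And>s. \<kappa> s \<noteq> 0 \<Longrightarrow> 0 \<le> s \<and> s < 1"
begin

definition space_kernel :: "real \<Rightarrow> 'a \<Rightarrow> 'a \<Rightarrow> real" where
  "space_kernel \<rho> x y = inverse \<rho> ^ DIM('a) * \<eta> (inverse \<rho> *\<^sub>R (y - x))"

definition time_kernel :: "real \<Rightarrow> real \<Rightarrow> real \<Rightarrow> real" where
  "time_kernel \<epsilon> t \<tau> = inverse \<epsilon> * \<kappa> (inverse \<epsilon> * (\<tau> - t))"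

definition mean :: "('a \<times> real \<Rightarrow> real) \<Rightarrow> real \<Rightarrow> real \<Rightarrow> 'a \<Rightarrow> real \<Rightarrow> real" where
  "mean v \<rho> \<epsilon> x t = (\<integral>z. v z * (space_kernel \<rho> x (fst z) * time_kernel \<epsilon> t (snd z)) \<partial>lebesgue)"

text \<open>
  The component in direction \<open>b\<close> of the vector field whose divergence is minus the derivative of
  \<open>space_kernel\<close> with respect to the radius.
\<close>

definition dilation_field :: "real \<Rightarrow> 'a \<Rightarrow> 'a \<Rightarrow> 'a \<Rightarrow> real" where
  "dilation_field \<rho> x b y = ((y - x) \<bullet> b) * (inverse \<rho> ^ (DIM('a) + 1) * \<eta> (inverse \<rho> *\<^sub>R (y - x)))"

definition dilation_div :: "real \<Rightarrow> 'a \<Rightarrow> 'a \<Rightarrow> real" where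
  "dilation_div \<rho> x y = real DIM('a) * inverse \<rho> ^ (DIM('a) + 1) * \<eta> (inverse \<rho> *\<^sub>R (y - x))
     + inverse \<rho> ^ (DIM('a) + 2) * frechet_derivative \<eta> (at (inverse \<rho> *\<^sub>R (y - x))) (y - x)"

lemma smooth_scaled:
  "smooth f \<Longrightarrow> smooth (\<lambda>y::'a. f (c *\<^sub>R (y - x)))"
  using C_k_affine[OF bounded_linear_scaleR_right[of c], of _ f "- (c *\<^sub>R x)"]
  by (simp add: scaleR_diff_right)

lemma support_scaled: "0 < \<rho> \<Longrightarrow> \<eta> (inverse \<rho> *\<^sub>R (y - x)) \<noteq> 0 \<Longrightarrow> y \<in> ball x \<rho>"
  using \<eta>(6)[of "inverse \<rho> *\<^sub>R (y - x)"] by (simp add: dist_norm norm_minus_commute divide_simps)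

lemma smooth_space_kernel: "smooth (space_kernel \<rho> x)"
  unfolding space_kernel_def[abs_def] using smooth_scaled[OF \<eta>(1)] by (auto intro!: C_k_mult C_k_const)

lemma smooth_dilation_field: "smooth (dilation_field \<rho> x b)"
proof -
  have "(\<lambda>y::'a. (y - x) \<bullet> b) = (\<lambda>y. - (x \<bullet> b) + y \<bullet> b)" by (simp add: inner_diff_left)
  then have "C_k k (\<lambda>y::'a. (y - x) \<bullet> b)" for k
    using C_k_add[OF C_k_const[of k "- (x \<bullet> b)"] C_k_linear[OF bounded_linear_inner_left[of b]]] by simp
  then show ?thesis unfolding dilation_field_def[abs_def] using smooth_scaled[OF \<eta>(1)] by (auto intro!: C_k_mult C_k_const)
qed

lemma test_fun_ballI:
  assumes "smooth f" "\<And>y. f y \<noteq> 0 \<Longrightarrow> y \<in> cball x \<rho>" "cball x \<rho> \<subseteq> (U :: 'a set)"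
  shows "test_fun U f"
  by (rule test_fun_compactI[OF assms(1,2) compact_cball assms(3)])

lemma \<eta>_derivative: "(\<eta> has_derivative frechet_derivative \<eta> (at y)) (at y)"
  using smooth_differentiable[OF \<eta>(1)] .

lemma D\<eta>_linear: "linear (frechet_derivative \<eta> (at y))"
  using \<eta>_derivative has_derivative_linear by blast

lemma divergence_dilation_field:
  assumes "0 < \<rho>" shows "(\<Sum>b\<in>Basis. grad (dilation_field \<rho> x b) y \<bullet> b) = dilation_div \<rho> x y"
proof -
  let ?c = "inverse \<rho>" and ?D = "frechet_derivative \<eta> (at (inverse \<rho> *\<^sub>R (y - x)))"
  have d: "((\<lambda>y. \<eta> (?c *\<^sub>R (y - x))) has_derivative (\<lambda>v. ?D (?c *\<^sub>R v))) (at y)"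
    by (rule has_derivative_compose[OF _ \<eta>_derivative]) (auto intro!: derivative_eq_intros)
  have "frechet_derivative (dilation_field \<rho> x b) (at y) b =
      ?c ^ (DIM('a) + 1) * \<eta> (?c *\<^sub>R (y - x)) + ((y - x) \<bullet> b) * (?c ^ (DIM('a) + 2) * ?D b)" if "b \<in> Basis" for b
  proof -
    have "(dilation_field \<rho> x b has_derivative (\<lambda>v. ((y - x) \<bullet> b) * (?c ^ (DIM('a) + 1) * ?D (?c *\<^sub>R v))
        + (v \<bullet> b) * (?c ^ (DIM('a) + 1) * \<eta> (?c *\<^sub>R (y - x))))) (at y)"
      unfolding dilation_field_def[abs_def]
      by (rule has_derivative_mult) (auto intro!: derivative_eq_intros d)
    from frechet_derivative_eqI[OF this, of b] show ?thesis
      using that linear_cmul[OF D\<eta>_linear] by simp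
  qed
  then have "(\<Sum>b\<in>Basis. grad (dilation_field \<rho> x b) y \<bullet> b) =
     (\<Sum>b\<in>Basis. ?c ^ (DIM('a) + 1) * \<eta> (?c *\<^sub>R (y - x)) + ((y - x) \<bullet> b) * (?c ^ (DIM('a) + 2) * ?D b))"
    by (intro sum.cong refl) (simp add: grad_inner_Basis)
  also have "\<dots> = real DIM('a) * (?c ^ (DIM('a) + 1) * \<eta> (?c *\<^sub>R (y - x))) + ?c ^ (DIM('a) + 2) * (\<Sum>b\<in>Basis. ((y - x) \<bullet> b) * ?D b)"
    by (simp only: sum.distrib sum_constant) (simp add: sum_distrib_left mult.left_commute)
  also have "(\<Sum>b\<in>Basis. ((y - x) \<bullet> b) * ?D b) = ?D (y - x)"
    by (rule linear_Basis_expansion[OF D\<eta>_linear, symmetric])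
  finally show ?thesis by (simp only: dilation_div_def mult.assoc)
qed

lemma space_kernel_derivative:
  assumes "0 < \<rho>" shows "((\<lambda>\<rho>. space_kernel \<rho> x y) has_real_derivative - dilation_div \<rho> x y) (at \<rho>)"
proof -
  let ?c = "inverse \<rho>" and ?D = "frechet_derivative \<eta> (at (inverse \<rho> *\<^sub>R (y - x)))"
  have "((\<lambda>\<rho>. \<eta> (inverse \<rho> *\<^sub>R (y - x))) has_derivative (\<lambda>h. ?D ((- (?c * h * ?c)) *\<^sub>R (y - x)))) (at \<rho>)"
    by (rule has_derivative_compose[OF _ \<eta>_derivative]) (use assms in \<open>auto intro!: derivative_eq_intros\<close>)
  moreover have "(\<lambda>h. ?D ((- (?c * h * ?c)) *\<^sub>R (y - x))) = (*) (- (?c ^ 2 * ?D (y - x)))"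
    by (simp only: linear_cmul[OF D\<eta>_linear] real_scaleR_def fun_eq_iff power2_eq_square) (simp add: algebra_simps)
  ultimately have d: "((\<lambda>\<rho>. \<eta> (inverse \<rho> *\<^sub>R (y - x))) has_real_derivative - (?c ^ 2 * ?D (y - x))) (at \<rho>)"
    by (simp add: has_field_derivative_def)
  have e: "?c ^ (DIM('a) - Suc 0) * ?c = ?c ^ DIM('a)"
    using power_Suc2[of ?c "DIM('a) - Suc 0"] by (simp del: power_Suc)
  have "((\<lambda>\<rho>. inverse \<rho> ^ DIM('a)) has_real_derivative - (real DIM('a) * ?c ^ (DIM('a) + 1))) (at \<rho>)"
    using assms by (auto intro!: derivative_eq_intros simp: e[symmetric])
  note deriv = DERIV_mult[OF this d]
  define E D where "E = \<eta> (?c *\<^sub>R (y - x))" and "D = ?D (y - x)"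
  have eq: "- (real DIM('a) * ?c ^ (DIM('a) + 1)) * E + - (?c ^ 2 * D) * ?c ^ DIM('a) = - dilation_div \<rho> x y"
    unfolding dilation_div_def E_def[symmetric] D_def[symmetric] by (simp add: power_add power2_eq_square algebra_simps)
  show ?thesis using deriv unfolding space_kernel_def E_def[symmetric] D_def[symmetric] eq .
qed

lemma dilation_div_bound:
  assumes "0 < \<rho>" shows "\<bar>dilation_div \<rho> x y\<bar> \<le> (real DIM('a) + M) * inverse \<rho> ^ (DIM('a) + 1)"
proof -
  let ?c = "inverse \<rho>" and ?D = "frechet_derivative \<eta> (at (inverse \<rho> *\<^sub>R (y - x)))"
  have "\<bar>?D (y - x)\<bar> \<le> M * \<rho>"
  proof (cases "?D (y - x) = 0")
    case False
    then have "norm (inverse \<rho> *\<^sub>R (y - x)) < 1" by (rule \<eta>(8))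
    then have "norm (y - x) \<le> \<rho>" using assms by (simp add: divide_simps)
    then have "M * norm (y - x) \<le> M * \<rho>" using \<eta>(5) by (intro mult_left_mono) auto
    then show ?thesis using \<eta>(7) order_trans by blast
  qed (use \<eta>(5) assms in auto)
  then have "\<bar>?c ^ (DIM('a) + 2) * ?D (y - x)\<bar> \<le> ?c ^ (DIM('a) + 2) * (M * \<rho>)"
    using assms by (simp add: abs_mult)
  also have "\<dots> = M * ?c ^ (DIM('a) + 1)" using assms by (simp add: field_simps)
  finally have 1: "\<bar>?c ^ (DIM('a) + 2) * ?D (y - x)\<bar> \<le> M * ?c ^ (DIM('a) + 1)" .
  have "\<bar>real DIM('a) * ?c ^ (DIM('a) + 1) * \<eta> (?c *\<^sub>R (y - x))\<bar> \<le> real DIM('a) * ?c ^ (DIM('a) + 1) * 1"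
    using assms \<eta>(2,3) by (simp add: abs_mult mult_left_le)
  then show ?thesis using 1 unfolding dilation_div_def by (auto simp: distrib_right)
qed

lemma time_kernel_bound: "0 < \<epsilon> \<Longrightarrow> \<bar>time_kernel \<epsilon> t \<tau>\<bar> \<le> inverse \<epsilon>"
  using \<kappa>(2,3) by (simp add: time_kernel_def abs_mult mult_left_le)

lemma time_kernel_support: "0 < \<epsilon> \<Longrightarrow> time_kernel \<epsilon> t \<tau> \<noteq> 0 \<Longrightarrow> t \<le> \<tau> \<and> \<tau> < t + \<epsilon>"
  using \<kappa>(5)[of "inverse \<epsilon> * (\<tau> - t)"] by (auto simp: time_kernel_def divide_simps split: if_splits)

lemma space_kernel_bound: "0 < \<rho> \<Longrightarrow> \<bar>space_kernel \<rho> x y\<bar> \<le> inverse \<rho> ^ DIM('a)"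
  using \<eta>(2,3) by (simp add: space_kernel_def abs_mult mult_left_le)

lemma continuous_time_kernel: "continuous_on UNIV (time_kernel \<epsilon> t)"
  unfolding time_kernel_def[abs_def]
  by (intro continuous_intros continuous_on_compose2[OF smooth_continuous[OF \<kappa>(1)]]) auto

lemma continuous_dilation_div: "0 < \<rho> \<Longrightarrow> continuous_on UNIV (dilation_div \<rho> x)"
proof -
  assume "0 < \<rho>"
  have "continuous_on UNIV (\<lambda>y. frechet_derivative (dilation_field \<rho> x b) (at y) b)" for b
    by (intro smooth_continuous smooth_frechet smooth_dilation_field)
  then have "continuous_on UNIV (\<lambda>y. \<Sum>b\<in>Basis. grad (dilation_field \<rho> x b) y \<bullet> b)"
    unfolding grad_def by (intro continuous_intros)
       (use smooth_continuous[OF smooth_frechet[OF smooth_dilation_field]] in auto)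
  then show ?thesis using divergence_dilation_field[OF \<open>0 < \<rho>\<close>] by simp
qed

lemma measurable_kernels [measurable]:
  "(\<lambda>z::'a \<times> real. space_kernel \<rho> x (fst z)) \<in> borel_measurable lebesgue"
  "(\<lambda>z::'a \<times> real. time_kernel \<epsilon> t (snd z)) \<in> borel_measurable lebesgue"
  "(\<lambda>z::'a \<times> real. dilation_field \<rho> x b (fst z)) \<in> borel_measurable lebesgue"
  "0 < \<rho> \<Longrightarrow> (\<lambda>z::'a \<times> real. dilation_div \<rho> x (fst z)) \<in> borel_measurable lebesgue"
  by (auto intro!: continuous_imp_lebesgue_measurable continuous_intros
      continuous_on_compose2[OF smooth_continuous[OF smooth_space_kernel] _ subset_UNIV]
      continuous_on_compose2[OF smooth_continuous[OF smooth_dilation_field] _ subset_UNIV]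
      continuous_on_compose2[OF continuous_dilation_div _ subset_UNIV]
      continuous_on_compose2[OF continuous_time_kernel _ subset_UNIV])


lemma mean_derivative:
  assumes "integrable lebesgue v" "0 < \<rho>" "0 < \<epsilon>"
  shows "((\<lambda>\<rho>. mean v \<rho> \<epsilon> x t) has_real_derivative
     (\<integral>z. v z * (- dilation_div \<rho> x (fst z) * time_kernel \<epsilon> t (snd z)) \<partial>lebesgue)) (at \<rho>)"
  unfolding mean_def
proof (rule DERIV_lebesgue_integral[OF assms(1), where a="\<rho>/2" and b="2*\<rho>"])
  let ?r = "inverse (\<rho>/2)"
  fix s :: real and z :: "'a \<times> real" assume s: "s \<in> {\<rho>/2<..<2*\<rho>}"
  then have s0: "0 < s" using assms by auto
  have sr: "inverse s \<le> ?r" using s assms by (intro le_imp_inverse_le) auto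
  have "\<bar>dilation_div s x (fst z)\<bar> \<le> (real DIM('a) + M) * inverse s ^ (DIM('a) + 1)"
    by (rule dilation_div_bound[OF s0])
  also have "\<dots> \<le> (real DIM('a) + M) * ?r ^ (DIM('a) + 1)"
    using sr s0 \<eta>(5) by (intro mult_left_mono power_mono) auto
  finally show "\<bar>- dilation_div s x (fst z) * time_kernel \<epsilon> t (snd z)\<bar> \<le> (real DIM('a) + M) * ?r ^ (DIM('a) + 1) * inverse \<epsilon>"
    unfolding abs_mult abs_minus_cancel using time_kernel_bound[OF assms(3)] by (intro mult_mono) auto
  have "\<bar>space_kernel s x (fst z)\<bar> \<le> inverse s ^ DIM('a)" by (rule space_kernel_bound[OF s0])
  also have "\<dots> \<le> ?r ^ DIM('a)" using sr s0 by (intro power_mono) auto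
  finally show "\<bar>space_kernel s x (fst z) * time_kernel \<epsilon> t (snd z)\<bar> \<le> ?r ^ DIM('a) * inverse \<epsilon>"
    unfolding abs_mult using time_kernel_bound[OF assms(3)] by (intro mult_mono) auto
  show "((\<lambda>s. space_kernel s x (fst z) * time_kernel \<epsilon> t (snd z)) has_real_derivative
          - dilation_div s x (fst z) * time_kernel \<epsilon> t (snd z)) (at s)"
    by (rule DERIV_cmult_right[OF space_kernel_derivative[OF s0]])
next
  show "(\<lambda>z. - dilation_div \<rho> x (fst z) * time_kernel \<epsilon> t (snd z)) \<in> borel_measurable lebesgue"
    using assms by measurable
qed (use assms in \<open>auto intro!: borel_measurable_times measurable_kernels\<close>)

text \<open>
  The derivative of the mean in the radius is an integral of \<open>v\<close> against a divergence. Moved onto \<open>v\<close> by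
  the weak gradient, it becomes an integral of \<open>G \<bullet> (y - x)\<close> against \<open>\<sigma>\<^sup>-\<^sup>n\<^sup>-\<^sup>1\<close> times the cutoff, where
  \<open>|y - x| \<le> \<sigma>\<close>; so it is bounded by the average of \<open>|G|\<close> over the cylinder of radius \<open>\<sigma>\<close>.
  Integrate from \<open>\<epsilon>\<close> to \<open>\<rho>\<close>.
\<close>

lemma spatial_oscillation:
  fixes G :: "'a \<times> real \<Rightarrow> 'a"
  assumes v: "integrable lebesgue v" and G: "integrable lebesgue G" and \<epsilon>: "0 < \<epsilon>" "\<epsilon> \<le> \<rho>"
    and wg: "\<And>\<psi> \<theta> b. test_fun U \<psi> \<Longrightarrow> continuous_on UNIV \<theta> \<Longrightarrow> (\<exists>C. \<forall>s. \<bar>\<theta> s\<bar> \<le> C) \<Longrightarrow> b \<in> Basis \<Longrightarrow>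
       (\<integral>z. v z * (\<theta> (snd z) * (grad \<psi> (fst z) \<bullet> b)) \<partial>lebesgue) = - (\<integral>z. (G z \<bullet> b) * (\<theta> (snd z) * \<psi> (fst z)) \<partial>lebesgue)"
    and U: "cball x \<rho> \<subseteq> U"
    and bd: "\<And>\<sigma>. \<epsilon> \<le> \<sigma> \<Longrightarrow> \<sigma> \<le> \<rho> \<Longrightarrow>
       (\<integral>\<^sup>+z. ennreal (norm (G z) * indicator (ball x \<sigma> \<times> {t-\<epsilon><..<t+\<epsilon>}) z) \<partial>lebesgue) \<le> ennreal (B * (\<sigma> ^ DIM('a) * \<epsilon>))"
    and B: "0 \<le> B"
  shows "\<bar>mean v \<rho> \<epsilon> x t - mean v \<epsilon> \<epsilon> x t\<bar> \<le> B * (\<rho> - \<epsilon>)"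
proof -
  note [measurable] = borel_measurable_integrable[OF v] borel_measurable_integrable[OF G]
  have bd': "\<bar>\<integral>z. v z * (- dilation_div \<sigma> x (fst z) * time_kernel \<epsilon> t (snd z)) \<partial>lebesgue\<bar> \<le> B" if s: "\<epsilon> \<le> \<sigma>" "\<sigma> \<le> \<rho>" for \<sigma>
  proof -
    have s0: "0 < \<sigma>" using s \<epsilon> by linarith
    let ?k = "time_kernel \<epsilon> t"
    have tf: "test_fun U (dilation_field \<sigma> x b)" for b
    proof (rule test_fun_ballI[OF smooth_dilation_field])
      show "y \<in> cball x \<sigma>" if "dilation_field \<sigma> x b y \<noteq> 0" for y
        using that support_scaled[OF s0, of y x] by (auto simp: dilation_field_def)
      show "cball x \<sigma> \<subseteq> U" using U s by auto
    qed
    have kb: "\<exists>C. \<forall>s. \<bar>?k s\<bar> \<le> C" using time_kernel_bound[OF \<epsilon>(1)] by blast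
    have i1: "integrable lebesgue (\<lambda>z. v z * (?k (snd z) * (grad (dilation_field \<sigma> x b) (fst z) \<bullet> b)))" if b: "b \<in> Basis" for b
    proof -
      obtain C where C: "\<And>y. \<bar>frechet_derivative (dilation_field \<sigma> x b) (at y) b\<bar> \<le> C"
        using test_fun_bounded_derivative[OF tf] by blast
      have [measurable]: "(\<lambda>z::'a \<times> real. frechet_derivative (dilation_field \<sigma> x b) (at (fst z)) b) \<in> borel_measurable lebesgue"
        by (intro continuous_imp_lebesgue_measurable continuous_intros
           continuous_on_compose2[OF smooth_continuous[OF smooth_frechet[OF smooth_dilation_field]] _ subset_UNIV])
      show ?thesis
      proof (rule integrable_mult_bounded[OF v])
        show "\<bar>?k (snd z) * (grad (dilation_field \<sigma> x b) (fst z) \<bullet> b)\<bar> \<le> inverse \<epsilon> * C" for z :: "'a \<times> real"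
          unfolding abs_mult using time_kernel_bound[OF \<epsilon>(1)] C \<epsilon> by (intro mult_mono) (auto simp: grad_inner_Basis b)
      qed (simp add: grad_inner_Basis b)
    qed
    have i2: "integrable lebesgue (\<lambda>z. (G z \<bullet> b) * (?k (snd z) * dilation_field \<sigma> x b (fst z)))" for b
    proof -
      obtain C where C: "\<And>y. \<bar>dilation_field \<sigma> x b y\<bar> \<le> C" using test_fun_bounded[OF tf] by blast
      show ?thesis
      proof (rule integrable_mult_bounded)
        show "\<bar>?k (snd z) * dilation_field \<sigma> x b (fst z)\<bar> \<le> inverse \<epsilon> * C" for z :: "'a \<times> real"
          unfolding abs_mult using time_kernel_bound[OF \<epsilon>(1)] C \<epsilon> by (intro mult_mono) auto
      qed (use G in auto)
    qed
    have "(\<integral>z. v z * (- dilation_div \<sigma> x (fst z) * ?k (snd z)) \<partial>lebesgue)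
        = (\<integral>z. - (\<Sum>b\<in>Basis. v z * (?k (snd z) * (grad (dilation_field \<sigma> x b) (fst z) \<bullet> b))) \<partial>lebesgue)"
      unfolding divergence_dilation_field[OF s0, symmetric] by (simp add: sum_distrib_left sum_distrib_right mult_ac)
    also have "\<dots> = - (\<Sum>b\<in>Basis. \<integral>z. v z * (?k (snd z) * (grad (dilation_field \<sigma> x b) (fst z) \<bullet> b)) \<partial>lebesgue)"
      using i1 by (simp only: integral_minus Bochner_Integration.integral_sum)
    also have "\<dots> = (\<Sum>b\<in>Basis. \<integral>z. (G z \<bullet> b) * (?k (snd z) * dilation_field \<sigma> x b (fst z)) \<partial>lebesgue)"
      using wg[OF tf continuous_time_kernel kb] by (simp add: sum_negf)
    also have "\<dots> = (\<integral>z. (\<Sum>b\<in>Basis. (G z \<bullet> b) * (?k (snd z) * dilation_field \<sigma> x b (fst z))) \<partial>lebesgue)"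
      using i2 by (simp only: Bochner_Integration.integral_sum)
    finally have eq: "(\<integral>z. v z * (- dilation_div \<sigma> x (fst z) * ?k (snd z)) \<partial>lebesgue) = \<dots>" .
    have "\<bar>\<integral>z. (\<Sum>b\<in>Basis. (G z \<bullet> b) * (?k (snd z) * dilation_field \<sigma> x b (fst z))) \<partial>lebesgue\<bar>
        \<le> (inverse \<sigma> ^ DIM('a) * inverse \<epsilon>) * (B * (\<sigma> ^ DIM('a) * \<epsilon>))"
    proof (rule abs_integral_le_nn_integral[OF _ bd[OF s]])
      fix z :: "'a \<times> real"
      obtain y \<tau> where z: "z = (y, \<tau>)" by fastforce
      let ?e = "inverse \<sigma> ^ (DIM('a) + 1) * \<eta> (inverse \<sigma> *\<^sub>R (y - x))"
      have "(\<Sum>b\<in>Basis. (G z \<bullet> b) * (?k (snd z) * dilation_field \<sigma> x b (fst z))) = (G z \<bullet> (y - x)) * (?k \<tau> * ?e)"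
        unfolding z dilation_field_def by (subst euclidean_inner[of _ "y - x"]) (simp add: sum_distrib_left sum_distrib_right mult_ac)
      moreover have "\<bar>(G z \<bullet> (y - x)) * (?k \<tau> * ?e)\<bar> \<le> inverse \<sigma> ^ DIM('a) * inverse \<epsilon> * (norm (G z) * indicator (ball x \<sigma> \<times> {t-\<epsilon><..<t+\<epsilon>}) z)"
      proof (cases "?k \<tau> = 0 \<or> ?e = 0")
        case True then show ?thesis using s0 \<epsilon> by (auto simp: indicator_def)
      next
        case False
        then have y: "y \<in> ball x \<sigma>" using support_scaled[OF s0, of y x] by auto
        have tau: "t \<le> \<tau>" "\<tau> < t + \<epsilon>" using False time_kernel_support[OF \<epsilon>(1), of t \<tau>] by auto
        have ind: "indicator (ball x \<sigma> \<times> {t-\<epsilon><..<t+\<epsilon>}) z = (1::real)" using y tau \<epsilon> z by (simp add: indicator_def)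
        have "norm (y - x) \<le> \<sigma>" using y by (simp add: dist_norm norm_minus_commute)
        then have 1: "\<bar>G z \<bullet> (y - x)\<bar> \<le> norm (G z) * \<sigma>"
          by (rule order_trans[OF Cauchy_Schwarz_ineq2 mult_left_mono]) auto
        have 2: "\<bar>?e\<bar> \<le> inverse \<sigma> ^ (DIM('a) + 1)" using \<eta>(2,3) s0 by (simp add: abs_mult mult_left_le)
        have "\<bar>(G z \<bullet> (y - x)) * (?k \<tau> * ?e)\<bar> \<le> (norm (G z) * \<sigma>) * (inverse \<epsilon> * inverse \<sigma> ^ (DIM('a) + 1))"
          unfolding abs_mult[of "G z \<bullet> (y - x)"] abs_mult[of "?k \<tau>"]
          by (intro mult_mono 1 2 time_kernel_bound \<epsilon>) (use s0 \<epsilon> in auto)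
        also have "\<dots> = inverse \<sigma> ^ DIM('a) * inverse \<epsilon> * norm (G z)" using s0 by simp
        finally show ?thesis unfolding ind by simp
      qed
      ultimately show "\<bar>\<Sum>b\<in>Basis. (G z \<bullet> b) * (?k (snd z) * dilation_field \<sigma> x b (fst z))\<bar>
         \<le> inverse \<sigma> ^ DIM('a) * inverse \<epsilon> * (norm (G z) * indicator (ball x \<sigma> \<times> {t-\<epsilon><..<t+\<epsilon>}) z)" by simp
    next
      note [measurable] = cylinder_measurable[of x \<sigma> "t-\<epsilon>" "t+\<epsilon>"]
      show "(\<lambda>z. norm (G z) * indicator (ball x \<sigma> \<times> {t-\<epsilon><..<t+\<epsilon>}) z) \<in> borel_measurable lebesgue" by measurable
    qed (use s0 \<epsilon> B in auto)
    also have "\<dots> = B" using s0 \<epsilon> by (simp add: power_inverse field_simps)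
    finally show ?thesis unfolding eq .
  qed
  have "norm (mean v \<rho> \<epsilon> x t - mean v \<epsilon> \<epsilon> x t) \<le> B * norm (\<rho> - \<epsilon>)"
  proof (rule field_differentiable_bound[of "{\<epsilon>..\<rho>}"])
    show "((\<lambda>\<rho>. mean v \<rho> \<epsilon> x t) has_real_derivative
      (\<integral>z. v z * (- dilation_div \<sigma> x (fst z) * time_kernel \<epsilon> t (snd z)) \<partial>lebesgue)) (at \<sigma> within {\<epsilon>..\<rho>})" if "\<sigma> \<in> {\<epsilon>..\<rho>}" for \<sigma>
    proof (rule has_field_derivative_at_within[OF mean_derivative[OF v _ \<epsilon>(1)]])
      show "0 < \<sigma>" using that \<epsilon> by simp
    qed
    show "norm (\<integral>z. v z * (- dilation_div \<sigma> x (fst z) * time_kernel \<epsilon> t (snd z)) \<partial>lebesgue) \<le> B" if "\<sigma> \<in> {\<epsilon>..\<rho>}" for \<sigma>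
      using bd'[of \<sigma>] that by simp
    show "convex {\<epsilon>..\<rho>}" by simp
    show "\<rho> \<in> {\<epsilon>..\<rho>}" "\<epsilon> \<in> {\<epsilon>..\<rho>}" using \<epsilon> by auto
  qed
  then show ?thesis using \<epsilon> by simp
qed

end

section \<open>Means at Lebesgue points\<close>

lemma integrable_indicator_cbox: "integrable lebesgue (indicator (cbox a b) :: 'b::euclidean_space \<Rightarrow> real)"
  using lmeasurable_iff_integrable lmeasurable_cbox by blast

text \<open>
  The differentiation theorem for one-sided cubes is applied to \<open>|f - q|\<close> for all rational \<open>q\<close>; then
  \<open>q\<close> is chosen close to \<open>f x\<close>.
\<close>

lemma lebesgue_points_AE:
  fixes f :: "'b::euclidean_space \<Rightarrow> real"
  assumes f: "integrable lebesgue f"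
  shows "AE x in lebesgue. \<forall>e>0. \<exists>d>0. \<forall>h. 0 < h \<and> h < d \<longrightarrow>
    (\<integral>z. \<bar>f z - f x\<bar> * indicator (cbox x (x + h *\<^sub>R One)) z \<partial>lebesgue) \<le> e * h ^ DIM('b)"
proof -
  have io: "set_integrable lebesgue (cbox a b) (\<lambda>z. \<bar>f z - c\<bar>)" for a b :: 'b and c
  proof -
    have "set_integrable lebesgue (cbox a b) f"
      unfolding set_integrable_def using f by (intro integrable_mult_indicator) auto
    moreover have "set_integrable lebesgue (cbox a b) (\<lambda>_. c)"
      unfolding set_integrable_def
      by (intro integrable_scaleR_left integrable_indicator_cbox)
    ultimately show ?thesis by (intro set_integrable_abs set_integral_diff(1))
  qed
  define P where "P q x \<longleftrightarrow> (\<forall>e>0. \<exists>d>0. \<forall>h. 0 < h \<and> h < d \<longrightarrow>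
     norm (integral (cbox x (x + h *\<^sub>R One)) (\<lambda>z. \<bar>f z - q\<bar>) /\<^sub>R h ^ DIM('b) - \<bar>f x - q\<bar>) < e)" for q x
  have "AE x in lebesgue. P q x" for q
  proof -
    have "(\<lambda>z. \<bar>f z - q\<bar>) integrable_on cbox a b" for a b
      using set_lebesgue_integral_eq_integral(1)[OF io] .
    from integrable_ccontinuous_explicit[OF this] obtain N where N: "negligible N"
      "\<And>x e. x \<notin> N \<Longrightarrow> 0 < e \<Longrightarrow> \<exists>d>0. \<forall>h. 0 < h \<and> h < d \<longrightarrow>
         norm (integral (cbox x (x + h *\<^sub>R One)) (\<lambda>z. \<bar>f z - q\<bar>) /\<^sub>R h ^ DIM('b) - \<bar>f x - q\<bar>) < e"
      by blast
    show ?thesis unfolding eventually_ae_filter_negligible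
      using N unfolding P_def by (intro exI[of _ N]) blast
  qed
  then have "AE x in lebesgue. \<forall>i::rat. P (of_rat i) x" by (intro AE_all_countable[THEN iffD2]) blast
  then show ?thesis
  proof eventually_elim
    case (elim x)
    show ?case
    proof (intro allI impI)
      fix e :: real assume e: "0 < e"
      obtain i where "f x - e/4 < of_rat i" "of_rat i < f x + e/4"
        using of_rat_dense[of "f x - e/4" "f x + e/4"] e by auto
      then have "\<bar>f x - of_rat i\<bar> < e/4" "P (of_rat i) x" using elim by (linarith, blast)
      then obtain q where q: "\<bar>f x - q\<bar> < e/4" and Pq: "P q x" by blast
      obtain d where d: "d > 0" "\<And>h. 0 < h \<Longrightarrow> h < d \<Longrightarrow>
          norm (integral (cbox x (x + h *\<^sub>R One)) (\<lambda>z. \<bar>f z - q\<bar>) /\<^sub>R h ^ DIM('b) - \<bar>f x - q\<bar>) < e/4"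
        using Pq[unfolded P_def, rule_format, of "e/4"] e by auto
      show "\<exists>d>0. \<forall>h. 0 < h \<and> h < d \<longrightarrow>
        (\<integral>z. \<bar>f z - f x\<bar> * indicator (cbox x (x + h *\<^sub>R One)) z \<partial>lebesgue) \<le> e * h ^ DIM('b)"
      proof (intro exI[of _ d] conjI d(1) allI impI)
        fix h assume h: "0 < h \<and> h < d"
        let ?C = "cbox x (x + h *\<^sub>R One)"
        have hn: "0 < h ^ DIM('b)" using h by simp
        have mC: "measure lebesgue ?C = h ^ DIM('b)"
          using h by (simp add: content_cbox_cases inner_add_left)
        have "\<bar>integral ?C (\<lambda>z. \<bar>f z - q\<bar>) / h ^ DIM('b) - \<bar>f x - q\<bar>\<bar> < e/4"
          using d(2)[of h] h unfolding real_norm_def real_scaleR_def by (simp only: divide_inverse mult.commute)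
        then have "integral ?C (\<lambda>z. \<bar>f z - q\<bar>) / h ^ DIM('b) \<le> e/2" using q by linarith
        then have 1: "integral ?C (\<lambda>z. \<bar>f z - q\<bar>) \<le> e/2 * h ^ DIM('b)" using hn by (simp add: field_simps)
        have i1: "integrable lebesgue (\<lambda>z. \<bar>f z - c\<bar> * indicator ?C z)" for c
          using io[of x "x + h *\<^sub>R One" c] unfolding set_integrable_def by (simp add: mult.commute)
        have i2: "integrable lebesgue (\<lambda>z. e/4 * indicator ?C z)"
          by (intro integrable_mult_right integrable_indicator_cbox)
        have "(\<integral>z. \<bar>f z - f x\<bar> * indicator ?C z \<partial>lebesgue) \<le> (\<integral>z. \<bar>f z - q\<bar> * indicator ?C z + e/4 * indicator ?C z \<partial>lebesgue)"
        proof (rule integral_mono)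
          show "\<bar>f z - f x\<bar> * indicator ?C z \<le> \<bar>f z - q\<bar> * indicator ?C z + e/4 * indicator ?C z" for z
          proof -
            have "\<bar>f z - f x\<bar> \<le> \<bar>f z - q\<bar> + e/4" using q by linarith
            then show ?thesis by (auto simp: indicator_def)
          qed
        qed (use i1 i2 in auto)
        also have "\<dots> = (\<integral>z. \<bar>f z - q\<bar> * indicator ?C z \<partial>lebesgue) + (\<integral>z. e/4 * indicator ?C z \<partial>lebesgue)"
          by (rule Bochner_Integration.integral_add[OF i1 i2])
        also have "(\<integral>z. e/4 * indicator ?C z \<partial>lebesgue) = e/4 * h ^ DIM('b)"
          using mC by simp
        also have "(\<integral>z. \<bar>f z - q\<bar> * indicator ?C z \<partial>lebesgue) = integral ?C (\<lambda>z. \<bar>f z - q\<bar>)"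
          using set_lebesgue_integral_eq_integral(2)[OF io] unfolding set_lebesgue_integral_def by (simp add: mult.commute)
        also have "\<dots> + e/4 * h ^ DIM('b) \<le> e * h ^ DIM('b)"
          using 1 mult_pos_pos[OF e hn] by linarith
        finally show "(\<integral>z. \<bar>f z - f x\<bar> * indicator ?C z \<partial>lebesgue) \<le> e * h ^ DIM('b)" by simp
      qed
    qed
  qed
qed

context bumps begin

text \<open>
  The kernels are not normalised: this is their common integral.
\<close>

definition mass :: real where "mass = (\<integral>z. \<eta> (fst z) * \<kappa> (snd z) \<partial>lebesgue)"

lemma continuous_bump: "continuous_on UNIV (\<lambda>z::'a \<times> real. \<eta> (fst z) * \<kappa> (snd z))"
  by (intro continuous_intros continuous_on_compose2[OF smooth_continuous[OF \<eta>(1)] _ subset_UNIV]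
     continuous_on_compose2[OF smooth_continuous[OF \<kappa>(1)] _ subset_UNIV])

lemma One_prod: "(One :: 'a \<times> real) = (One, 1)"
  by (simp add: sum_Basis_prod_eq sum_prod zero_prod_def)

lemma bump_support: "\<eta> (fst z) * \<kappa> (snd z) \<noteq> 0 \<Longrightarrow> z \<in> cbox (0 :: 'a \<times> real) One"
  using \<eta>(6)[of "fst z"] \<kappa>(5)[of "snd z"]
  by (auto simp: One_prod zero_prod_def cbox_Pair_eq mem_Times_iff)

lemma mass_pos: "0 < mass"
proof -
  let ?f = "\<lambda>z::'a \<times> real. \<eta> (fst z) * \<kappa> (snd z)"
  have nn: "0 \<le> ?f z" for z using \<eta>(2) \<kappa>(2) by simp
  have int: "integrable lebesgue ?f"
  proof (rule Bochner_Integration.integrable_bound[of _ "indicator (cbox 0 One) :: 'a \<times> real \<Rightarrow> real"])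
    show "integrable lebesgue (indicator (cbox 0 One) :: 'a \<times> real \<Rightarrow> real)"
      by (rule integrable_indicator_cbox)
    show "?f \<in> borel_measurable lebesgue" by (rule continuous_imp_lebesgue_measurable[OF continuous_bump])
    show "AE z in lebesgue. norm (?f z) \<le> norm (indicator (cbox 0 One) z :: real)"
    proof (rule AE_I2)
      fix z
      show "norm (?f z) \<le> norm (indicator (cbox 0 One) z :: real)"
        using bump_support[of z] nn[of z] \<eta>(3)[of "fst z"] \<kappa>(3)[of "snd z"] \<eta>(2)[of "fst z"] \<kappa>(2)[of "snd z"]
        by (cases "?f z = 0") (auto simp: mult_le_one)
    qed
  qed
  have "mass \<noteq> 0"
  proof
    assume "mass = 0"
    then have "AE z in lebesgue. ?f z = 0"
      using integral_nonneg_eq_0_iff_AE[OF int] nn by (simp add: mass_def)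
    then obtain N where N: "negligible N" "{z. ?f z \<noteq> 0} \<subseteq> N"
      unfolding eventually_ae_filter_negligible by auto
    have "open {z. ?f z \<noteq> 0}"
      using open_Collect_neq[OF continuous_bump continuous_on_const[of UNIV 0]] .
    moreover have "{z. ?f z \<noteq> 0} \<noteq> {}"
    proof -
      obtain y s where "0 < \<eta> y" "0 < \<kappa> s" using \<eta>(4) \<kappa>(4) by blast
      then have "(y, s) \<in> {z. ?f z \<noteq> 0}" by simp
      then show ?thesis by blast
    qed
    ultimately have "\<not> negligible {z. ?f z \<noteq> 0}" by (rule open_not_negligible)
    with N show False using negligible_subset by blast
  qed
  moreover have "0 \<le> mass" unfolding mass_def using nn by (intro integral_nonneg_AE) auto
  ultimately show ?thesis by simp
qed

lemma kernel_mass: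
  assumes "0 < \<epsilon>"
  shows "(\<integral>z. space_kernel \<epsilon> x (fst z) * time_kernel \<epsilon> t (snd z) \<partial>lebesgue) = mass"
proof -
  let ?F = "\<lambda>z::'a \<times> real. space_kernel \<epsilon> x (fst z) * time_kernel \<epsilon> t (snd z)"
  let ?T = "\<lambda>z::'a \<times> real. (x, t) + \<epsilon> *\<^sub>R z"
  have cF: "continuous_on UNIV ?F"
    by (intro continuous_intros continuous_on_compose2[OF smooth_continuous[OF smooth_space_kernel] _ subset_UNIV]
      continuous_on_compose2[OF continuous_time_kernel _ subset_UNIV])
  then have [measurable]: "?F \<in> borel_measurable borel" by (rule borel_measurable_continuous_onI)
  have "(\<integral>z. ?F z \<partial>lebesgue) = (\<integral>z. ?F z \<partial>lborel)" by (rule integral_completion) simp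
  also have "\<dots> = (\<integral>z. ?F z \<partial>density (distr lborel borel ?T) (\<lambda>_. ennreal (\<bar>\<epsilon>\<bar> ^ DIM('a \<times> real))))"
    using lborel_affine[of \<epsilon> "(x, t)"] assms by (simp add: ennreal_power)
  also have "\<dots> = \<bar>\<epsilon>\<bar> ^ DIM('a \<times> real) * (\<integral>z. ?F (?T z) \<partial>lborel)"
    by (subst integral_density) (auto simp: integral_distr)
  also have "(\<integral>z. ?F (?T z) \<partial>lborel) = (\<integral>z. inverse \<epsilon> ^ (DIM('a) + 1) * (\<eta> (fst z) * \<kappa> (snd z)) \<partial>lborel)"
  proof -
    have 1: "inverse \<epsilon> *\<^sub>R (fst (?T z) - x) = fst z" for z using assms by simp
    have 2: "inverse \<epsilon> * (snd (?T z) - t) = snd z" for z using assms by simp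
    show ?thesis unfolding space_kernel_def time_kernel_def 1 2 by (simp add: mult_ac)
  qed
  also have "\<dots> = inverse \<epsilon> ^ (DIM('a) + 1) * mass"
    unfolding mass_def using borel_measurable_continuous_onI[OF continuous_bump] by (subst integral_completion) auto
  finally show ?thesis using assms by (simp add: field_simps)
qed

lemma kernel_support:
  assumes "0 < \<epsilon>" "space_kernel \<epsilon> x (fst z) * time_kernel \<epsilon> t (snd z) \<noteq> 0"
  shows "z \<in> cbox (x, t) ((x, t) + \<epsilon> *\<^sub>R One)"
proof -
  have "\<eta> (inverse \<epsilon> *\<^sub>R (fst z - x)) \<noteq> 0" "\<kappa> (inverse \<epsilon> * (snd z - t)) \<noteq> 0"
    using assms by (auto simp: space_kernel_def time_kernel_def)
  then have 1: "inverse \<epsilon> *\<^sub>R (fst z - x) \<in> cbox 0 One" and 2: "0 \<le> inverse \<epsilon> * (snd z - t)" "inverse \<epsilon> * (snd z - t) < 1"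
    using \<eta>(6) \<kappa>(5) by blast+
  have "fst z \<in> cbox x (x + \<epsilon> *\<^sub>R One)"
    using 1 assms(1) by (simp add: mem_box inner_diff_left inner_add_left field_simps)
  moreover have "t \<le> snd z" "snd z \<le> t + \<epsilon>" using 2 assms(1) by (auto simp: field_simps)
  ultimately show ?thesis by (cases z) (simp add: One_prod cbox_Pair_eq)
qed

text \<open>
  For \<open>\<rho> = \<epsilon>\<close> the kernel is bounded by \<open>\<epsilon>\<^sup>-\<^sup>n\<^sup>-\<^sup>1\<close> and lives on a cube of side \<open>\<epsilon>\<close> in space-time, so
  the error is at most the mean of \<open>|v - v(x, t)|\<close> over that cube.
\<close>

lemma mean_at_lebesgue_point:
  assumes v: "integrable lebesgue v"
    and z0: "\<forall>e>0. \<exists>d>0. \<forall>h. 0 < h \<and> h < d \<longrightarrow>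
    (\<integral>z. \<bar>v z - v (x, t)\<bar> * indicator (cbox (x, t) ((x, t) + h *\<^sub>R One)) z \<partial>lebesgue) \<le> e * h ^ DIM('a \<times> real)"
  shows "((\<lambda>\<epsilon>. mean v \<epsilon> \<epsilon> x t) \<longlongrightarrow> mass * v (x, t)) (at_right 0)"
proof (rule tendstoI)
  fix e :: real assume e: "0 < e"
  then obtain d where d: "d > 0" "\<And>h. 0 < h \<Longrightarrow> h < d \<Longrightarrow>
    (\<integral>z. \<bar>v z - v (x, t)\<bar> * indicator (cbox (x, t) ((x, t) + h *\<^sub>R One)) z \<partial>lebesgue) \<le> e/2 * h ^ DIM('a \<times> real)"
    using z0[rule_format, of "e/2"] by auto
  have "dist (mean v \<epsilon> \<epsilon> x t) (mass * v (x, t)) < e" if \<epsilon>: "0 < \<epsilon>" "\<epsilon> < d" for \<epsilon>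
  proof -
    let ?k = "\<lambda>z::'a \<times> real. space_kernel \<epsilon> x (fst z) * time_kernel \<epsilon> t (snd z)"
    let ?C = "cbox (x, t) ((x, t) + \<epsilon> *\<^sub>R One)"
    let ?b = "inverse \<epsilon> ^ DIM('a) * inverse \<epsilon>"
    have kb: "\<bar>?k z\<bar> \<le> ?b" for z
      unfolding abs_mult by (intro mult_mono space_kernel_bound time_kernel_bound \<epsilon>) (use \<epsilon> in auto)
    have kb': "\<bar>?k z\<bar> \<le> ?b * indicator ?C z" for z
      using kb[of z] kernel_support[OF \<epsilon>(1), of x z t] by (cases "?k z = 0") (use \<epsilon> in auto)
    have [measurable]: "?k \<in> borel_measurable lebesgue" by measurable
    have iC: "integrable lebesgue (\<lambda>z. ?b * indicator ?C z)"
      by (intro integrable_mult_right integrable_indicator_cbox)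
    have ik: "integrable lebesgue ?k"
      by (rule Bochner_Integration.integrable_bound[OF iC]) (use kb' in \<open>auto intro!: AE_I2 order_trans[OF _ abs_ge_self]\<close>)
    have ivk: "integrable lebesgue (\<lambda>z. v z * ?k z)"
      by (rule integrable_mult_bounded[OF v _ kb]) simp
    have ivc: "integrable lebesgue (\<lambda>z. \<bar>v z - v (x, t)\<bar> * indicator ?C z)"
    proof -
      have "integrable lebesgue (\<lambda>z. v z * indicator ?C z - v (x, t) * indicator ?C z)"
      proof (intro Bochner_Integration.integrable_diff integrable_mult_right integrable_indicator_cbox)
        show "integrable lebesgue (\<lambda>z. v z * indicator ?C z)"
          by (rule integrable_mult_bounded[OF v borel_measurable_integrable[OF integrable_indicator_cbox], of _ _ 1])
             (auto simp: indicator_def)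
      qed
      then have "integrable lebesgue (\<lambda>z. \<bar>v z * indicator ?C z - v (x, t) * indicator ?C z\<bar>)" by (rule integrable_abs)
      then show ?thesis by (rule back_subst[where P="integrable lebesgue"]) (auto simp: indicator_def)
    qed
    have eq: "mean v \<epsilon> \<epsilon> x t - mass * v (x, t) = (\<integral>z. v z * ?k z - v (x, t) * ?k z \<partial>lebesgue)"
      unfolding mean_def kernel_mass[OF \<epsilon>(1), of x t, symmetric] using ivk ik by (simp add: mult.commute)
    have "\<bar>\<integral>z. v z * ?k z - v (x, t) * ?k z \<partial>lebesgue\<bar> \<le> (\<integral>z. ?b * (\<bar>v z - v (x, t)\<bar> * indicator ?C z) \<partial>lebesgue)"
    proof (rule order_trans[OF integral_abs_bound integral_mono])
      show "\<bar>v z * ?k z - v (x, t) * ?k z\<bar> \<le> ?b * (\<bar>v z - v (x, t)\<bar> * indicator ?C z)" for z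
      proof -
        have "\<bar>v z * ?k z - v (x, t) * ?k z\<bar> = \<bar>v z - v (x, t)\<bar> * \<bar>?k z\<bar>" by (simp only: left_diff_distrib[symmetric] abs_mult)
        also have "\<dots> \<le> \<bar>v z - v (x, t)\<bar> * (?b * indicator ?C z)" by (intro mult_left_mono kb') simp
        finally show ?thesis by (simp only: mult_ac)
      qed
    qed (use ivk ik ivc in auto)
    also have "\<dots> = ?b * (\<integral>z. \<bar>v z - v (x, t)\<bar> * indicator ?C z \<partial>lebesgue)"
      by (rule integral_mult_right_zero)
    also have "\<dots> \<le> ?b * (e/2 * \<epsilon> ^ DIM('a \<times> real))" using \<epsilon> by (intro mult_left_mono d) auto
    also have "\<dots> = e/2" using \<epsilon> by (simp add: field_simps)
    also have "\<dots> < e" using e by simp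
    finally show ?thesis unfolding dist_real_def eq .
  qed
  then show "\<forall>\<^sub>F \<epsilon> in at_right 0. dist (mean v \<epsilon> \<epsilon> x t) (mass * v (x, t)) < e"
    unfolding eventually_at_right_field using d(1) by (intro exI[of _ d]) auto
qed

end

section \<open>Weak gradients on space-time\<close>

text \<open>
  The Lebesgue measure of a product is the completion of the product measure, so Fubini's theorem
  applies to a Borel representative, which agrees with \<open>f\<close> almost everywhere on almost every slice.
\<close>

lemma lebesgue_prod_borel_representative:
  fixes f :: "'a::euclidean_space \<times> real \<Rightarrow> real"
  assumes f: "integrable lebesgue f"
  obtains f' where "integrable (lborel \<Otimes>\<^sub>M lborel) f'" "(\<integral>z. f z \<partial>lebesgue) = (\<integral>z. f' z \<partial>(lborel \<Otimes>\<^sub>M lborel))"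
    "f' \<in> borel_measurable borel"
    "AE t in lebesgue. AE y in lebesgue. f (y, t) = f' (y, t)"
proof -
  obtain f' where f'[measurable]: "f' \<in> borel_measurable lborel" and ae: "AE z in lborel. f z = f' z"
    using completion_ex_borel_measurable_real[OF borel_measurable_integrable[OF f]] by blast
  have ae2: "AE z in lebesgue. f z = f' z" by (rule AE_completion[OF ae])
  have f'L: "f' \<in> borel_measurable lebesgue" by (intro measurable_completion) simp
  have "integrable lebesgue f'" by (rule integrable_cong_AE_imp[OF f f'L]) (use ae2 in auto)
  then have i: "integrable lborel f'" by (simp add: integrable_completion)
  have "(\<integral>z. f z \<partial>lebesgue) = (\<integral>z. f' z \<partial>lebesgue)"
    by (rule integral_cong_AE[OF borel_measurable_integrable[OF f] f'L ae2])
  also have "\<dots> = (\<integral>z. f' z \<partial>lborel)" by (rule integral_completion) simp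
  finally have eq: "(\<integral>z. f z \<partial>lebesgue) = (\<integral>z. f' z \<partial>lborel)" .
  obtain N where N: "N \<in> null_sets lborel" "{z. f z \<noteq> f' z} \<subseteq> N"
    using ae unfolding eventually_ae_filter by auto
  have aeN: "AE z in lborel \<Otimes>\<^sub>M lborel. z \<notin> N"
    using N(1) unfolding lborel_prod by (rule AE_not_in)
  have Ns: "N \<in> sets (lborel \<Otimes>\<^sub>M lborel)" using N(1) unfolding lborel_prod by auto
  have "AE y in lborel. AE t in lborel. (y, t) \<notin> N"
    using lborel_pair.AE_pair[OF aeN] .
  then have "AE t in lborel. AE y in lborel. (y, t) \<notin> N"
  proof (subst (asm) lborel_pair.AE_commute)
    have "{x \<in> space (lborel \<Otimes>\<^sub>M lborel). (fst x, snd x) \<notin> N} = space (lborel \<Otimes>\<^sub>M lborel) - N" by auto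
    then show "{x \<in> space (lborel \<Otimes>\<^sub>M lborel). (fst x, snd x) \<notin> N} \<in> sets (lborel \<Otimes>\<^sub>M lborel)"
      using Ns by (simp only: sets.compl_sets)
  qed
  then have "AE t in lborel. AE y in lborel. f (y, t) = f' (y, t)"
  proof eventually_elim
    case (elim t)
    then show ?case by eventually_elim (use N(2) in blast)
  qed
  then have "AE t in lebesgue. AE y in lebesgue. f (y, t) = f' (y, t)"
    by (simp add: AE_completion_iff)
  with that[of f'] i eq f' show thesis by (simp add: lborel_prod)
qed

lemma AE_integrable_slice:
  fixes f :: "'a::euclidean_space \<times> real \<Rightarrow> real"
  assumes f: "integrable lebesgue f"
  shows "AE t in lebesgue. integrable lebesgue (\<lambda>y. f (y, t))"
proof -
  obtain f' where f': "integrable (lborel \<Otimes>\<^sub>M lborel) f'" "(\<integral>z. f z \<partial>lebesgue) = (\<integral>z. f' z \<partial>(lborel \<Otimes>\<^sub>M lborel))"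
     "f' \<in> borel_measurable borel"
    and ae: "AE t in lebesgue. AE y in lebesgue. f (y, t) = f' (y, t)"
    by (rule lebesgue_prod_borel_representative[OF f])
  have "AE t in lborel. integrable lborel (\<lambda>y. f' (y, t))"
    using lborel_pair.AE_integrable_snd[of "\<lambda>y t. f' (y, t)"] f'(1) by simp
  then have "AE t in lebesgue. integrable lborel (\<lambda>y. f' (y, t))" by (rule AE_completion)
  with ae show ?thesis
  proof eventually_elim
    case (elim t)
    have g: "integrable lebesgue (\<lambda>y. f' (y, t))"
      using elim(2) borel_measurable_integrable[OF elim(2)] by (simp add: integrable_completion)
    have "(\<lambda>y. f (y, t)) \<in> borel_measurable lebesgue"
      by (rule borel_measurable_AE[OF borel_measurable_integrable[OF g]]) (use elim(1) in \<open>eventually_elim, simp\<close>)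
    then show ?case by (rule integrable_cong_AE_imp[OF g]) (use elim(1) in \<open>eventually_elim, simp\<close>)
  qed
qed

lemma lebesgue_integral_zero_slices:
  fixes f :: "'a::euclidean_space \<times> real \<Rightarrow> real"
  assumes f: "integrable lebesgue f" and z: "AE t in lebesgue. (\<integral>y. f (y, t) \<partial>lebesgue) = 0"
  shows "(\<integral>z. f z \<partial>lebesgue) = 0"
proof -
  obtain f' where f': "integrable (lborel \<Otimes>\<^sub>M lborel) f'" "(\<integral>z. f z \<partial>lebesgue) = (\<integral>z. f' z \<partial>(lborel \<Otimes>\<^sub>M lborel))"
     "f' \<in> borel_measurable borel"
    and ae: "AE t in lebesgue. AE y in lebesgue. f (y, t) = f' (y, t)"
    by (rule lebesgue_prod_borel_representative[OF f])
  have "AE t in lebesgue. (\<integral>y. f' (y, t) \<partial>lborel) = 0"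
    using ae z AE_integrable_slice[OF f]
  proof eventually_elim
    case (elim t)
    have m: "(\<lambda>y. f' (y, t)) \<in> borel_measurable lborel"
      using measurable_compose[of "\<lambda>y. (y, t)" borel borel f' borel] f'(3)
      by (simp add: borel_measurable_continuous_onI continuous_on_Pair)
    have "(\<integral>y. f' (y, t) \<partial>lborel) = (\<integral>y. f' (y, t) \<partial>lebesgue)" using m by (simp add: integral_completion)
    also have "\<dots> = (\<integral>y. f (y, t) \<partial>lebesgue)"
      by (rule integral_cong_AE) (use elim m in \<open>auto elim: eventually_mono intro: measurable_completion\<close>)
    finally show ?case using elim by simp
  qed
  then have "AE t in lborel. (\<integral>y. f' (y, t) \<partial>lborel) = 0" by (simp only: AE_completion_iff)
  then have "(\<integral>t. (\<integral>y. f' (y, t) \<partial>lborel) \<partial>lborel) = 0"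
    by (rule integral_eq_zero_AE)
  then show ?thesis using lborel_pair.integral_snd[of "\<lambda>y t. f' (y, t)"] f' by simp
qed

lemma integrable_test_weights:
  fixes g :: "'a::euclidean_space \<times> real \<Rightarrow> real"
  assumes g: "integrable lebesgue g"
    and \<psi>: "test_fun B \<psi>" and \<theta>: "continuous_on UNIV \<theta>" "\<exists>C. \<forall>s. \<bar>\<theta> s\<bar> \<le> C" and b: "b \<in> Basis"
  shows "integrable lebesgue (\<lambda>z. g z * (\<theta> (snd z) * (grad \<psi> (fst z) \<bullet> b)))"
    and "integrable lebesgue (\<lambda>z. g z * (\<theta> (snd z) * \<psi> (fst z)))"
proof -
  have sm: "smooth \<psi>" using \<psi> by (simp add: test_fun_def)
  obtain Ct where Ct: "\<And>s. \<bar>\<theta> s\<bar> \<le> Ct" using \<theta>(2) by blast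
  obtain C0 where C0: "\<And>y. \<bar>\<psi> y\<bar> \<le> C0" using test_fun_bounded[OF \<psi>] by blast
  obtain C where C: "\<And>y. \<bar>frechet_derivative \<psi> (at y) b\<bar> \<le> C" using test_fun_bounded_derivative[OF \<psi>] by blast
  have ct: "continuous_on UNIV (\<lambda>z::'a \<times> real. \<theta> (snd z))"
    by (intro continuous_on_compose2[OF \<theta>(1) _ subset_UNIV] continuous_intros)
  have cp: "continuous_on UNIV (\<lambda>z::'a \<times> real. \<psi> (fst z))"
    by (intro continuous_on_compose2[OF smooth_continuous[OF sm] _ subset_UNIV] continuous_intros)
  have cd: "continuous_on UNIV (\<lambda>z::'a \<times> real. frechet_derivative \<psi> (at (fst z)) b)"
    by (intro continuous_on_compose2[OF smooth_continuous[OF smooth_frechet[OF sm]] _ subset_UNIV] continuous_intros)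
  show "integrable lebesgue (\<lambda>z. g z * (\<theta> (snd z) * (grad \<psi> (fst z) \<bullet> b)))"
  proof (rule integrable_mult_bounded[OF g])
    show "(\<lambda>z::'a \<times> real. \<theta> (snd z) * (grad \<psi> (fst z) \<bullet> b)) \<in> borel_measurable lebesgue"
      unfolding grad_inner_Basis[OF b]
      by (intro continuous_imp_lebesgue_measurable continuous_on_mult ct cd)
    show "\<bar>\<theta> (snd z) * (grad \<psi> (fst z) \<bullet> b)\<bar> \<le> Ct * C" for z
      unfolding abs_mult grad_inner_Basis[OF b] by (intro mult_mono Ct C order_trans[OF abs_ge_zero Ct]) auto
  qed
  show "integrable lebesgue (\<lambda>z. g z * (\<theta> (snd z) * \<psi> (fst z)))"
  proof (rule integrable_mult_bounded[OF g])
    show "(\<lambda>z::'a \<times> real. \<theta> (snd z) * \<psi> (fst z)) \<in> borel_measurable lebesgue"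
      by (intro continuous_imp_lebesgue_measurable continuous_on_mult ct cp)
    show "\<bar>\<theta> (snd z) * \<psi> (fst z)\<bar> \<le> Ct * C0" for z
      unfolding abs_mult by (intro mult_mono Ct C0 order_trans[OF abs_ge_zero Ct]) auto
  qed
qed

text \<open>
  Multiply the identity on the slice at time \<open>\<tau>\<close> by \<open>\<theta> \<tau>\<close> and integrate over \<open>\<tau>\<close>.
\<close>

lemma weak_grad_spacetime:
  fixes w :: "'a::euclidean_space \<times> real \<Rightarrow> real" and G :: "'a \<times> real \<Rightarrow> 'a"
  assumes w: "integrable lebesgue (\<lambda>z. indicator (B \<times> I) z * w z)"
    and G: "integrable lebesgue (\<lambda>z. indicator (B \<times> I) z *\<^sub>R G z)"
    and wg: "AE t in lebesgue. t \<in> I \<longrightarrow> weak_grad B (\<lambda>y. w (y, t)) (\<lambda>y. G (y, t))"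
    and \<psi>: "test_fun B \<psi>" and \<theta>: "continuous_on UNIV \<theta>" "\<exists>C. \<forall>s. \<bar>\<theta> s\<bar> \<le> C" and b: "b \<in> Basis"
  shows "(\<integral>z. (indicator (B \<times> I) z * w z) * (\<theta> (snd z) * (grad \<psi> (fst z) \<bullet> b)) \<partial>lebesgue)
      = - (\<integral>z. ((indicator (B \<times> I) z *\<^sub>R G z) \<bullet> b) * (\<theta> (snd z) * \<psi> (fst z)) \<partial>lebesgue)"
proof -
  let ?w = "\<lambda>z. indicator (B \<times> I) z * w z" and ?G = "\<lambda>z. indicator (B \<times> I) z *\<^sub>R G z"
  have sm: "smooth \<psi>" using \<psi> by (simp add: test_fun_def)
  obtain C0 where C0: "\<And>y. \<bar>\<psi> y\<bar> \<le> C0" using test_fun_bounded[OF \<psi>] by blast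
  have "\<forall>b. \<exists>C. \<forall>y. \<bar>frechet_derivative \<psi> (at y) b\<bar> \<le> C" using test_fun_bounded_derivative[OF \<psi>] by blast
  then obtain C where C: "\<And>b y. \<bar>frechet_derivative \<psi> (at y) b\<bar> \<le> C b"
    using choice[of "\<lambda>b C. \<forall>y. \<bar>frechet_derivative \<psi> (at y) b\<bar> \<le> C"] by blast
  have i1: "integrable lebesgue (\<lambda>z. ?w z * (\<theta> (snd z) * (grad \<psi> (fst z) \<bullet> b)))"
    by (rule integrable_test_weights(1)[OF w \<psi> \<theta> b])
  have "integrable lebesgue (\<lambda>z. ?G z \<bullet> b)" by (rule integrable_inner_left) (use G in simp)
  then have i2: "integrable lebesgue (\<lambda>z. (?G z \<bullet> b) * (\<theta> (snd z) * \<psi> (fst z)))"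
    by (rule integrable_test_weights(2)[OF _ \<psi> \<theta> b])
  have sG: "AE t in lebesgue. \<forall>c\<in>Basis. integrable lebesgue (\<lambda>y. ?G (y, t) \<bullet> c)"
  proof (rule AE_finite_allI[OF finite_Basis])
    fix c :: 'a
    have "integrable lebesgue (\<lambda>z. ?G z \<bullet> c)" by (rule integrable_inner_left) (use G in simp)
    then show "AE t in lebesgue. integrable lebesgue (\<lambda>y. ?G (y, t) \<bullet> c)" by (rule AE_integrable_slice)
  qed
  have "(\<integral>z. ?w z * (\<theta> (snd z) * (grad \<psi> (fst z) \<bullet> b)) + (?G z \<bullet> b) * (\<theta> (snd z) * \<psi> (fst z)) \<partial>lebesgue) = 0"
  proof (rule lebesgue_integral_zero_slices)
    show "integrable lebesgue (\<lambda>z. ?w z * (\<theta> (snd z) * (grad \<psi> (fst z) \<bullet> b)) + (?G z \<bullet> b) * (\<theta> (snd z) * \<psi> (fst z)))"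
      using i1 i2 by (rule Bochner_Integration.integrable_add)
    show "AE t in lebesgue. (\<integral>y. ?w (y, t) * (\<theta> (snd (y, t)) * (grad \<psi> (fst (y, t)) \<bullet> b))
        + (?G (y, t) \<bullet> b) * (\<theta> (snd (y, t)) * \<psi> (fst (y, t))) \<partial>lebesgue) = 0"
      using wg AE_integrable_slice[OF w] sG
    proof eventually_elim
      case (elim t)
      show ?case
      proof (cases "t \<in> I")
        case False then show ?thesis by simp
      next
        case True
        have iw: "integrable lebesgue (\<lambda>y. indicator B y * w (y, t))"
          using elim(2) True by (simp add: indicator_times)
        have iG: "integrable lebesgue (\<lambda>y. indicator B y *\<^sub>R G (y, t))"
        proof -
          have "integrable lebesgue (\<lambda>y. \<Sum>c\<in>Basis. ((indicator B y *\<^sub>R G (y, t)) \<bullet> c) *\<^sub>R c)"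
            using elim(3) True by (intro Bochner_Integration.integrable_sum integrable_scaleR_left) (auto simp: indicator_times)
          then show ?thesis by (simp only: euclidean_representation)
        qed
        have iwg: "integrable lebesgue (\<lambda>y. indicator B y *\<^sub>R (w (y, t) *\<^sub>R grad \<psi> y))"
        proof -
          have "integrable lebesgue (\<lambda>y. \<Sum>c\<in>Basis. ((indicator B y * w (y, t)) * frechet_derivative \<psi> (at y) c) *\<^sub>R c)"
            by (intro Bochner_Integration.integrable_sum integrable_scaleR_left integrable_mult_bounded[OF iw _ C]
                continuous_imp_lebesgue_measurable smooth_continuous smooth_frechet sm)
          then show ?thesis by (simp add: grad_def scaleR_sum_right mult.assoc)
        qed
        have ipG: "integrable lebesgue (\<lambda>y. indicator B y *\<^sub>R (\<psi> y *\<^sub>R G (y, t)))"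
          using integrable_scaleR_bounded[OF iG continuous_imp_lebesgue_measurable[OF smooth_continuous[OF sm]] C0]
          by (simp add: mult.commute)
        have "(LINT x:B|lebesgue. w (x, t) *\<^sub>R grad \<psi> x) = - (LINT x:B|lebesgue. \<psi> x *\<^sub>R G (x, t))"
          using elim(1) True \<psi> unfolding weak_grad_def by blast
        then have 0: "(\<integral>y. indicator B y *\<^sub>R (w (y, t) *\<^sub>R grad \<psi> y) \<partial>lebesgue) \<bullet> b + (\<integral>y. indicator B y *\<^sub>R (\<psi> y *\<^sub>R G (y, t)) \<partial>lebesgue) \<bullet> b = 0"
          unfolding set_lebesgue_integral_def by simp
        have "(\<integral>y. ?w (y, t) * (\<theta> (snd (y, t)) * (grad \<psi> (fst (y, t)) \<bullet> b))
           + (?G (y, t) \<bullet> b) * (\<theta> (snd (y, t)) * \<psi> (fst (y, t))) \<partial>lebesgue)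
          = (\<integral>y. \<theta> t * ((indicator B y *\<^sub>R (w (y, t) *\<^sub>R grad \<psi> y)) \<bullet> b + (indicator B y *\<^sub>R (\<psi> y *\<^sub>R G (y, t))) \<bullet> b) \<partial>lebesgue)"
          using True by (intro Bochner_Integration.integral_cong refl) (simp add: indicator_times algebra_simps)
        also have "\<dots> = \<theta> t * ((\<integral>y. (indicator B y *\<^sub>R (w (y, t) *\<^sub>R grad \<psi> y)) \<bullet> b \<partial>lebesgue) + (\<integral>y. (indicator B y *\<^sub>R (\<psi> y *\<^sub>R G (y, t))) \<bullet> b \<partial>lebesgue))"
          by (simp only: integral_mult_right_zero Bochner_Integration.integral_add[OF integrable_inner_left[OF iwg] integrable_inner_left[OF ipG]])
        also have "\<dots> = 0" using 0 iwg ipG by (simp only: integral_inner_left)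
        finally show ?thesis .
      qed
    qed
  qed
  then show ?thesis using Bochner_Integration.integral_add[OF i1 i2] by linarith
qed

section \<open>Measurability of the composed vector field\<close>

lemma tuples_convergence_componentwise:
  fixes D :: "nat \<Rightarrow> nat \<Rightarrow> 'a::topological_space"
  assumes "\<And>j. (\<lambda>k. D k j) \<longlonglongrightarrow> w j"
  shows "D \<longlonglongrightarrow> w"
  using assms limitin_componentwise[of "\<lambda>_. euclidean" UNIV D w sequentially]
  by (simp add: euclidean_product_topology)

text \<open>
  Approximate \<open>w\<close> pointwise by maps \<open>D k\<close> with finitely many values. On each level set of \<open>D k\<close> the
  composition is measurable because \<open>A\<close> is measurable in \<open>z\<close>, and the compositions converge almost
  everywhere because \<open>A\<close> is continuous in \<open>\<xi>\<close>.
\<close>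

lemma caratheodory_measurable:
  fixes A :: "'a::euclidean_space \<times> real \<Rightarrow> (nat \<Rightarrow> 'a) \<Rightarrow> nat \<Rightarrow> 'a"
  assumes U: "U \<in> sets lebesgue" and A: "caratheodory_field N U A" and w: "measurable_tuple N U w" and i: "i < N"
  shows "(\<lambda>z. A z (w z) i) \<in> borel_measurable (lebesgue_on U)"
proof -
  have sp: "space (lebesgue_on U) = U" by simp
  have "\<exists>F. (\<forall>k. simple_function (lebesgue_on U) (F k)) \<and> (\<forall>x\<in>U. (\<lambda>k. F k x) \<longlonglongrightarrow> w x j)" if "j < N" for j
  proof -
    have "(\<lambda>x. w x j) \<in> borel_measurable (lebesgue_on U)" using w that by (simp add: measurable_tuple_def)
    from borel_measurable_implies_sequence_metric[OF this, of 0] obtain F where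
      "\<forall>k. simple_function (lebesgue_on U) (F k)" "\<forall>x\<in>space (lebesgue_on U). (\<lambda>k. F k x) \<longlonglongrightarrow> w x j" by blast
    then show ?thesis unfolding sp by blast
  qed
  then have "\<forall>j. \<exists>F. j < N \<longrightarrow> (\<forall>k. simple_function (lebesgue_on U) (F k)) \<and> (\<forall>x\<in>U. (\<lambda>k. F k x) \<longlonglongrightarrow> w x j)" by blast
  then obtain F where F: "\<And>j k. j < N \<Longrightarrow> simple_function (lebesgue_on U) (F j k)"
    and lim: "\<And>j x. j < N \<Longrightarrow> x \<in> U \<Longrightarrow> (\<lambda>k. F j k x) \<longlonglongrightarrow> w x j"
    using choice[of "\<lambda>j F. j < N \<longrightarrow> (\<forall>k. simple_function (lebesgue_on U) (F k)) \<and> (\<forall>x\<in>U. (\<lambda>k. F k x) \<longlonglongrightarrow> w x j)"] by blast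
  define D where "D k z = (\<lambda>j. if j < N then F j k z else 0)" for k z
  have Dt: "D k z \<in> tuples N" for k z by (simp add: D_def tuples_def)
  have meas: "(\<lambda>z. A z (D k z) i) \<in> borel_measurable (lebesgue_on U)" for k
  proof (rule measurable_compose_countable'[where I="D k ` U" and f="\<lambda>\<xi> z. A z \<xi> i"])
    show "(\<lambda>z. A z \<xi> i) \<in> borel_measurable (lebesgue_on U)" if "\<xi> \<in> D k ` U" for \<xi>
      using A that Dt i unfolding caratheodory_field_def measurable_tuple_def by blast
    have "finite (\<Union>j<N. F j k ` U)"
      using simple_functionD(1)[OF F] sp by auto
    then have "finite {f. \<forall>j. (j \<in> {..<N} \<longrightarrow> f j \<in> (\<Union>j<N. F j k ` U)) \<and> (j \<notin> {..<N} \<longrightarrow> f j = 0)}"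
      by (intro finite_set_of_finite_funs) auto
    then have fin: "finite (D k ` U)"
    proof (rule rev_finite_subset, intro subsetI CollectI allI conjI impI)
      fix f j assume "f \<in> D k ` U"
      then obtain z where z: "z \<in> U" "f = D k z" by blast
      show "f j \<in> (\<Union>j<N. F j k ` U)" if "j \<in> {..<N}"
      proof (rule UN_I[OF that])
        show "f j \<in> F j k ` U" using z that by (simp add: D_def)
      qed
      show "f j = 0" if "j \<notin> {..<N}" using z that by (simp add: D_def)
    qed
    then show "countable (D k ` U)" by (rule countable_finite)
    show "D k \<in> lebesgue_on U \<rightarrow>\<^sub>M count_space (D k ` U)"
      unfolding measurable_count_space_eq2[OF fin]
    proof (intro conjI ballI)
      show "D k \<in> space (lebesgue_on U) \<rightarrow> D k ` U" by auto
      fix a assume a: "a \<in> D k ` U"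
      have a0: "a j = 0" if "\<not> j < N" for j using a that by (auto simp: D_def)
      have "D k z = a \<longleftrightarrow> (\<forall>j\<in>{..<N}. F j k z = a j)" for z
      proof
        assume "D k z = a"
        then show "\<forall>j\<in>{..<N}. F j k z = a j" by (auto simp: D_def)
      next
        assume "\<forall>j\<in>{..<N}. F j k z = a j"
        then show "D k z = a" using a0 by (simp add: D_def fun_eq_iff)
      qed
      then have "D k -` {a} \<inter> space (lebesgue_on U) = {z \<in> space (lebesgue_on U). \<forall>j\<in>{..<N}. F j k z = a j}" by auto
      also have "\<dots> \<in> sets (lebesgue_on U)"
      proof (rule sets.sets_Collect_finite_All)
        show "{z \<in> space (lebesgue_on U). F j k z = a j} \<in> sets (lebesgue_on U)" if "j \<in> {..<N}" for j
          using simple_functionD(2)[OF F[of j k], of "{a j}"] that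
          by (auto simp: vimage_def Int_def conj_commute)
      qed auto
      finally show "D k -` {a} \<inter> space (lebesgue_on U) \<in> sets (lebesgue_on U)" .
    qed
  qed
  let ?g = "\<lambda>k z. indicator U z *\<^sub>R A z (D k z) i"
  have U': "U \<inter> space lebesgue \<in> sets lebesgue" using U by simp
  have g: "?g k \<in> borel_measurable lebesgue" for k
    using iffD1[OF borel_measurable_restrict_space_iff[OF U'] meas] .
  have "AE z in lebesgue. lim (\<lambda>k. ?g k z) = indicator U z *\<^sub>R A z (w z) i"
  proof -
    have "AE z in lebesgue. z \<in> U \<longrightarrow> continuous_on (tuples N) (A z)"
      using A by (simp add: caratheodory_field_def)
    then show ?thesis
    proof eventually_elim
      case (elim z)
      show ?case
      proof (cases "z \<in> U")
        case True
        have wt: "w z \<in> tuples N" using w True by (simp add: measurable_tuple_def)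
        have "(\<lambda>k. D k z) \<longlonglongrightarrow> w z"
        proof (rule tuples_convergence_componentwise)
          fix j show "(\<lambda>k. D k z j) \<longlonglongrightarrow> w z j"
            using lim[of j z] True wt by (cases "j < N") (auto simp: D_def tuples_def)
        qed
        then have "(\<lambda>k. A z (D k z)) \<longlonglongrightarrow> A z (w z)"
          using continuous_on_tendsto_compose[of "tuples N" "A z" "\<lambda>k. D k z" "w z" sequentially] elim True wt Dt by auto
        then have "(\<lambda>k. A z (D k z) i) \<longlonglongrightarrow> A z (w z) i"
          using continuous_on_tendsto_compose[of UNIV "\<lambda>f. f i" "\<lambda>k. A z (D k z)" "A z (w z)" sequentially]
          by auto
        then show ?thesis using True by (simp add: limI)
      qed (simp add: limI)
    qed
  qed
  then have "(\<lambda>z. indicator U z *\<^sub>R A z (w z) i) \<in> borel_measurable lebesgue"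
    by (rule borel_measurable_AE[OF borel_measurable_lim_metric[OF g]])
  then show ?thesis by (rule iffD2[OF borel_measurable_restrict_space_iff[OF U']])
qed

section \<open>Oscillation of the means in time\<close>

lemma grad_inner:
  assumes "f differentiable (at x)" shows "grad f x \<bullet> v = frechet_derivative f (at x) v"
proof -
  have "frechet_derivative f (at x) v = (\<Sum>b\<in>Basis. (v \<bullet> b) * frechet_derivative f (at x) b)"
    by (rule linear_Basis_expansion[OF linear_frechet_derivative[OF assms]])
  then show ?thesis unfolding grad_def inner_sum_left by (simp add: inner_commute[of v] mult.commute)
qed

lemma tnorm_nonneg: "0 \<le> tnorm N v" by (simp add: tnorm_def)

lemma norm_le_tnorm: "i < N \<Longrightarrow> norm (v i) \<le> tnorm N v"
  unfolding tnorm_def by (rule member_le_L2_set) auto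

lemma tnorm_scaleR: "tnorm N (\<lambda>i. c *\<^sub>R v i) = \<bar>c\<bar> * tnorm N v"
  unfolding tnorm_def by (simp add: L2_set_right_distrib)

text \<open>
  This bound of a projection in direction \<open>e\<close> does not involve \<open>N\<close>; it is what keeps the final constant
  independent of \<open>N\<close>.
\<close>

lemma tinner_scaled_vector_bound:
  fixes X :: "nat \<Rightarrow> 'a::real_inner"
  shows "\<bar>tinner N X (\<lambda>i. e i *\<^sub>R g)\<bar> \<le> L2_set e {..<N} * norm g * tnorm N X"
proof -
  have "\<bar>tinner N X (\<lambda>i. e i *\<^sub>R g)\<bar> \<le> (\<Sum>i<N. \<bar>X i \<bullet> (e i *\<^sub>R g)\<bar>)"
    unfolding tinner_def by (rule sum_abs)
  also have "\<dots> \<le> (\<Sum>i<N. \<bar>e i\<bar> * \<bar>norm g * norm (X i)\<bar>)"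
  proof (rule sum_mono)
    fix i
    have "\<bar>X i \<bullet> (e i *\<^sub>R g)\<bar> \<le> norm (X i) * norm (e i *\<^sub>R g)" by (rule Cauchy_Schwarz_ineq2)
    then show "\<bar>X i \<bullet> (e i *\<^sub>R g)\<bar> \<le> \<bar>e i\<bar> * \<bar>norm g * norm (X i)\<bar>" by (simp add: abs_mult mult_ac)
  qed
  also have "\<dots> \<le> L2_set e {..<N} * L2_set (\<lambda>i. norm g * norm (X i)) {..<N}"
    by (rule L2_set_mult_ineq)
  also have "\<dots> = L2_set e {..<N} * norm g * tnorm N X"
    unfolding tnorm_def by (simp add: L2_set_right_distrib[symmetric])
  finally show ?thesis .
qed

lemma measurable_tuple_extend:
  assumes "measurable_tuple N U f" "U \<in> sets lebesgue" "i < N"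
  shows "(\<lambda>z. indicator U z *\<^sub>R f z i) \<in> borel_measurable lebesgue"
proof -
  have "U \<inter> space lebesgue \<in> sets lebesgue" using assms by simp
  moreover have "(\<lambda>z. f z i) \<in> borel_measurable (lebesgue_on U)" using assms by (simp add: measurable_tuple_def)
  ultimately show ?thesis by (rule iffD1[OF borel_measurable_restrict_space_iff])
qed

lemma measurable_tnorm_powr:
  fixes f :: "'a::euclidean_space \<Rightarrow> nat \<Rightarrow> 'b::euclidean_space"
  assumes "measurable_tuple N U f" "U \<in> sets lebesgue" "C \<in> sets lebesgue" "C \<subseteq> U"
  shows "(\<lambda>z. tnorm N (f z) powr a * indicator C z) \<in> borel_measurable lebesgue"
    and "(\<lambda>z. tnorm N (f z) * indicator C z) \<in> borel_measurable lebesgue"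
proof -
  let ?T = "\<lambda>z. sqrt (\<Sum>i<N. (norm (indicator U z *\<^sub>R f z i))\<^sup>2)"
  have [measurable]: "?T \<in> borel_measurable lebesgue"
  proof -
    have [measurable]: "(\<lambda>z. \<Sum>i<N. (norm (indicator U z *\<^sub>R f z i))\<^sup>2) \<in> borel_measurable lebesgue"
      by (intro borel_measurable_sum borel_measurable_power
            measurable_compose[OF measurable_tuple_extend[OF assms(1,2)] borel_measurable_norm]) simp
    show ?thesis by measurable
  qed
  note [measurable] = assms(3)
  have "(\<lambda>z. ?T z powr a * indicator C z) \<in> borel_measurable lebesgue"
    "(\<lambda>z. ?T z * indicator C z) \<in> borel_measurable lebesgue" by measurable
  moreover have "?T z powr a * indicator C z = tnorm N (f z) powr a * indicator C z"
     "?T z * indicator C z = tnorm N (f z) * indicator C z" for z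
    using assms(4) by (auto simp: tnorm_def L2_set_def indicator_def)
  ultimately show "(\<lambda>z. tnorm N (f z) powr a * indicator C z) \<in> borel_measurable lebesgue"
    "(\<lambda>z. tnorm N (f z) * indicator C z) \<in> borel_measurable lebesgue" by (simp_all only:)
qed

context bumps begin

text \<open>
  Differences of rescaled translates of \<open>K\<close> are smooth approximations of the indicator of a time interval.
\<close>

lemma exists_primitive_time_bump:
  "\<exists>K. (\<forall>s. (K has_real_derivative \<kappa> s) (at s)) \<and> (\<forall>s\<le>0. K s = 0) \<and> (\<forall>s\<ge>1. K s = K 1) \<and> (\<forall>s. \<bar>K s\<bar> \<le> 1)"
proof -
  have "isCont \<kappa> s" for s using smooth_continuous[OF \<kappa>(1)] by (simp add: continuous_on_eq_continuous_at)
  then obtain F where F: "\<And>s. (F has_vector_derivative \<kappa> s) (at s)"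
    using einterval_antiderivative[of "-\<infinity>" \<infinity> \<kappa>] by auto
  define K where "K s = F s - F 0" for s
  have K: "(K has_real_derivative \<kappa> s) (at s)" for s
    unfolding K_def[abs_def] using F[of s]
    by (auto intro!: derivative_eq_intros simp: has_real_derivative_iff_has_vector_derivative[symmetric])
  have mv: "\<exists>c>a. c < b \<and> K b - K a = (b - a) * \<kappa> c" if "a < b" for a b
    using MVT2[OF that, of K \<kappa>] K by blast
  have K0: "K s = 0" if "s \<le> 0" for s
  proof (cases "s = 0")
    case False
    then have "s < 0" using that by simp
    then obtain c where "c < 0" "K 0 - K s = (0 - s) * \<kappa> c" using mv[of s 0] by blast
    moreover have "\<kappa> c = 0" using \<kappa>(5)[of c] \<open>c < 0\<close> by force
    ultimately show ?thesis by (simp add: K_def)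
  qed (simp add: K_def)
  have K1: "K s = K 1" if "1 \<le> s" for s
  proof (cases "s = 1")
    case False
    then have "1 < s" using that by simp
    then obtain c where "1 < c" "K s - K 1 = (s - 1) * \<kappa> c" using mv[of 1 s] by blast
    moreover have "\<kappa> c = 0" using \<kappa>(5)[of c] \<open>1 < c\<close> by force
    ultimately show ?thesis by simp
  qed simp
  have KI: "\<bar>K s\<bar> \<le> 1" if s: "0 < s" "s \<le> 1" for s
  proof -
    obtain c where "K s - K 0 = (s - 0) * \<kappa> c" using mv[OF s(1)] by blast
    then have "K s = s * \<kappa> c" by (simp add: K_def)
    then show ?thesis using s \<kappa>(2)[of c] \<kappa>(3)[of c] by (simp add: abs_mult mult_le_one)
  qed
  have "\<bar>K s\<bar> \<le> 1" for s
    using K0[of s] K1[of s] KI[of s] KI[of 1] by (cases "s \<le> 0"; cases "s \<le> 1") auto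
  with K K0 K1 show ?thesis by blast
qed

text \<open>
  The test function is \<open>e\<^sub>i h(y) \<theta>(\<tau>)\<close>, where \<open>h\<close> is the spatial cutoff at scale \<open>\<rho>\<close> and \<open>\<theta>\<close> is a smooth
  approximation of the indicator of \<open>(s, t)\<close> with \<open>\<theta>' = time_kernel \<epsilon> s - time_kernel \<epsilon> t\<close>. The term with
  the time derivative is then the difference of the two means, up to the factor \<open>\<rho>\<^sup>n\<close>, and the other two
  terms are bounded by \<open>|\<nabla>h| \<le> M / \<rho>\<close> and the growth of the field.
\<close>

lemma temporal_oscillation:
  fixes u :: "'a \<times> real \<Rightarrow> nat \<Rightarrow> real" and Du F :: "'a \<times> real \<Rightarrow> nat \<Rightarrow> 'a"
  assumes U: "U \<in> sets lebesgue" and p: "1 < p" and L: "0 < L"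
    and car: "caratheodory_field N U A" and str: "p_structure N p \<nu> L U A"
    and sol: "weak_solution N p U A F u Du"
    and Du: "measurable_tuple N U Du" and F: "measurable_tuple N U F"
    and u: "\<And>i. i < N \<Longrightarrow> integrable lebesgue (\<lambda>z. indicator C0 z * u z i)" and C0: "C0 \<subseteq> U"
    and e: "L2_set e {..<N} \<le> 1"
    and pos: "0 < \<rho>" "0 < \<epsilon>" "s < t" and cyl: "cball x \<rho> \<times> {s-\<epsilon>..t+\<epsilon>} \<subseteq> C0"
    and nD: "(\<integral>\<^sup>+z. ennreal (tnorm N (Du z) powr (p-1) * indicator (ball x \<rho> \<times> {s-\<epsilon><..<t+\<epsilon>}) z) \<partial>lebesgue) \<le> ennreal b"
    and nF: "(\<integral>\<^sup>+z. ennreal (tnorm N (F z) powr (p-1) * indicator (ball x \<rho> \<times> {s-\<epsilon><..<t+\<epsilon>}) z) \<partial>lebesgue) \<le> ennreal b"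
    and b: "0 \<le> b"
  defines "v \<equiv> \<lambda>z. \<Sum>i<N. e i * (indicator C0 z * u z i)"
  shows "\<bar>mean v \<rho> \<epsilon> x t - mean v \<rho> \<epsilon> x s\<bar> \<le> inverse \<rho> ^ DIM('a) * (2 * (M * inverse \<rho>) * (L + 1) * b)"
proof -
  let ?C = "ball x \<rho> \<times> {s-\<epsilon><..<t+\<epsilon>}"
  have CU: "?C \<subseteq> U" using cyl C0 ball_subset_cball by fastforce
  have CC0: "?C \<subseteq> C0" using cyl ball_subset_cball by fastforce
  obtain K where K: "\<And>s. (K has_real_derivative \<kappa> s) (at s)" "\<And>s. s \<le> 0 \<Longrightarrow> K s = 0"
    "\<And>s. 1 \<le> s \<Longrightarrow> K s = K 1" "\<And>s. \<bar>K s\<bar> \<le> 1" using exists_primitive_time_bump by blast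
  have smK: "smooth K"
  proof
    fix k show "C_k k K"
    proof (cases k)
      case 0 then show ?thesis using K(1)[THEN DERIV_isCont] by (simp add: continuous_on_eq_continuous_at)
    next
      case (Suc m)
      have "C_k (Suc m) K"
      proof (rule C_k_SucI[where f'="\<lambda>s h. \<kappa> s * h"])
        show "(K has_derivative (*) (\<kappa> s)) (at s)" for s using K(1)[of s] by (simp add: has_field_derivative_def)
        show "C_k m (\<lambda>s. \<kappa> s * h)" for h using \<kappa>(1) by (intro C_k_mult C_k_const) auto
      qed
      then show ?thesis using Suc by simp
    qed
  qed
  define h where "h y = \<eta> (inverse \<rho> *\<^sub>R (y - x))" for y
  define \<theta> where "\<theta> \<tau> = K (inverse \<epsilon> * (\<tau> - s)) - K (inverse \<epsilon> * (\<tau> - t))" for \<tau>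
  define d\<theta> where "d\<theta> \<tau> = time_kernel \<epsilon> s \<tau> - time_kernel \<epsilon> t \<tau>" for \<tau>
  have smh: "smooth h" unfolding h_def[abs_def] by (rule smooth_scaled[OF \<eta>(1)])
  have sm\<theta>: "smooth \<theta>"
  proof
    fix k
    have 1: "C_k k (\<lambda>\<tau>. K (inverse \<epsilon> * (\<tau> - r)))" for r
      using C_k_affine[OF bounded_linear_mult_right[of "inverse \<epsilon>"], of k K "- (inverse \<epsilon> * r)"] smK
      by (simp add: algebra_simps)
    have "C_k k (\<lambda>\<tau>. K (inverse \<epsilon> * (\<tau> - s)) + (-1) * K (inverse \<epsilon> * (\<tau> - t)))"
      by (intro C_k_add C_k_mult C_k_const 1)
    then show "C_k k \<theta>" by (simp add: \<theta>_def[abs_def])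
  qed
  have D\<theta>: "(\<theta> has_real_derivative d\<theta> \<tau>) (at \<tau>)" for \<tau>
  proof -
    have "((\<lambda>\<tau>. K (inverse \<epsilon> * (\<tau> - r))) has_real_derivative \<kappa> (inverse \<epsilon> * (\<tau> - r)) * inverse \<epsilon>) (at \<tau>)" for r
      by (rule DERIV_chain2[OF K(1)]) (auto intro!: derivative_eq_intros)
    from DERIV_diff[OF this[of s] this[of t]] show ?thesis
      unfolding \<theta>_def[abs_def] d\<theta>_def time_kernel_def by (simp add: mult.commute)
  qed
  have \<theta>b: "\<bar>\<theta> \<tau>\<bar> \<le> 2" for \<tau>
    using K(4)[of "inverse \<epsilon> * (\<tau> - s)"] K(4)[of "inverse \<epsilon> * (\<tau> - t)"] unfolding \<theta>_def by linarith
  have \<theta>s: "s \<le> \<tau> \<and> \<tau> < t + \<epsilon>" if "\<theta> \<tau> \<noteq> 0" for \<tau>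
  proof (rule ccontr)
    assume "\<not> ?thesis"
    then consider "\<tau> < s" | "t + \<epsilon> \<le> \<tau>" by linarith
    then show False
    proof cases
      case 1
      then have "inverse \<epsilon> * (\<tau> - s) \<le> 0" "inverse \<epsilon> * (\<tau> - t) \<le> 0" using pos by (auto simp: mult_le_0_iff)
      then show False using that K(2) by (simp add: \<theta>_def)
    next
      case 2
      then have "1 \<le> inverse \<epsilon> * (\<tau> - s)" "1 \<le> inverse \<epsilon> * (\<tau> - t)" using pos by (auto simp: field_simps)
      then have "\<theta> \<tau> = 0" unfolding \<theta>_def by (simp add: K(3)[of "inverse \<epsilon> * (\<tau> - s)"] K(3)[of "inverse \<epsilon> * (\<tau> - t)"])
      then show False using that by simp
    qed
  qed
  have d\<theta>s: "s \<le> \<tau> \<and> \<tau> < t + \<epsilon>" if "d\<theta> \<tau> \<noteq> 0" for \<tau>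
    using that time_kernel_support[OF pos(2), of s \<tau>] time_kernel_support[OF pos(2), of t \<tau>] pos
    unfolding d\<theta>_def by (cases "time_kernel \<epsilon> s \<tau> = 0") auto
  have hs: "y \<in> ball x \<rho>" if "h y \<noteq> 0" for y using support_scaled[OF pos(1), of y x] that by (simp add: h_def)
  have Dh: "(h has_derivative (\<lambda>v. frechet_derivative \<eta> (at (inverse \<rho> *\<^sub>R (y - x))) (inverse \<rho> *\<^sub>R v))) (at y)" for y
    unfolding h_def[abs_def]
    by (rule has_derivative_compose[OF _ \<eta>_derivative]) (auto intro!: derivative_eq_intros)
  have gradh: "grad h y \<bullet> v = frechet_derivative \<eta> (at (inverse \<rho> *\<^sub>R (y - x))) (inverse \<rho> *\<^sub>R v)" for y v
    using grad_inner[of h y v] frechet_derivative_eqI[OF Dh] Dh differentiable_def by fastforce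
  have grads: "y \<in> ball x \<rho>" if nz: "grad h y \<noteq> 0" for y
  proof -
    have "grad h y \<bullet> grad h y \<noteq> 0" using nz by simp
    then have "norm (inverse \<rho> *\<^sub>R (y - x)) < 1" unfolding gradh by (rule \<eta>(8))
    then show ?thesis using pos by (simp add: dist_norm norm_minus_commute divide_simps)
  qed
  have gradb: "norm (grad h y) \<le> M * inverse \<rho>" for y
  proof (cases "grad h y = 0")
    case False
    have "norm (grad h y) * norm (grad h y) = grad h y \<bullet> grad h y" by (simp add: dot_square_norm power2_eq_square)
    also have "\<dots> \<le> M * norm (inverse \<rho> *\<^sub>R grad h y)"
      unfolding gradh using \<eta>(7) abs_le_D1 by blast
    also have "\<dots> = (M * inverse \<rho>) * norm (grad h y)" using pos by simp
    finally show ?thesis using False by (simp add: mult_le_cancel_right)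
  qed (use \<eta>(5) pos in auto)
  define \<phi> where "\<phi> z i = (if i < N then e i * (h (fst z) * \<theta> (snd z)) else 0)" for z :: "'a \<times> real" and i
  have tt: "test_tuple N U \<phi>"
    unfolding test_tuple_def
  proof (intro conjI allI impI)
    show "\<phi> z \<in> tuples N" for z by (simp add: \<phi>_def tuples_def)
    fix i assume i: "i < N"
    show "test_fun U (\<lambda>z. \<phi> z i)"
    proof (rule test_fun_compactI)
      show "smooth (\<lambda>z. \<phi> z i)"
      proof
        fix k
        have "C_k k (\<lambda>z::'a \<times> real. h (fst z))" using C_k_affine[OF bounded_linear_fst, of k h 0] smh by simp
        moreover have "C_k k (\<lambda>z::'a \<times> real. \<theta> (snd z))" using C_k_affine[OF bounded_linear_snd, of k \<theta> 0] sm\<theta> by simp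
        ultimately show "C_k k (\<lambda>z. \<phi> z i)" unfolding \<phi>_def using i by (simp add: C_k_mult C_k_const)
      qed
      show "z \<in> cball x \<rho> \<times> {s..t+\<epsilon>}" if "\<phi> z i \<noteq> 0" for z
      proof -
        have "h (fst z) \<noteq> 0" "\<theta> (snd z) \<noteq> 0" using that by (auto simp: \<phi>_def split: if_splits)
        from hs[OF this(1)] \<theta>s[OF this(2)] show ?thesis by (cases z) auto
      qed
      show "compact (cball x \<rho> \<times> {s..t+\<epsilon>})" by (intro compact_Times compact_cball compact_Icc)
      have "cball x \<rho> \<times> {s..t+\<epsilon>} \<subseteq> cball x \<rho> \<times> {s-\<epsilon>..t+\<epsilon>}" using pos by auto
      then show "cball x \<rho> \<times> {s..t+\<epsilon>} \<subseteq> U" using cyl C0 by blast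
    qed
  qed
  have dt: "dt_tuple \<phi> z i = e i * (h (fst z) * d\<theta> (snd z))" if "i < N" for z i
  proof -
    have "((\<lambda>r. e i * (h (fst z) * \<theta> r)) has_real_derivative e i * (h (fst z) * d\<theta> (snd z))) (at (snd z))"
      by (intro DERIV_cmult D\<theta>)
    from DERIV_imp_deriv[OF this] show ?thesis using that by (cases z) (simp add: dt_tuple_def \<phi>_def)
  qed
  have gr: "grad_tuple \<phi> z i = (e i * \<theta> (snd z)) *\<^sub>R grad h (fst z)" if "i < N" for z i
  proof -
    obtain y \<tau> where z: "z = (y, \<tau>)" by fastforce
    have "((\<lambda>y. (e i * \<theta> \<tau>) * h y) has_derivative (\<lambda>v. (e i * \<theta> \<tau>) * frechet_derivative h (at y) v)) (at y)"
      by (intro has_derivative_mult_right smooth_differentiable[OF smh])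
    from frechet_derivative_eqI[OF this] have "frechet_derivative (\<lambda>y. (e i * \<theta> \<tau>) * h y) (at y) v = (e i * \<theta> \<tau>) * frechet_derivative h (at y) v" for v .
    moreover have "(\<lambda>y. \<phi> (y, \<tau>) i) = (\<lambda>y. (e i * \<theta> \<tau>) * h y)" using that by (simp add: \<phi>_def mult_ac)
    ultimately show ?thesis by (simp add: z grad_tuple_def grad_def scaleR_sum_right)
  qed
  have grad_bound: "\<bar>tinner N X (grad_tuple \<phi> z)\<bar> \<le> (2 * (M * inverse \<rho>)) * (tnorm N X * indicator ?C z)" for X z
  proof -
    have eq: "tinner N X (grad_tuple \<phi> z) = tinner N X (\<lambda>i. e i *\<^sub>R (\<theta> (snd z) *\<^sub>R grad h (fst z)))"
      unfolding tinner_def by (intro sum.cong refl) (simp add: gr)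
    show ?thesis
    proof (cases "\<theta> (snd z) *\<^sub>R grad h (fst z) = 0")
      case True
      have "0 \<le> (2 * (M * inverse \<rho>)) * (tnorm N X * indicator ?C z)"
        using \<eta>(5) pos by (intro mult_nonneg_nonneg tnorm_nonneg) auto
      then show ?thesis unfolding eq True by (simp add: tinner_def)
    next
      case False
      then have "z \<in> ?C" using grads[of "fst z"] \<theta>s[of "snd z"] pos by (cases z) auto
      have "\<bar>tinner N X (grad_tuple \<phi> z)\<bar> \<le> L2_set e {..<N} * norm (\<theta> (snd z) *\<^sub>R grad h (fst z)) * tnorm N X"
        unfolding eq by (rule tinner_scaled_vector_bound)
      also have "\<dots> \<le> 1 * (2 * (M * inverse \<rho>)) * tnorm N X"
        unfolding norm_scaleR
        by (intro mult_mono mult_right_mono e \<theta>b gradb tnorm_nonneg) (use \<eta>(5) pos in auto)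
      finally show ?thesis using \<open>z \<in> ?C\<close> by simp
    qed
  qed
  \<comment> \<open>In the weak formulation \<open>f1\<close> carries the time derivative, \<open>f2\<close> the field and \<open>f3\<close> the right-hand side.\<close>
  define f1 where "f1 z = v z * (h (fst z) * d\<theta> (snd z))" for z
  define f2 where "f2 z = indicator U z * tinner N (A z (Du z)) (grad_tuple \<phi> z)" for z
  define f3 where "f3 z = indicator U z * tinner N (\<lambda>i. tnorm N (F z) powr (p - 2) *\<^sub>R F z i) (grad_tuple \<phi> z)" for z
  have iv: "integrable lebesgue v" unfolding v_def
    by (intro Bochner_Integration.integrable_sum integrable_mult_right u) auto
  have kb: "\<bar>space_kernel \<rho> x (fst z) * time_kernel \<epsilon> r (snd z)\<bar> \<le> inverse \<rho> ^ DIM('a) * inverse \<epsilon>" for r and z :: "'a \<times> real"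
    unfolding abs_mult by (intro mult_mono space_kernel_bound time_kernel_bound pos) (use pos in auto)
  have ivk: "integrable lebesgue (\<lambda>z. v z * (space_kernel \<rho> x (fst z) * time_kernel \<epsilon> r (snd z)))" for r
    by (rule integrable_mult_bounded[OF iv _ kb]) measurable
  have f1k: "inverse \<rho> ^ DIM('a) * f1 z = v z * (space_kernel \<rho> x (fst z) * time_kernel \<epsilon> s (snd z)) - v z * (space_kernel \<rho> x (fst z) * time_kernel \<epsilon> t (snd z))" for z
    unfolding f1_def h_def d\<theta>_def space_kernel_def by (simp add: algebra_simps)
  have i1': "integrable lebesgue (\<lambda>z. inverse \<rho> ^ DIM('a) * f1 z)"
    unfolding f1k by (intro Bochner_Integration.integrable_diff ivk)
  then have i1: "integrable lebesgue f1" using pos by simp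
  have mean_eq: "inverse \<rho> ^ DIM('a) * (\<integral>z. f1 z \<partial>lebesgue) = mean v \<rho> \<epsilon> x s - mean v \<rho> \<epsilon> x t"
  proof -
    have "inverse \<rho> ^ DIM('a) * (\<integral>z. f1 z \<partial>lebesgue) = (\<integral>z. inverse \<rho> ^ DIM('a) * f1 z \<partial>lebesgue)"
      by (rule integral_mult_right_zero[symmetric])
    also have "\<dots> = mean v \<rho> \<epsilon> x s - mean v \<rho> \<epsilon> x t"
      unfolding f1k mean_def by (rule Bochner_Integration.integral_diff[OF ivk ivk])
    finally show ?thesis .
  qed
  have f1u: "f1 z = indicator U z * tinner N (u z) (dt_tuple \<phi> z)" for z
  proof -
    have *: "tinner N (u z) (dt_tuple \<phi> z) = (\<Sum>i<N. e i * u z i) * (h (fst z) * d\<theta> (snd z))"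
      unfolding tinner_def sum_distrib_right by (intro sum.cong refl) (simp add: dt)
    show ?thesis
    proof (cases "h (fst z) * d\<theta> (snd z) = 0")
      case True show ?thesis unfolding * f1_def True by simp
    next
      case False
      then have "z \<in> ?C" using hs[of "fst z"] d\<theta>s[of "snd z"] pos by (cases z) auto
      then have "z \<in> C0" "z \<in> U" using CC0 CU by auto
      then show ?thesis unfolding * f1_def v_def by simp
    qed
  qed
  have AE_A: "AE z in lebesgue. \<bar>f2 z\<bar> \<le> (2 * (M * inverse \<rho>) * L) * (tnorm N (Du z) powr (p-1) * indicator ?C z)"
  proof -
    have "AE z in lebesgue. z \<in> U \<longrightarrow> (\<forall>\<xi>\<in>tuples N. \<nu> * tnorm N \<xi> powr p \<le> tinner N (A z \<xi>) \<xi> \<and>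
        tnorm N (A z \<xi>) \<le> L * tnorm N \<xi> powr (p - 1))"
      using str by (simp add: p_structure_def)
    then show ?thesis
    proof eventually_elim
      case (elim z)
      show ?case
      proof (cases "z \<in> U")
        case False then show ?thesis using L \<eta>(5) pos by (simp add: f2_def)
      next
        case True
        then have "Du z \<in> tuples N" using Du by (simp add: measurable_tuple_def)
        with elim True have a: "tnorm N (A z (Du z)) \<le> L * tnorm N (Du z) powr (p - 1)" by blast
        have "\<bar>f2 z\<bar> = \<bar>tinner N (A z (Du z)) (grad_tuple \<phi> z)\<bar>" using True by (simp add: f2_def)
        also have "\<dots> \<le> (2 * (M * inverse \<rho>)) * (tnorm N (A z (Du z)) * indicator ?C z)" by (rule grad_bound)
        also have "\<dots> \<le> (2 * (M * inverse \<rho>)) * ((L * tnorm N (Du z) powr (p - 1)) * indicator ?C z)"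
          by (intro mult_left_mono mult_right_mono a) (use \<eta>(5) pos in auto)
        finally show ?thesis by (simp only: mult.assoc)
      qed
    qed
  qed
  have F_b: "\<bar>f3 z\<bar> \<le> (2 * (M * inverse \<rho>)) * (tnorm N (F z) powr (p-1) * indicator ?C z)" for z
  proof (cases "z \<in> U")
    case False then show ?thesis using \<eta>(5) pos by (simp add: f3_def)
  next
    case True
    have "tnorm N (\<lambda>i. tnorm N (F z) powr (p - 2) *\<^sub>R F z i) = tnorm N (F z) powr (p - 2) * tnorm N (F z)"
      by (simp add: tnorm_scaleR)
    also have "\<dots> = tnorm N (F z) powr (p - 1)"
      using powr_add[of "tnorm N (F z)" "p - 2" 1] tnorm_nonneg[of N "F z"] by simp
    finally have *: "tnorm N (\<lambda>i. tnorm N (F z) powr (p - 2) *\<^sub>R F z i) = tnorm N (F z) powr (p - 1)" .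
    show ?thesis using grad_bound[of "\<lambda>i. tnorm N (F z) powr (p - 2) *\<^sub>R F z i" z] True unfolding * f3_def by simp
  qed
  note mC = cylinder_measurable[of x \<rho> "s-\<epsilon>" "t+\<epsilon>"]
  note n2 = abs_integral_le_nn_integral_AE[OF AE_A nD measurable_tnorm_powr(1)[OF Du U mC CU] _ b]
  have pc: "0 \<le> 2 * (M * inverse \<rho>) * L" "0 \<le> 2 * (M * inverse \<rho>)" using \<eta>(5) pos L by auto
  have cgh: "continuous_on UNIV (\<lambda>z::'a \<times> real. \<theta> (snd z) *\<^sub>R grad h (fst z))"
    unfolding grad_def
    by (intro continuous_intros continuous_on_compose2[OF smooth_continuous[OF sm\<theta>] _ subset_UNIV]
      continuous_on_compose2[OF smooth_continuous[OF smooth_frechet[OF smh]] _ subset_UNIV])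
  \<comment> \<open>Without measurability the integral of \<open>f2 - f1\<close> could not be split.\<close>
  have f2m: "f2 \<in> borel_measurable lebesgue"
  proof -
    have f2: "f2 = (\<lambda>z. \<Sum>i<N. (indicator U z *\<^sub>R A z (Du z) i) \<bullet> (e i *\<^sub>R (\<theta> (snd z) *\<^sub>R grad h (fst z))))"
      unfolding f2_def tinner_def by (auto simp: fun_eq_iff sum_distrib_left gr mult_ac intro!: sum.cong)
    have "U \<inter> space lebesgue \<in> sets lebesgue" using U by simp
    then have "(\<lambda>z. indicator U z *\<^sub>R A z (Du z) i) \<in> borel_measurable lebesgue" if "i < N" for i
      using caratheodory_measurable[OF U car Du that] by (rule iffD1[OF borel_measurable_restrict_space_iff])
    then have "(\<lambda>z. (indicator U z *\<^sub>R A z (Du z) i) \<bullet> (e i *\<^sub>R (\<theta> (snd z) *\<^sub>R grad h (fst z)))) \<in> borel_measurable lebesgue"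
      if "i < N" for i
      by (rule borel_measurable_inner[OF _ borel_measurable_scaleR[OF borel_measurable_const continuous_imp_lebesgue_measurable[OF cgh]]]) (rule that)
    then show ?thesis unfolding f2 by (intro borel_measurable_sum) simp
  qed
  have i2: "integrable lebesgue f2"
    using f2m n2(1)[OF pc(1)] by (intro integrableI_bounded) (auto intro: le_less_trans)
  have "(LINT z:U|lebesgue. - tinner N (u z) (dt_tuple \<phi> z) + tinner N (A z (Du z)) (grad_tuple \<phi> z))
      = (LINT z:U|lebesgue. tinner N (\<lambda>i. tnorm N (F z) powr (p - 2) *\<^sub>R F z i) (grad_tuple \<phi> z))"
    using sol tt unfolding weak_solution_def by blast
  then have "(\<integral>z. f2 z - f1 z \<partial>lebesgue) = (\<integral>z. f3 z \<partial>lebesgue)"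
    unfolding set_lebesgue_integral_def f1u f2_def f3_def by (simp add: algebra_simps)
  then have "(\<integral>z. f1 z \<partial>lebesgue) = (\<integral>z. f2 z \<partial>lebesgue) - (\<integral>z. f3 z \<partial>lebesgue)"
    using Bochner_Integration.integral_diff[OF i2 i1] by simp
  moreover have "\<bar>\<integral>z. f2 z \<partial>lebesgue\<bar> \<le> 2 * (M * inverse \<rho>) * L * b" by (rule n2(2)[OF pc(1)])
  moreover have "\<bar>\<integral>z. f3 z \<partial>lebesgue\<bar> \<le> 2 * (M * inverse \<rho>) * b"
    by (rule abs_integral_le_nn_integral[OF F_b nF measurable_tnorm_powr(1)[OF F U mC CU] pc(2) b])
  ultimately have "\<bar>\<integral>z. f1 z \<partial>lebesgue\<bar> \<le> 2 * (M * inverse \<rho>) * L * b + 2 * (M * inverse \<rho>) * b" by linarith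
  also have "\<dots> = 2 * (M * inverse \<rho>) * (L + 1) * b" by (simp add: algebra_simps)
  finally have f1b: "\<bar>\<integral>z. f1 z \<partial>lebesgue\<bar> \<le> 2 * (M * inverse \<rho>) * (L + 1) * b" .
  have "\<bar>mean v \<rho> \<epsilon> x t - mean v \<rho> \<epsilon> x s\<bar> = \<bar>inverse \<rho> ^ DIM('a) * (\<integral>z. f1 z \<partial>lebesgue)\<bar>"
    unfolding mean_eq by (rule abs_minus_commute)
  also have "\<dots> = inverse \<rho> ^ DIM('a) * \<bar>\<integral>z. f1 z \<partial>lebesgue\<bar>" using pos by (simp add: abs_mult)
  also have "\<dots> \<le> inverse \<rho> ^ DIM('a) * (2 * (M * inverse \<rho>) * (L + 1) * b)"
    by (intro mult_left_mono f1b) (use pos in auto)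
  finally show ?thesis .
qed

end

section \<open>The estimate at a pair of Lebesgue points\<close>

lemma emeasure_cylinder:
  assumes "0 \<le> \<sigma>" "a \<le> b"
  shows "emeasure lebesgue (ball y \<sigma> \<times> {a<..<b} :: ('a::euclidean_space \<times> real) set)
    = ennreal (measure lborel (ball (0::'a) 1) * \<sigma> ^ DIM('a) * (b - a))"
proof -
  have "emeasure lebesgue (ball y \<sigma> \<times> {a<..<b}) = emeasure lborel (ball y \<sigma> \<times> {a<..<b})"
    by (simp add: borel_open open_Times)
  also have "\<dots> = emeasure lborel (ball y \<sigma>) * emeasure lborel {a<..<b}"
    unfolding lborel_prod[symmetric] by (rule lborel.emeasure_pair_measure_Times) auto
  also have "emeasure lborel (ball y \<sigma>) = ennreal (measure lborel (ball y \<sigma>))"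
    using emeasure_lborel_ball_finite[of y \<sigma>] by (intro emeasure_eq_ennreal_measure) auto
  also have "measure lborel (ball y \<sigma>) = \<sigma> ^ DIM('a) * measure lborel (ball (0::'a) 1)"
    by (rule content_ball_conv_unit_ball[OF assms(1)])
  also have "emeasure lborel {a<..<b} = ennreal (b - a)" using assms(2) by simp
  finally show ?thesis using assms by (simp add: ennreal_mult'[symmetric] mult_ac)
qed

text \<open>
  A substitute for Jensen's inequality: with \<open>l\<^sup>q\<close> bounding the average of \<open>H\<^sup>q\<close> it yields
  \<open>2 l\<^sup>a\<close> as a bound for the average of \<open>H\<^sup>a\<close>, for every exponent \<open>a \<le> q\<close>.
\<close>

lemma powr_le_one_plus_powr:
  assumes "0 \<le> H" "1 \<le> l" "0 < a" "a \<le> q"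
  shows "H powr a \<le> l powr a + l powr (a - q) * H powr (q::real)"
proof -
  have l: "0 < l" using assms by simp
  have "(H / l) powr a \<le> 1 + (H / l) powr q"
  proof (cases "H / l \<le> 1")
    case True
    then have "(H / l) powr a \<le> 1" using assms by (intro powr_le1) auto
    then show ?thesis by (simp add: add_increasing2)
  next
    case False
    then have "(H / l) powr a \<le> (H / l) powr q" using assms by (intro powr_mono) auto
    then show ?thesis by simp
  qed
  then have "l powr a * (H / l) powr a \<le> l powr a * (1 + (H / l) powr q)" by (intro mult_left_mono) auto
  moreover have "l powr a * (H / l) powr a = H powr a" using l assms by (simp add: powr_divide)
  moreover have "l powr a * (1 + (H / l) powr q) = l powr a + l powr (a - q) * H powr q"
    using l assms by (simp add: powr_divide powr_diff distrib_left)
  ultimately show ?thesis by simp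
qed

context bumps begin

lemma mean_sum:
  assumes "\<And>i. i < N \<Longrightarrow> integrable lebesgue (w i)" "0 < \<rho>" "0 < \<epsilon>"
  shows "mean (\<lambda>z. \<Sum>i<N. e i * w i z) \<rho> \<epsilon> x t = (\<Sum>i<N. e i * mean (w i) \<rho> \<epsilon> x t)"
proof -
  let ?k = "\<lambda>z. space_kernel \<rho> x (fst z) * time_kernel \<epsilon> t (snd z)"
  have kb: "\<bar>?k z\<bar> \<le> inverse \<rho> ^ DIM('a) * inverse \<epsilon>" for z
    unfolding abs_mult by (intro mult_mono space_kernel_bound time_kernel_bound assms) (use assms in auto)
  have i: "integrable lebesgue (\<lambda>z. w i z * ?k z)" if "i < N" for i
    by (rule integrable_mult_bounded[OF assms(1)[OF that] _ kb]) measurable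
  have "mean (\<lambda>z. \<Sum>i<N. e i * w i z) \<rho> \<epsilon> x t = (\<integral>z. (\<Sum>i<N. e i * (w i z * ?k z)) \<partial>lebesgue)"
    unfolding mean_def sum_distrib_right by (simp only: mult.assoc)
  also have "\<dots> = (\<Sum>i<N. \<integral>z. e i * (w i z * ?k z) \<partial>lebesgue)"
    by (rule Bochner_Integration.integral_sum) (use i in \<open>auto intro: integrable_mult_right\<close>)
  also have "\<dots> = (\<Sum>i<N. e i * mean (w i) \<rho> \<epsilon> x t)"
    unfolding mean_def by (simp only: integral_mult_right_zero)
  finally show ?thesis .
qed

lemma weak_grad_sum:
  fixes w :: "nat \<Rightarrow> 'a \<times> real \<Rightarrow> real" and G :: "nat \<Rightarrow> 'a \<times> real \<Rightarrow> 'a"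
  assumes w: "\<And>i. i < N \<Longrightarrow> integrable lebesgue (w i)" and G: "\<And>i. i < N \<Longrightarrow> integrable lebesgue (G i)"
    and \<psi>: "test_fun U \<psi>" and \<theta>: "continuous_on UNIV \<theta>" "\<exists>C. \<forall>s. \<bar>\<theta> s\<bar> \<le> C" and b: "b \<in> Basis"
    and wg: "\<And>i. i < N \<Longrightarrow> (\<integral>z. w i z * (\<theta> (snd z) * (grad \<psi> (fst z) \<bullet> b)) \<partial>lebesgue)
      = - (\<integral>z. (G i z \<bullet> b) * (\<theta> (snd z) * \<psi> (fst z)) \<partial>lebesgue)"
  shows "(\<integral>z. (\<Sum>i<N. e i * w i z) * (\<theta> (snd z) * (grad \<psi> (fst z) \<bullet> b)) \<partial>lebesgue)
      = - (\<integral>z. ((\<Sum>i<N. e i *\<^sub>R G i z) \<bullet> b) * (\<theta> (snd z) * \<psi> (fst z)) \<partial>lebesgue)"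
proof -
  have iG: "integrable lebesgue (\<lambda>z. G i z \<bullet> b)" if "i < N" for i
    by (rule integrable_inner_left) (use G that in simp)
  have "(\<integral>z. (\<Sum>i<N. e i * w i z) * (\<theta> (snd z) * (grad \<psi> (fst z) \<bullet> b)) \<partial>lebesgue)
     = (\<integral>z. (\<Sum>i<N. e i * (w i z * (\<theta> (snd z) * (grad \<psi> (fst z) \<bullet> b)))) \<partial>lebesgue)"
    unfolding sum_distrib_right by (simp only: mult.assoc)
  also have "\<dots> = (\<Sum>i<N. e i * (\<integral>z. w i z * (\<theta> (snd z) * (grad \<psi> (fst z) \<bullet> b)) \<partial>lebesgue))"
    by (subst Bochner_Integration.integral_sum)
       (auto intro!: integrable_mult_right integrable_test_weights(1)[OF w \<psi> \<theta> b] simp del: integrable_mult_left_iff)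
  also have "\<dots> = - (\<Sum>i<N. e i * (\<integral>z. (G i z \<bullet> b) * (\<theta> (snd z) * \<psi> (fst z)) \<partial>lebesgue))"
    unfolding sum_negf[symmetric] by (intro sum.cong refl) (simp add: wg)
  also have "(\<Sum>i<N. e i * (\<integral>z. (G i z \<bullet> b) * (\<theta> (snd z) * \<psi> (fst z)) \<partial>lebesgue))
     = (\<integral>z. (\<Sum>i<N. e i * ((G i z \<bullet> b) * (\<theta> (snd z) * \<psi> (fst z)))) \<partial>lebesgue)"
    by (subst Bochner_Integration.integral_sum)
       (auto intro!: integrable_mult_right integrable_test_weights(2)[OF iG \<psi> \<theta> b] simp del: integrable_mult_left_iff)
  also have "\<dots> = (\<integral>z. ((\<Sum>i<N. e i *\<^sub>R G i z) \<bullet> b) * (\<theta> (snd z) * \<psi> (fst z)) \<partial>lebesgue)"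
    unfolding inner_sum_left inner_scaleR_left sum_distrib_right by (simp only: mult.assoc)
  finally show ?thesis .
qed

text \<open>
  The function \<open>H\<close> stands for the function inside the maximal function, and \<open>l\<close> for its common size at the
  two points. The bound \<open>tnorm N (u z) \<le> r * H z\<close> takes over where the balancing radius exceeds \<open>r\<close>.
\<close>

lemma pointwise_estimate:
  fixes u :: "'a \<times> real \<Rightarrow> nat \<Rightarrow> real" and Du F :: "'a \<times> real \<Rightarrow> nat \<Rightarrow> 'a" and H :: "'a \<times> real \<Rightarrow> real"
  assumes U: "U \<in> sets lebesgue" and p: "1 < p" and L: "0 < L"
    and car: "caratheodory_field N U A" and str: "p_structure N p \<nu> L U A"
    and sol: "weak_solution N p U A F u Du"
    and Du: "measurable_tuple N U Du" and F: "measurable_tuple N U F"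
    and r: "0 < r" and C0U: "pcyl x0 t0 (2*r) \<subseteq> U"
    and iu: "\<And>i. i < N \<Longrightarrow> integrable lebesgue (\<lambda>z. indicator (pcyl x0 t0 (2*r)) z * u z i)"
    and iG: "\<And>i. i < N \<Longrightarrow> integrable lebesgue (\<lambda>z. indicator (pcyl x0 t0 (2*r)) z *\<^sub>R Du z i)"
    and wg: "\<And>i. i < N \<Longrightarrow> AE \<tau> in lebesgue. \<tau> \<in> pint t0 (2*r) \<longrightarrow>
        weak_grad (ball x0 (2*r)) (\<lambda>y. u (y, \<tau>) i) (\<lambda>y. Du (y, \<tau>) i)"
    and x: "x \<in> ball x0 r" and ts: "t \<in> pint t0 r" "s \<in> pint t0 r" "s < t"
    and lim: "\<And>i \<tau>. i < N \<Longrightarrow> \<tau> \<in> {s, t} \<Longrightarrow>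
        ((\<lambda>\<epsilon>. mean (\<lambda>z. indicator (pcyl x0 t0 (2*r)) z * u z i) \<epsilon> \<epsilon> x \<tau>) \<longlongrightarrow> mass * u (x, \<tau>) i) (at_right 0)"
    and H0: "\<And>z. 0 \<le> H z" and Hm: "(\<lambda>z. H z * indicator (pcyl x0 t0 (2*r)) z) \<in> borel_measurable lebesgue"
    and HD: "\<And>z. tnorm N (Du z) \<le> H z" and HF: "\<And>z. tnorm N (F z) \<le> H z" and Hu: "\<And>z. 2 < p \<Longrightarrow> tnorm N (u z) \<le> r * H z"
    and l: "1 \<le> l"
    and max: "\<And>y \<sigma> a b. 0 \<le> \<sigma> \<Longrightarrow> a \<le> b \<Longrightarrow> ball y \<sigma> \<times> {a<..<b} \<subseteq> pcyl x0 t0 (2*r) \<Longrightarrow>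
        (x, t) \<in> ball y \<sigma> \<times> {a<..<b} \<or> (x, s) \<in> ball y \<sigma> \<times> {a<..<b} \<Longrightarrow>
        (\<integral>\<^sup>+z. ennreal (H z powr (max 1 (p-1)) * indicator (ball y \<sigma> \<times> {a<..<b}) z) \<partial>lebesgue)
          \<le> ennreal (l powr (max 1 (p-1)) * (measure lborel (ball (0::'a) 1) * \<sigma> ^ DIM('a) * (b - a)))"
  shows "mass * tnorm N (\<lambda>i. u (x, t) i - u (x, s) i)
    \<le> measure lborel (ball (0::'a) 1) * (8 + 8 * M * (L + 1)) * (sqrt (t - s) * l powr (p/2))"
proof -
  define C0 where "C0 = pcyl x0 t0 (2*r)"
  define \<omega> where "\<omega> = measure lborel (ball (0::'a) 1)"
  define q where "q = max 1 (p-1)"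
  note C0U = C0U[folded C0_def] and iu = iu[folded C0_def] and iG = iG[folded C0_def] and lim = lim[folded C0_def]
    and Hm = Hm[folded C0_def] and max = max[folded C0_def \<omega>_def q_def]
  have \<omega>: "0 < \<omega>" unfolding \<omega>_def by (rule content_ball_pos) simp
  have l0: "0 < l" using l by simp
  have C0s: "C0 \<in> sets lebesgue" unfolding C0_def pcyl_def pint_def by (rule cylinder_measurable)
  \<comment> \<open>Twice the cylinder leaves room for radius \<open>r\<close> in space and \<open>r\<^sup>2\<close> in time around either point.\<close>
  have fit: "cball x \<sigma> \<times> {a..b} \<subseteq> C0" if "\<sigma> \<le> r" "t0 - 2 * r\<^sup>2 \<le> a" "b \<le> t0 + 2 * r\<^sup>2" for \<sigma> a b
  proof
    fix z assume z: "z \<in> cball x \<sigma> \<times> {a..b}"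
    obtain y \<tau> where [simp]: "z = (y, \<tau>)" by fastforce
    have "dist x0 y \<le> dist x0 x + dist x y" by (rule dist_triangle)
    then have "y \<in> ball x0 (2*r)" using z x that(1) by auto
    moreover have "0 < r\<^sup>2" using r by simp
    moreover have "a \<le> \<tau>" "\<tau> \<le> b" using z by auto
    ultimately have "y \<in> ball x0 (2*r)" "t0 - 4 * r\<^sup>2 < \<tau>" "\<tau> < t0 + 4 * r\<^sup>2" using that(2,3) by (blast, linarith+)
    then have "t0 - (2*r)\<^sup>2 < \<tau>" "\<tau> < t0 + (2*r)\<^sup>2" by (simp_all add: power_mult_distrib)
    with \<open>y \<in> ball x0 (2*r)\<close> show "z \<in> C0" by (simp add: C0_def pcyl_def pint_def)
  qed
  have fit': "ball x \<sigma> \<times> {a<..<b} \<subseteq> C0" if "\<sigma> \<le> r" "t0 - 2 * r\<^sup>2 \<le> a" "b \<le> t0 + 2 * r\<^sup>2" for \<sigma> a b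
    using fit[OF that] ball_subset_cball[of x \<sigma>] by fastforce
  have tsr: "t0 - r\<^sup>2 < s" "t < t0 + r\<^sup>2" using ts by (auto simp: pint_def)
  have x_in: "(x, t) \<in> C0" "(x, s) \<in> C0"
    using fit[of 0 s t] r ts tsr by (auto simp: less_imp_le intro!: subsetD[OF fit[of 0 s t]])
  have avg: "(\<integral>\<^sup>+z. ennreal (H z powr a * indicator (ball x \<sigma> \<times> {c<..<d}) z) \<partial>lebesgue)
      \<le> ennreal (2 * l powr a * (\<omega> * \<sigma> ^ DIM('a) * (d - c)))"
    if a: "0 < a" "a \<le> q" and c: "0 < \<sigma>" "\<sigma> \<le> r" "t0 - 2 * r\<^sup>2 \<le> c" "d \<le> t0 + 2 * r\<^sup>2" "c < t \<and> t < d \<or> c < s \<and> s < d" for a \<sigma> c d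
  proof -
    let ?C = "ball x \<sigma> \<times> {c<..<d}"
    have cd: "c \<le> d" using c(5) by linarith
    have CC: "?C \<subseteq> C0" by (rule fit'[OF c(2-4)])
    note [measurable] = cylinder_measurable[of x \<sigma> c d] Hm
    have eq: "H z powr q * indicator ?C z = (H z * indicator C0 z) powr q * indicator ?C z" for z
      using CC by (auto simp: indicator_def)
    have m: "(\<lambda>z. H z powr q * indicator ?C z) \<in> borel_measurable lebesgue" unfolding eq by measurable
    have "(\<integral>\<^sup>+z. ennreal (H z powr a * indicator ?C z) \<partial>lebesgue)
        \<le> (\<integral>\<^sup>+z. ennreal (l powr a) * indicator ?C z + ennreal (l powr (a - q)) * ennreal (H z powr q * indicator ?C z) \<partial>lebesgue)"
    proof (rule nn_integral_mono)
      fix z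
      show "ennreal (H z powr a * indicator ?C z) \<le> ennreal (l powr a) * indicator ?C z + ennreal (l powr (a - q)) * ennreal (H z powr q * indicator ?C z)"
        using powr_le_one_plus_powr[OF H0 l a, of z]
        by (auto simp: indicator_def ennreal_mult'[symmetric] ennreal_plus[symmetric] simp del: ennreal_plus intro!: ennreal_leI)
    qed
    also have "\<dots> = ennreal (l powr a) * emeasure lebesgue ?C + ennreal (l powr (a - q)) * (\<integral>\<^sup>+z. ennreal (H z powr q * indicator ?C z) \<partial>lebesgue)"
      using m by (subst nn_integral_add) (auto simp: nn_integral_cmult)
    also have "\<dots> \<le> ennreal (l powr a) * ennreal (\<omega> * \<sigma> ^ DIM('a) * (d - c)) + ennreal (l powr (a - q)) * ennreal (l powr q * (\<omega> * \<sigma> ^ DIM('a) * (d - c)))"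
    proof (intro add_mono mult_left_mono)
      show "emeasure lebesgue ?C \<le> ennreal (\<omega> * \<sigma> ^ DIM('a) * (d - c))"
        unfolding \<omega>_def using emeasure_cylinder[of \<sigma> c d x] c(1) cd by simp
      show "(\<integral>\<^sup>+z. ennreal (H z powr q * indicator ?C z) \<partial>lebesgue) \<le> ennreal (l powr q * (\<omega> * \<sigma> ^ DIM('a) * (d - c)))"
        by (rule max) (use c(1,5) cd CC in auto)
    qed auto
    also have "\<dots> = ennreal (2 * l powr a * (\<omega> * \<sigma> ^ DIM('a) * (d - c)))"
    proof -
      have nn: "0 \<le> \<omega> * \<sigma> ^ DIM('a) * (d - c)" using \<omega> c(1) cd by simp
      have "l powr (a - q) * (l powr q * (\<omega> * \<sigma> ^ DIM('a) * (d - c))) = l powr a * (\<omega> * \<sigma> ^ DIM('a) * (d - c))"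
        using l0 by (simp add: powr_diff)
      then show ?thesis using nn
        by (simp add: ennreal_mult'[symmetric] ennreal_plus[symmetric] del: ennreal_plus)
    qed
    finally show ?thesis .
  qed
  define \<delta> where "\<delta> i = u (x, t) i - u (x, s) i" for i
  show ?thesis
  proof (cases "tnorm N \<delta> = 0")
    case True
    then show ?thesis using \<omega> \<eta>(5) L l ts unfolding \<delta>_def[abs_def] \<omega>_def by simp
  next
    case False
    \<comment> \<open>Projecting onto the unit vector \<open>e\<close> along the increment loses nothing at these two times.\<close>
    define e where "e i = \<delta> i / tnorm N \<delta>" for i
    have np: "0 < tnorm N \<delta>" using False tnorm_nonneg[of N \<delta>] by linarith
    have tn: "tnorm N \<delta> = L2_set \<delta> {..<N}" by (simp add: tnorm_def L2_set_def)
    have e1: "L2_set e {..<N} = 1"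
    proof -
      have "L2_set e {..<N} = L2_set (\<lambda>i. inverse (tnorm N \<delta>) * \<delta> i) {..<N}" by (simp add: e_def[abs_def] divide_inverse mult.commute)
      also have "\<dots> = inverse (tnorm N \<delta>) * L2_set \<delta> {..<N}" using np by (intro L2_set_right_distrib[symmetric]) simp
      finally show ?thesis using np tn by simp
    qed
    have e\<delta>: "(\<Sum>i<N. e i * \<delta> i) = tnorm N \<delta>"
    proof -
      have "(\<Sum>i<N. e i * \<delta> i) = (\<Sum>i<N. (\<delta> i)\<^sup>2) / tnorm N \<delta>"
        by (simp add: e_def sum_divide_distrib power2_eq_square)
      also have "(\<Sum>i<N. (\<delta> i)\<^sup>2) = (tnorm N \<delta>)\<^sup>2" by (simp add: tn L2_set_def sum_nonneg)
      finally show ?thesis using np by (simp add: power2_eq_square)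
    qed
    define v where "v z = (\<Sum>i<N. e i * (indicator C0 z * u z i))" for z
    define G where "G z = (\<Sum>i<N. e i *\<^sub>R (indicator C0 z *\<^sub>R Du z i))" for z
    have iv: "integrable lebesgue v" unfolding v_def[abs_def]
      by (intro Bochner_Integration.integrable_sum integrable_mult_right iu) auto
    have iG': "integrable lebesgue G" unfolding G_def[abs_def]
      by (intro Bochner_Integration.integrable_sum integrable_scaleR_right iG) auto
    have limv: "((\<lambda>\<epsilon>. mean v \<epsilon> \<epsilon> x \<tau>) \<longlongrightarrow> mass * (\<Sum>i<N. e i * u (x, \<tau>) i)) (at_right 0)" if "\<tau> \<in> {s, t}" for \<tau>
    proof -
      have "((\<lambda>\<epsilon>. \<Sum>i<N. e i * mean (\<lambda>z. indicator C0 z * u z i) \<epsilon> \<epsilon> x \<tau>) \<longlongrightarrow> (\<Sum>i<N. e i * (mass * u (x, \<tau>) i))) (at_right 0)"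
        by (intro tendsto_sum tendsto_mult tendsto_const lim that) auto
      moreover have "\<forall>\<^sub>F \<epsilon> in at_right 0. (\<Sum>i<N. e i * mean (\<lambda>z. indicator C0 z * u z i) \<epsilon> \<epsilon> x \<tau>) = mean v \<epsilon> \<epsilon> x \<tau>"
        unfolding eventually_at_right_field v_def[abs_def]
        by (intro exI[of _ 1]) (auto simp: mean_sum[OF iu])
      ultimately have "((\<lambda>\<epsilon>. mean v \<epsilon> \<epsilon> x \<tau>) \<longlongrightarrow> (\<Sum>i<N. e i * (mass * u (x, \<tau>) i))) (at_right 0)"
        by (rule Lim_transform_eventually)
      then show ?thesis by (simp add: sum_distrib_left mult_ac)
    qed
    have limd: "((\<lambda>\<epsilon>. \<bar>mean v \<epsilon> \<epsilon> x t - mean v \<epsilon> \<epsilon> x s\<bar>) \<longlongrightarrow> mass * tnorm N \<delta>) (at_right 0)"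
    proof -
      have "((\<lambda>\<epsilon>. \<bar>mean v \<epsilon> \<epsilon> x t - mean v \<epsilon> \<epsilon> x s\<bar>) \<longlongrightarrow> \<bar>mass * (\<Sum>i<N. e i * u (x, t) i) - mass * (\<Sum>i<N. e i * u (x, s) i)\<bar>) (at_right 0)"
        by (intro tendsto_rabs tendsto_diff limv) auto
      moreover have "mass * (\<Sum>i<N. e i * u (x, t) i) - mass * (\<Sum>i<N. e i * u (x, s) i) = mass * tnorm N \<delta>"
        unfolding e\<delta>[symmetric] right_diff_distrib[symmetric] sum_subtractf[symmetric] \<delta>_def ..
      ultimately show ?thesis using mass_pos np by simp
    qed
    have Gb: "norm (G z) \<le> H z * indicator C0 z" for z
    proof (cases "z \<in> C0")
      case True
      have "norm (G z) \<le> (\<Sum>i<N. norm (e i *\<^sub>R Du z i))" unfolding G_def using True by (simp add: sum_norm_le)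
      also have "\<dots> = (\<Sum>i<N. \<bar>e i\<bar> * \<bar>norm (Du z i)\<bar>)" by simp
      also have "\<dots> \<le> L2_set e {..<N} * tnorm N (Du z)" unfolding tnorm_def by (rule L2_set_mult_ineq)
      finally show ?thesis using e1 HD[of z] True by simp
    qed (simp add: G_def)
    have vb: "\<bar>v z\<bar> \<le> tnorm N (u z)" for z
    proof (cases "z \<in> C0")
      case True
      have "\<bar>v z\<bar> \<le> (\<Sum>i<N. \<bar>e i\<bar> * \<bar>norm (u z i)\<bar>)"
        unfolding v_def using True by (auto simp: abs_mult intro: order_trans[OF sum_abs])
      also have "\<dots> \<le> L2_set e {..<N} * tnorm N (u z)" unfolding tnorm_def by (rule L2_set_mult_ineq)
      finally show ?thesis using e1 by simp
    qed (simp add: v_def tnorm_nonneg)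
    have wgv: "(\<integral>z. v z * (\<theta> (snd z) * (grad \<psi> (fst z) \<bullet> b)) \<partial>lebesgue) = - (\<integral>z. (G z \<bullet> b) * (\<theta> (snd z) * \<psi> (fst z)) \<partial>lebesgue)"
      if "test_fun (ball x0 (2*r)) \<psi>" "continuous_on UNIV \<theta>" "\<exists>C. \<forall>s. \<bar>\<theta> s\<bar> \<le> C" "b \<in> Basis" for \<psi> \<theta> b
      unfolding v_def G_def
    proof (rule weak_grad_sum[OF iu iG that])
      fix i assume i: "i < N"
      show "(\<integral>z. (indicator C0 z * u z i) * (\<theta> (snd z) * (grad \<psi> (fst z) \<bullet> b)) \<partial>lebesgue)
        = - (\<integral>z. ((indicator C0 z *\<^sub>R Du z i) \<bullet> b) * (\<theta> (snd z) * \<psi> (fst z)) \<partial>lebesgue)"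
        using weak_grad_spacetime[OF _ _ _ that, of "pint t0 (2*r)" "\<lambda>z. u z i" "\<lambda>z. Du z i"] iu[OF i] iG[OF i] wg[OF i]
        unfolding C0_def pcyl_def by blast
    qed
    have cbU: "cball x \<rho> \<subseteq> ball x0 (2*r)" if "\<rho> \<le> r" for \<rho>
      using fit[of \<rho> t t] that tsr ts r by (auto simp: C0_def pcyl_def)
    have q: "1 \<le> q" "p - 1 \<le> q" by (auto simp: q_def)
    have space: "\<bar>mean v \<rho> \<epsilon> x \<tau> - mean v \<epsilon> \<epsilon> x \<tau>\<bar> \<le> 4 * \<omega> * l * \<rho>"
      if \<rho>: "0 < \<epsilon>" "\<epsilon> \<le> \<rho>" "\<rho> \<le> r" "\<epsilon> \<le> r\<^sup>2" and \<tau>: "\<tau> \<in> {s, t}" for \<rho> \<epsilon> \<tau>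
    proof -
      have "\<bar>mean v \<rho> \<epsilon> x \<tau> - mean v \<epsilon> \<epsilon> x \<tau>\<bar> \<le> (4 * \<omega> * l) * (\<rho> - \<epsilon>)"
      proof (rule spatial_oscillation[OF iv iG' \<rho>(1,2) wgv cbU[OF \<rho>(3)]])
        fix \<sigma> assume \<sigma>: "\<epsilon> \<le> \<sigma>" "\<sigma> \<le> \<rho>"
        let ?C = "ball x \<sigma> \<times> {\<tau>-\<epsilon><..<\<tau>+\<epsilon>}"
        have "(\<integral>\<^sup>+z. ennreal (norm (G z) * indicator ?C z) \<partial>lebesgue) \<le> (\<integral>\<^sup>+z. ennreal (H z powr 1 * indicator ?C z) \<partial>lebesgue)"
        proof (intro nn_integral_mono ennreal_leI mult_right_mono)
          show "norm (G z) \<le> H z powr 1" for z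
            using Gb[of z] H0[of z] by (cases "z \<in> C0") auto
        qed auto
        also have "\<dots> \<le> ennreal (2 * l powr 1 * (\<omega> * \<sigma> ^ DIM('a) * ((\<tau>+\<epsilon>) - (\<tau>-\<epsilon>))))"
          by (rule avg) (use \<rho> \<sigma> \<tau> tsr ts q in auto)
        also have "2 * l powr 1 * (\<omega> * \<sigma> ^ DIM('a) * ((\<tau>+\<epsilon>) - (\<tau>-\<epsilon>))) = 4 * \<omega> * l * (\<sigma> ^ DIM('a) * \<epsilon>)"
          using l0 by simp
        finally show "(\<integral>\<^sup>+z. ennreal (norm (G z) * indicator ?C z) \<partial>lebesgue) \<le> ennreal (4 * \<omega> * l * (\<sigma> ^ DIM('a) * \<epsilon>))" .
      qed (use \<omega> l0 in auto)
      also have "\<dots> \<le> (4 * \<omega> * l) * \<rho>" using \<rho> \<omega> l0 by (intro mult_left_mono) auto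
      finally show ?thesis .
    qed
    define T where "T = 4 * M * (L + 1) * \<omega> * l powr (p - 1)"
    have time: "\<bar>mean v \<rho> \<epsilon> x t - mean v \<rho> \<epsilon> x s\<bar> \<le> T * (t - s + 2 * \<epsilon>) / \<rho>"
      if \<rho>: "0 < \<epsilon>" "0 < \<rho>" "\<rho> \<le> r" "\<epsilon> \<le> r\<^sup>2" for \<rho> \<epsilon>
    proof -
      let ?C = "ball x \<rho> \<times> {s-\<epsilon><..<t+\<epsilon>}"
      define b where "b = 2 * l powr (p - 1) * (\<omega> * \<rho> ^ DIM('a) * ((t+\<epsilon>) - (s-\<epsilon>)))"
      have bH: "(\<integral>\<^sup>+z. ennreal (H z powr (p-1) * indicator ?C z) \<partial>lebesgue) \<le> ennreal b"
        unfolding b_def by (rule avg) (use \<rho> tsr ts q p in auto)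
      have bX: "(\<integral>\<^sup>+z. ennreal (tnorm N (X z) powr (p-1) * indicator ?C z) \<partial>lebesgue) \<le> ennreal b"
        if "\<And>z. tnorm N (X z) \<le> H z" for X :: "'a \<times> real \<Rightarrow> nat \<Rightarrow> 'a"
      proof (rule order_trans[OF _ bH], intro nn_integral_mono ennreal_leI mult_right_mono)
        show "tnorm N (X z) powr (p-1) \<le> H z powr (p-1)" for z
          using p that tnorm_nonneg by (intro powr_mono2) auto
      qed auto
      have "\<bar>mean v \<rho> \<epsilon> x t - mean v \<rho> \<epsilon> x s\<bar> \<le> inverse \<rho> ^ DIM('a) * (2 * (M * inverse \<rho>) * (L + 1) * b)"
        unfolding v_def[abs_def]
      proof (rule temporal_oscillation[OF U p L car str sol Du F iu C0U _ \<rho>(2,1) ts(3) _ bX[OF HD] bX[OF HF]])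
        show "L2_set e {..<N} \<le> 1" using e1 by simp
        show "cball x \<rho> \<times> {s - \<epsilon>..t + \<epsilon>} \<subseteq> C0" by (rule fit) (use \<rho> tsr in auto)
        show "0 \<le> b" unfolding b_def using \<omega> \<rho> ts by (intro mult_nonneg_nonneg) auto
      qed
      also have "\<dots> = T * (t - s + 2 * \<epsilon>) / \<rho>"
      proof -
        have alg: "X * (2 * (M * R) * (L + 1) * (2 * lp * (\<omega> * Y * ((t+\<epsilon>) - (s-\<epsilon>))))) = (X * Y) * (4 * M * (L + 1) * \<omega> * lp * (t - s + 2 * \<epsilon>) * R)"
          for X Y R lp :: real by (simp add: algebra_simps)
        have "inverse \<rho> ^ DIM('a) * \<rho> ^ DIM('a) = 1" using \<rho>(2) by (simp add: power_inverse)
        then show ?thesis unfolding b_def T_def alg divide_inverse by simp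
      qed
      finally show ?thesis .
    qed
    have A: "mass * tnorm N \<delta> \<le> 8 * \<omega> * l * \<rho> + T * (t - s) / \<rho>" if \<rho>: "0 < \<rho>" "\<rho> \<le> r" for \<rho>
    proof (rule tendsto_le[OF trivial_limit_at_right_real _ limd])
      have "((\<lambda>\<epsilon>. 8 * \<omega> * l * \<rho> + T * (t - s + 2 * \<epsilon>) / \<rho>) \<longlongrightarrow> 8 * \<omega> * l * \<rho> + T * (t - s + 2 * 0) / \<rho>) (at_right 0)"
        using \<rho> by (intro tendsto_intros) auto
      then show "((\<lambda>\<epsilon>. 8 * \<omega> * l * \<rho> + T * (t - s + 2 * \<epsilon>) / \<rho>) \<longlongrightarrow> 8 * \<omega> * l * \<rho> + T * (t - s) / \<rho>) (at_right 0)" by simp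
      show "\<forall>\<^sub>F \<epsilon> in at_right 0. \<bar>mean v \<epsilon> \<epsilon> x t - mean v \<epsilon> \<epsilon> x s\<bar> \<le> 8 * \<omega> * l * \<rho> + T * (t - s + 2 * \<epsilon>) / \<rho>"
        unfolding eventually_at_right_field
      proof (intro exI[of _ "min \<rho> (r\<^sup>2)"] conjI allI impI)
        show "0 < min \<rho> (r\<^sup>2)" using \<rho> r by simp
        fix \<epsilon> assume \<epsilon>: "0 < \<epsilon>" "\<epsilon> < min \<rho> (r\<^sup>2)"
        have "\<bar>mean v \<rho> \<epsilon> x t - mean v \<epsilon> \<epsilon> x t\<bar> \<le> 4 * \<omega> * l * \<rho>" "\<bar>mean v \<rho> \<epsilon> x s - mean v \<epsilon> \<epsilon> x s\<bar> \<le> 4 * \<omega> * l * \<rho>"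
          using \<epsilon> \<rho> by (auto intro!: space)
        moreover have "\<bar>mean v \<rho> \<epsilon> x t - mean v \<rho> \<epsilon> x s\<bar> \<le> T * (t - s + 2 * \<epsilon>) / \<rho>" using \<epsilon> \<rho> by (intro time) auto
        ultimately show "\<bar>mean v \<epsilon> \<epsilon> x t - mean v \<epsilon> \<epsilon> x s\<bar> \<le> 8 * \<omega> * l * \<rho> + T * (t - s + 2 * \<epsilon>) / \<rho>" by linarith
      qed
    qed
    have B: "mass * tnorm N \<delta> \<le> 8 * \<omega> * l * r" if p2: "2 < p"
    proof (rule tendsto_le[OF trivial_limit_at_right_real tendsto_const limd])
      have mb: "\<bar>mean v \<epsilon> \<epsilon> x \<tau>\<bar> \<le> 4 * \<omega> * l * r" if \<epsilon>: "0 < \<epsilon>" "\<epsilon> \<le> r" "\<epsilon> \<le> r\<^sup>2" and \<tau>: "\<tau> \<in> {s, t}" for \<epsilon> \<tau>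
      proof -
        let ?C = "ball x \<epsilon> \<times> {\<tau>-\<epsilon><..<\<tau>+\<epsilon>}"
        have CC: "?C \<subseteq> C0" by (rule fit') (use \<epsilon> \<tau> tsr ts in auto)
        have "\<bar>mean v \<epsilon> \<epsilon> x \<tau>\<bar> \<le> (inverse \<epsilon> ^ DIM('a) * inverse \<epsilon> * r) * (2 * l powr 1 * (\<omega> * \<epsilon> ^ DIM('a) * ((\<tau>+\<epsilon>) - (\<tau>-\<epsilon>))))"
          unfolding mean_def
        proof (rule abs_integral_le_nn_integral)
          show "(\<integral>\<^sup>+z. ennreal (H z powr 1 * indicator ?C z) \<partial>lebesgue) \<le> ennreal (2 * l powr 1 * (\<omega> * \<epsilon> ^ DIM('a) * ((\<tau>+\<epsilon>) - (\<tau>-\<epsilon>))))"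
            by (rule avg) (use \<epsilon> \<tau> tsr ts q in auto)
          note [measurable] = cylinder_measurable[of x \<epsilon> "\<tau>-\<epsilon>" "\<tau>+\<epsilon>"] Hm
          have eq: "H z powr 1 * indicator ?C z = (H z * indicator C0 z) * indicator ?C z" for z
            using CC H0[of z] by (auto simp: indicator_def)
          show "(\<lambda>z. H z powr 1 * indicator ?C z) \<in> borel_measurable lebesgue" unfolding eq by measurable
          show "0 \<le> inverse \<epsilon> ^ DIM('a) * inverse \<epsilon> * r" using \<epsilon> r by simp
          show "0 \<le> 2 * l powr 1 * (\<omega> * \<epsilon> ^ DIM('a) * ((\<tau>+\<epsilon>) - (\<tau>-\<epsilon>)))" using \<epsilon> \<omega> by (intro mult_nonneg_nonneg) auto
          fix z
          show "\<bar>v z * (space_kernel \<epsilon> x (fst z) * time_kernel \<epsilon> \<tau> (snd z))\<bar> \<le> (inverse \<epsilon> ^ DIM('a) * inverse \<epsilon> * r) * (H z powr 1 * indicator ?C z)"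
          proof (cases "space_kernel \<epsilon> x (fst z) * time_kernel \<epsilon> \<tau> (snd z) = 0")
            case True show ?thesis unfolding True using H0[of z] \<epsilon> r by simp
          next
            case False
            then have "fst z \<in> ball x \<epsilon>" using support_scaled[OF \<epsilon>(1), of "fst z" x] by (auto simp: space_kernel_def)
            moreover have "\<tau> \<le> snd z" "snd z < \<tau> + \<epsilon>" using False time_kernel_support[OF \<epsilon>(1), of \<tau> "snd z"] by auto
            ultimately have z: "z \<in> ?C" using \<epsilon> by (cases z) auto
            have "\<bar>v z\<bar> \<le> r * H z" using vb[of z] Hu[OF p2, of z] by linarith
            then have "\<bar>v z * (space_kernel \<epsilon> x (fst z) * time_kernel \<epsilon> \<tau> (snd z))\<bar> \<le> (r * H z) * (inverse \<epsilon> ^ DIM('a) * inverse \<epsilon>)"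
              unfolding abs_mult
              by (intro mult_mono space_kernel_bound time_kernel_bound \<epsilon>) (use \<epsilon> r H0[of z] in auto)
            then show ?thesis using z H0[of z] by (simp add: mult_ac)
          qed
        qed
        also have "\<dots> = 4 * \<omega> * l * r"
        proof -
          have alg: "(X * R * r) * (2 * k * (\<omega> * Y * ((\<tau>+\<epsilon>) - (\<tau>-\<epsilon>)))) = (X * Y) * (R * \<epsilon>) * (4 * \<omega> * k * r)"
            for X Y R k :: real by (simp add: algebra_simps)
          have "inverse \<epsilon> ^ DIM('a) * \<epsilon> ^ DIM('a) = 1" "inverse \<epsilon> * \<epsilon> = 1" using \<epsilon> by (simp_all add: power_inverse)
          then show ?thesis unfolding alg using l0 by simp
        qed
        finally show ?thesis .
      qed
      show "\<forall>\<^sub>F \<epsilon> in at_right 0. \<bar>mean v \<epsilon> \<epsilon> x t - mean v \<epsilon> \<epsilon> x s\<bar> \<le> 8 * \<omega> * l * r"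
        unfolding eventually_at_right_field
      proof (intro exI[of _ "min r (r\<^sup>2)"] conjI allI impI)
        show "0 < min r (r\<^sup>2)" using r by simp
        fix \<epsilon> assume \<epsilon>: "0 < \<epsilon>" "\<epsilon> < min r (r\<^sup>2)"
        have "\<bar>mean v \<epsilon> \<epsilon> x t\<bar> \<le> 4 * \<omega> * l * r" "\<bar>mean v \<epsilon> \<epsilon> x s\<bar> \<le> 4 * \<omega> * l * r" using \<epsilon> by (auto intro!: mb)
        then show "\<bar>mean v \<epsilon> \<epsilon> x t - mean v \<epsilon> \<epsilon> x s\<bar> \<le> 8 * \<omega> * l * r" by linarith
      qed
    qed
    \<comment> \<open>The radius that balances the two terms of \<open>A\<close>.\<close>
    define \<rho> where "\<rho> = sqrt ((t - s) / 2) * l powr ((p - 2) / 2)"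
    have sq: "0 < sqrt ((t - s) / 2)" "sqrt ((t - s) / 2) \<le> sqrt (t - s)" using ts by auto
    have sqr: "sqrt ((t - s) / 2) < r"
    proof (rule real_less_lsqrt)
      show "(t - s) / 2 < r\<^sup>2" using tsr by simp
    qed (use ts r in auto)
    have \<rho>0: "0 < \<rho>" unfolding \<rho>_def using sq l0 by simp
    have lp: "l * l powr ((p - 2) / 2) = l powr (p / 2)"
      using l0 powr_add[of l 1 "(p-2)/2"] by (simp add: field_simps)
    have 1: "l * \<rho> \<le> sqrt (t - s) * l powr (p / 2)"
    proof -
      have "l * \<rho> = sqrt ((t - s) / 2) * l powr (p / 2)" unfolding \<rho>_def lp[symmetric] by simp
      also have "\<dots> \<le> sqrt (t - s) * l powr (p / 2)" by (intro mult_right_mono sq) simp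
      finally show ?thesis .
    qed
    have key: "mass * tnorm N \<delta> \<le> \<omega> * (8 + 8 * M * (L + 1)) * (sqrt (t - s) * l powr (p/2))"
    proof (cases "\<rho> \<le> r")
      case True
      have "l powr (p - 1) * (t - s) / \<rho> = 2 * (sqrt ((t - s) / 2) * l powr (p / 2))"
      proof -
        have alg: "(X * Y) * (2 * (Z * Z)) = 2 * (Z * X) * (Z * Y)" for X Y Z :: real by simp
        have "p - 1 = p / 2 + (p - 2) / 2" by (simp add: field_simps)
        then have "l powr (p - 1) = l powr (p / 2) * l powr ((p - 2) / 2)" by (simp only: powr_add)
        then have "l powr (p - 1) * (t - s) = (l powr (p / 2) * l powr ((p - 2) / 2)) * (t - s)" by (simp only:)
        also have "\<dots> = (l powr (p / 2) * l powr ((p - 2) / 2)) * (2 * (sqrt ((t - s) / 2) * sqrt ((t - s) / 2)))"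
          using ts by simp
        also have "\<dots> = 2 * (sqrt ((t - s) / 2) * l powr (p / 2)) * \<rho>" unfolding \<rho>_def by (rule alg)
        finally have "l powr (p - 1) * (t - s) = 2 * (sqrt ((t - s) / 2) * l powr (p / 2)) * \<rho>" .
        then show ?thesis using \<rho>0 by simp
      qed
      also have "\<dots> \<le> 2 * (sqrt (t - s) * l powr (p / 2))" by (intro mult_left_mono mult_right_mono sq) auto
      finally have 2: "l powr (p - 1) * (t - s) / \<rho> \<le> 2 * (sqrt (t - s) * l powr (p / 2))" .
      have "mass * tnorm N \<delta> \<le> 8 * \<omega> * (l * \<rho>) + 4 * M * (L + 1) * \<omega> * (l powr (p - 1) * (t - s) / \<rho>)"
        using A[OF \<rho>0 True] unfolding T_def by (simp add: mult.assoc)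
      also have "\<dots> \<le> 8 * \<omega> * (sqrt (t - s) * l powr (p / 2)) + 4 * M * (L + 1) * \<omega> * (2 * (sqrt (t - s) * l powr (p / 2)))"
        using \<omega> \<eta>(5) L by (intro add_mono mult_left_mono 1 2) auto
      also have "\<dots> = \<omega> * (8 + 8 * M * (L + 1)) * (sqrt (t - s) * l powr (p/2))" by (simp add: algebra_simps)
      finally show ?thesis .
    next
      case False
      have p2: "2 < p"
      proof (rule ccontr)
        assume "\<not> 2 < p"
        then have "l powr ((p - 2) / 2) \<le> 1" using l powr_mono[of "(p-2)/2" 0 l] by simp
        then have "\<rho> \<le> sqrt ((t - s) / 2)" unfolding \<rho>_def using sq by (simp add: mult_left_le)
        then show False using False sqr by linarith
      qed
      have "mass * tnorm N \<delta> \<le> 8 * \<omega> * (l * r)" using B[OF p2] by (simp add: mult.assoc)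
      also have "\<dots> \<le> 8 * \<omega> * (l * \<rho>)" using False \<omega> l0 by (intro mult_left_mono) auto
      also have "\<dots> \<le> 8 * \<omega> * (sqrt (t - s) * l powr (p / 2))" using \<omega> by (intro mult_left_mono 1) auto
      also have "\<dots> \<le> \<omega> * (8 + 8 * M * (L + 1)) * (sqrt (t - s) * l powr (p/2))"
      proof (intro mult_right_mono)
        have "0 \<le> \<omega> * (8 * M * (L + 1))" using \<omega> \<eta>(5) L by simp
        then show "8 * \<omega> \<le> \<omega> * (8 + 8 * M * (L + 1))" by (simp add: distrib_left)
      qed (use ts in auto)
      finally show ?thesis .
    qed
    then show ?thesis unfolding \<delta>_def[abs_def] \<omega>_def .
  qed
qed

end

section \<open>The strong maximal function and almost every pair of times\<close>

lemma strong_maximal_bound: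
  assumes "0 < \<sigma>" "a < b" and z: "z \<in> ball y \<sigma> \<times> {a<..<b}"
  shows "(\<integral>\<^sup>+\<zeta>. ennreal \<bar>f \<zeta>\<bar> * indicator (ball y \<sigma> \<times> {a<..<b}) \<zeta> \<partial>lebesgue)
    \<le> strong_maximal f z * emeasure lebesgue (ball y \<sigma> \<times> {a<..<b} :: ('a::euclidean_space \<times> real) set)"
proof -
  let ?C = "ball y \<sigma> \<times> {a<..<b}"
  let ?m = "measure lborel (ball (0::'a) 1) * \<sigma> ^ DIM('a) * (b - a)"
  have m: "emeasure lebesgue ?C = ennreal ?m" using assms by (intro emeasure_cylinder) auto
  have "0 < measure lborel (ball (0::'a) 1)" by (rule content_ball_pos) simp
  then have mp: "0 < ?m" using assms by simp
  let ?i = "\<integral>\<^sup>+\<zeta>. ennreal \<bar>f \<zeta>\<bar> * indicator ?C \<zeta> \<partial>lebesgue"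
  have "?i / ennreal ?m \<le> strong_maximal f z"
    unfolding strong_maximal_def m[symmetric] by (rule SUP_upper) (use z in blast)
  then have "?i / ennreal ?m * ennreal ?m \<le> strong_maximal f z * ennreal ?m" by (rule mult_right_mono) simp
  moreover have "?i / ennreal ?m * ennreal ?m = ?i"
  proof -
    have "ennreal ?m \<noteq> 0" "ennreal ?m < top" using mp by (simp_all only: ennreal_eq_0_iff not_le ennreal_less_top)
    then have "ennreal ?m / ennreal ?m = 1" by (intro ennreal_divide_self) auto
    then show ?thesis by (simp only: ennreal_divide_times mult_1_right)
  qed
  ultimately show ?thesis using m by simp
qed

text \<open>
  On almost every line in time direction a null set of points \<open>(x, t)\<close> leaves a null set of times, and
  almost every pair of times avoids it.
\<close>

lemma AE_lebesgue_time_pairs: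
  fixes P :: "'a::euclidean_space \<times> real \<Rightarrow> bool"
  assumes "AE z in lebesgue. P z"
  shows "AE (x, t, s) in lebesgue. P (x, t) \<and> P (x, s)"
proof -
  have "AE z in lborel. P z" using assms by (simp add: AE_completion_iff)
  then obtain N where N: "N \<in> null_sets lborel" "{z. \<not> P z} \<subseteq> N"
    unfolding eventually_ae_filter by auto
  have "AE z in lborel \<Otimes>\<^sub>M lborel. z \<notin> N" using N(1) unfolding lborel_prod by (rule AE_not_in)
  then have ae: "AE x in lborel. AE t in lborel. (x, t) \<notin> N" by (rule lborel_pair.AE_pair)
  have Nb: "N \<in> sets borel" using N(1) by auto
  have lift: "AE w in lborel \<Otimes>\<^sub>M (lborel \<Otimes>\<^sub>M lborel). (fst w, h (snd w)) \<notin> N"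
    if h: "h = fst \<or> h = snd" for h :: "real \<times> real \<Rightarrow> real"
  proof -
    interpret P: pair_sigma_finite "lborel :: 'a measure" "lborel \<Otimes>\<^sub>M lborel :: (real \<times> real) measure"
      unfolding lborel_prod by unfold_locales
    have hc: "continuous_on UNIV h" using h by (auto intro!: continuous_intros)
    have "continuous_on UNIV (\<lambda>w::'a \<times> real \<times> real. (fst w, h (snd w)))"
      by (intro continuous_intros continuous_on_compose2[OF hc]) auto
    then have "(\<lambda>w::'a \<times> real \<times> real. (fst w, h (snd w))) -` (- N) \<inter> space borel \<in> sets borel"
      by (intro measurable_sets[OF borel_measurable_continuous_onI]) (use Nb in auto)
    then have m: "{w \<in> space (lborel \<Otimes>\<^sub>M (lborel \<Otimes>\<^sub>M lborel)). (fst w :: 'a, h (snd w)) \<notin> N} \<in> sets (lborel \<Otimes>\<^sub>M (lborel \<Otimes>\<^sub>M lborel))"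
      unfolding lborel_prod by (simp add: vimage_def)
    have slice: "AE c in lborel \<Otimes>\<^sub>M lborel. (x, h c) \<notin> N" if a: "AE t in lborel. (x, t) \<notin> N" for x
    proof (rule lborel_pair.AE_pair_measure)
      have "continuous_on UNIV (\<lambda>c. (x, h c))" by (intro continuous_intros hc)
      then have "(\<lambda>c. (x, h c)) -` (- N) \<inter> space borel \<in> sets borel"
        by (intro measurable_sets[OF borel_measurable_continuous_onI]) (use Nb in auto)
      then show "{c \<in> space (lborel \<Otimes>\<^sub>M lborel). (x, h c) \<notin> N} \<in> sets (lborel \<Otimes>\<^sub>M lborel)"
        unfolding lborel_prod by (simp add: vimage_def)
      show "AE t in lborel. AE s in lborel. (x, h (t, s)) \<notin> N"
        using h
      proof
        assume "h = fst"
        with a show ?thesis by (auto elim!: eventually_mono)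
      next
        assume "h = snd"
        with a show ?thesis by simp
      qed
    qed
    show ?thesis using m
    proof (rule P.AE_pair_measure)
      show "AE x in lborel. AE c in lborel \<Otimes>\<^sub>M lborel. (fst (x, c), h (snd (x, c))) \<notin> N"
        using ae by eventually_elim (use slice in simp)
    qed
  qed
  have "AE w in lborel \<Otimes>\<^sub>M (lborel \<Otimes>\<^sub>M lborel). case w of (x, t, s) \<Rightarrow> P (x, t) \<and> P (x, s)"
    using lift[OF disjI1[OF refl]] lift[OF disjI2[OF refl]] by eventually_elim (use N(2) in auto)
  then show ?thesis unfolding lborel_prod by (rule AE_completion)
qed

lemma le_one_plus_powr: "0 \<le> a \<Longrightarrow> 1 \<le> q \<Longrightarrow> a \<le> 1 + a powr (q::real)"
  using powr_le_one_plus_powr[of a 1 1 q] by simp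

lemma integrable_component:
  fixes f :: "'a::euclidean_space \<times> real \<Rightarrow> nat \<Rightarrow> 'b::euclidean_space"
  assumes f: "measurable_tuple N U f" and U: "U \<in> sets lebesgue" and C: "C \<in> sets lebesgue" "C \<subseteq> U" "emeasure lebesgue C < \<infinity>"
    and g: "set_integrable lebesgue C g" "\<And>z. tnorm N (f z) powr q \<le> g z" and q: "1 \<le> q" and i: "i < N"
  shows "integrable lebesgue (\<lambda>z. indicator C z *\<^sub>R f z i)"
proof (rule Bochner_Integration.integrable_bound)
  show "integrable lebesgue (\<lambda>z. indicator C z + indicator C z * g z)"
    using g(1) C unfolding set_integrable_def
    by (intro Bochner_Integration.integrable_add integrable_real_indicator) auto
  have "(\<lambda>z. indicator C z *\<^sub>R (indicator U z *\<^sub>R f z i)) \<in> borel_measurable lebesgue"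
    by (intro borel_measurable_scaleR[OF borel_measurable_indicator[OF C(1)] measurable_tuple_extend[OF f U i]])
  moreover have "indicator C z *\<^sub>R (indicator U z *\<^sub>R f z i) = indicator C z *\<^sub>R f z i" for z
    using C(2) by (auto simp: indicator_def)
  ultimately show "(\<lambda>z. indicator C z *\<^sub>R f z i) \<in> borel_measurable lebesgue" by (simp only:)
  show "AE z in lebesgue. norm (indicator C z *\<^sub>R f z i) \<le> norm (indicator C z + indicator C z * g z)"
  proof (rule AE_I2)
    fix z
    have "norm (f z i) \<le> tnorm N (f z)" by (rule norm_le_tnorm[OF i])
    also have "\<dots> \<le> 1 + tnorm N (f z) powr q" by (rule le_one_plus_powr[OF tnorm_nonneg q])
    also have "\<dots> \<le> 1 + g z" using g(2)[of z] by simp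
    finally show "norm (indicator C z *\<^sub>R f z i) \<le> norm (indicator C z + indicator C z * g z)"
      by (auto simp: indicator_def)
  qed
qed

text \<open>
  Both cases of \<open>g\<close> have the form \<open>\<lambda>\<^sup>p\<^sup>/\<^sup>2\<close>, where \<open>\<lambda>\<^sup>q\<close> with \<open>q = max 1 (p - 1)\<close> is one plus the maximal
  function of the \<open>q\<close>-th power.
\<close>

lemma g_bound_eq_ennpowr:
  fixes u :: "'a::euclidean_space \<times> real \<Rightarrow> nat \<Rightarrow> real" and Du F :: "'a \<times> real \<Rightarrow> nat \<Rightarrow> 'a"
    and N :: nat and x0 :: 'a and t0 r :: real
  assumes p: "1 < p" "p \<noteq> 2"
  defines "f \<equiv> \<lambda>\<zeta>. (tnorm N (Du \<zeta>) + tnorm N (F \<zeta>) + (if p < 2 then 0 else tnorm N (u \<zeta>) / r)) powr (max 1 (p-1))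
        * indicator (pcyl x0 t0 (2*r)) \<zeta>"
  shows "g_bound N p x0 t0 r F u Du z = ennpowr (strong_maximal f z + 1) (1 / max 1 (p-1) * (p/2))"
proof (cases "p < 2")
  case True
  then have "f = (\<lambda>\<zeta>. (tnorm N (Du \<zeta>) + tnorm N (F \<zeta>)) * indicator (pcyl x0 t0 (2*r)) \<zeta>)"
    by (simp add: f_def max_def tnorm_nonneg add_nonneg_nonneg)
  then show ?thesis unfolding g_bound_def using True by (simp add: max_def)
next
  case False
  then have "2 < p" using p by simp
  then have "f = (\<lambda>\<zeta>. (tnorm N (u \<zeta>) / r + tnorm N (Du \<zeta>) + tnorm N (F \<zeta>)) powr (p-1) * indicator (pcyl x0 t0 (2*r)) \<zeta>)"
    by (simp add: f_def max_def add_ac)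
  then show ?thesis unfolding g_bound_def using \<open>2 < p\<close> by (simp add: max_def mult.commute)
qed

theorem lemma8p2:
  fixes p L :: real
  assumes "1 < p" and "p \<noteq> 2" and "0 < L"
  shows "\<exists>c>0. \<forall>(N::nat) (\<nu>::real) (\<Omega>::(real ^ 'n) set) (T::real) A F u Du.
    1 \<le> N \<and> 0 < \<nu> \<and> \<nu> < L \<and>
    open \<Omega> \<and> connected \<Omega> \<and> bounded \<Omega> \<and> \<Omega> \<noteq> {} \<and> 0 < T \<and>
    caratheodory_field N (\<Omega> \<times> {0<..<T}) A \<and>
    p_structure N p \<nu> L (\<Omega> \<times> {0<..<T}) A \<and>
    Lq_loc N (max 1 (p - 1)) (\<Omega> \<times> {0<..<T}) F \<and>
    parabolic_sobolev_loc N (max 1 (p - 1)) \<Omega> T u Du \<and>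
    weak_solution N p (\<Omega> \<times> {0<..<T}) A F u Du \<longrightarrow>
    (\<forall>x0 t0 r. 0 < r \<and> pcyl x0 t0 (2 * r) \<Subset> \<Omega> \<times> {0<..<T} \<longrightarrow>
      (AE (x, t, s) in lebesgue. x \<in> ball x0 r \<and> t \<in> pint t0 r \<and> s \<in> pint t0 r \<longrightarrow>
        ennreal (tnorm N (\<lambda>i. u (x, t) i - u (x, s) i) / \<bar>t - s\<bar> powr (1 / 2))
        \<le> ennreal c * (g_bound N p x0 t0 r F u Du (x, t) + g_bound N p x0 t0 r F u Du (x, s))))"
proof -
  define q where "q = max 1 (p - 1)"
  have q1: "1 \<le> q" by (simp add: q_def)
  obtain \<eta> :: "real^'n \<Rightarrow> real" and M where \<eta>: "smooth \<eta> \<and> (\<forall>y. 0 \<le> \<eta> y \<and> \<eta> y \<le> 1) \<and> (\<exists>y. 0 < \<eta> y) \<and> 1 \<le> M \<and>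
    (\<forall>y. \<eta> y \<noteq> 0 \<longrightarrow> norm y < 1 \<and> y \<in> cbox 0 One) \<and>
    (\<forall>y v. \<bar>frechet_derivative \<eta> (at y) v\<bar> \<le> M * norm v \<and> (frechet_derivative \<eta> (at y) v \<noteq> 0 \<longrightarrow> norm y < 1))"
    using exists_bump by blast
  obtain \<kappa> :: "real \<Rightarrow> real" where \<kappa>: "smooth \<kappa>" "\<forall>s. 0 \<le> \<kappa> s \<and> \<kappa> s \<le> 1" "\<exists>s. 0 < \<kappa> s"
    "\<forall>s. \<kappa> s \<noteq> 0 \<longrightarrow> norm s < 1 \<and> s \<in> cbox 0 One"
    using exists_bump by blast
  interpret bumps \<eta> \<kappa> M
  proof
    show "\<And>s. \<kappa> s \<noteq> 0 \<Longrightarrow> 0 \<le> s \<and> s < 1" using \<kappa>(4) by force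
  qed (use \<eta> \<kappa>(1-3) in blast)+
  have M: "1 \<le> M" using \<eta> by blast
  define \<omega> where "\<omega> = measure lborel (ball (0::real^'n) 1)"
  have \<omega>: "0 < \<omega>" unfolding \<omega>_def by (rule content_ball_pos) simp
  define c where "c = \<omega> * (8 + 8 * M * (L + 1)) / mass"
  have c0: "0 < c" unfolding c_def using \<omega> mass_pos M assms(3) by (intro divide_pos_pos mult_pos_pos add_pos_nonneg) auto
  show ?thesis
  proof (intro exI[of _ c] conjI c0 allI impI; (elim conjE)?)
    fix N :: nat and \<nu> :: real and \<Omega> :: "(real^'n) set" and T :: real
      and A :: "(real^'n) \<times> real \<Rightarrow> (nat \<Rightarrow> real^'n) \<Rightarrow> nat \<Rightarrow> real^'n"
      and F :: "(real^'n) \<times> real \<Rightarrow> nat \<Rightarrow> real^'n" and u :: "(real^'n) \<times> real \<Rightarrow> nat \<Rightarrow> real"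
      and Du :: "(real^'n) \<times> real \<Rightarrow> nat \<Rightarrow> real^'n" and x0 :: "real^'n" and t0 r :: real
    let ?U = "\<Omega> \<times> {0<..<T}"
    assume \<Omega>: "open \<Omega>" and car: "caratheodory_field N ?U A" and str: "p_structure N p \<nu> L ?U A"
      and FL: "Lq_loc N (max 1 (p - 1)) ?U F" and uP: "parabolic_sobolev_loc N (max 1 (p - 1)) \<Omega> T u Du"
      and sol: "weak_solution N p ?U A F u Du" and r: "0 < r" and Q: "pcyl x0 t0 (2 * r) \<Subset> ?U"
    define C0 where "C0 = pcyl x0 t0 (2 * r)"
    have U: "?U \<in> sets lebesgue" using \<Omega> by (intro sets_completionI_sets) (auto intro!: borel_open open_Times)
    have Fm: "measurable_tuple N ?U F" using FL by (simp add: Lq_loc_def)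
    have um: "measurable_tuple N ?U u" and Dm: "measurable_tuple N ?U Du" using uP by (auto simp: parabolic_sobolev_loc_def)
    have C0s: "C0 \<in> sets lebesgue" unfolding C0_def pcyl_def pint_def by (rule cylinder_measurable)
    have r2: "0 < (2*r)\<^sup>2" using r by simp
    have cl: "closure C0 = cball x0 (2*r) \<times> {t0 - (2*r)\<^sup>2..t0 + (2*r)\<^sup>2}"
      unfolding C0_def pcyl_def pint_def closure_Times using r r2 by (simp add: closure_greaterThanLessThan)
    have clU: "closure C0 \<subseteq> ?U" using Q by (simp add: compactly_contained_def C0_def)
    have C0U: "C0 \<subseteq> ?U" using clU closure_subset by blast
    have in1: "(x0, t0 - (2*r)\<^sup>2) \<in> ?U" "(x0, t0 + (2*r)\<^sup>2) \<in> ?U"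
      by (rule subsetD[OF clU], use r r2 in \<open>simp add: cl\<close>)+
    have b1: "cball x0 (2*r) \<subseteq> \<Omega>"
    proof
      fix y assume "y \<in> cball x0 (2*r)"
      then have "(y, t0) \<in> closure C0" using r2 by (simp add: cl)
      then show "y \<in> \<Omega>" using clU by blast
    qed
    have b2: "ball x0 (2*r) \<Subset> \<Omega>" using b1 r by (simp add: compactly_contained_def)
    have sob: "(AE \<tau>\<in>pint t0 (2*r) in lebesgue. sobolev_W1 N q (ball x0 (2*r)) (\<lambda>x. u (x, \<tau>)) (\<lambda>x. Du (x, \<tau>)))"
      and seti: "set_integrable lebesgue C0 (\<lambda>z. tnorm N (u z) powr q + tnorm N (Du z) powr q)"
      using uP b2 in1 r2 unfolding parabolic_sobolev_loc_def q_def[symmetric] C0_def pcyl_def pint_def by auto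
    have fin: "emeasure lebesgue C0 < \<infinity>"
      unfolding C0_def pcyl_def pint_def using r r2 by (subst emeasure_cylinder) auto
    have iu: "integrable lebesgue (\<lambda>z. indicator C0 z * u z i)" if "i < N" for i
      using integrable_component[OF um U C0s C0U fin seti _ q1 that] by simp
    have iG: "integrable lebesgue (\<lambda>z. indicator C0 z *\<^sub>R Du z i)" if "i < N" for i
      by (rule integrable_component[OF Dm U C0s C0U fin seti _ q1 that]) simp
    have wg: "AE \<tau> in lebesgue. \<tau> \<in> pint t0 (2*r) \<longrightarrow> weak_grad (ball x0 (2*r)) (\<lambda>y. u (y, \<tau>) i) (\<lambda>y. Du (y, \<tau>) i)"
      if "i < N" for i
      using sob by eventually_elim (use that in \<open>simp add: sobolev_W1_def\<close>)
    define P where "P z \<longleftrightarrow> (\<forall>i<N. ((\<lambda>\<epsilon>. mean (\<lambda>z. indicator C0 z * u z i) \<epsilon> \<epsilon> (fst z) (snd z)) \<longlongrightarrow> mass * (indicator C0 z * u z i)) (at_right 0))" for z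
    have "AE z in lebesgue. P z"
    proof -
      have "AE z in lebesgue. ((\<lambda>\<epsilon>. mean (\<lambda>z. indicator C0 z * u z i) \<epsilon> \<epsilon> (fst z) (snd z)) \<longlongrightarrow> mass * (indicator C0 z * u z i)) (at_right 0)"
        if "i \<in> {..<N}" for i
      proof -
        have i: "i < N" using that by simp
        show ?thesis using lebesgue_points_AE[OF iu[OF i]]
        proof eventually_elim
          case (elim z)
          then show ?case using mean_at_lebesgue_point[OF iu[OF i], of "fst z" "snd z"] by simp
        qed
      qed
      then have "AE z in lebesgue. \<forall>i\<in>{..<N}. ((\<lambda>\<epsilon>. mean (\<lambda>z. indicator C0 z * u z i) \<epsilon> \<epsilon> (fst z) (snd z)) \<longlongrightarrow> mass * (indicator C0 z * u z i)) (at_right 0)"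
        by (intro AE_finite_allI) auto
      then show ?thesis by eventually_elim (simp add: P_def)
    qed
    then have "AE (x, t, s) in lebesgue. P (x, t) \<and> P (x, s)" by (rule AE_lebesgue_time_pairs)
    then show "AE (x, t, s) in lebesgue. x \<in> ball x0 r \<and> t \<in> pint t0 r \<and> s \<in> pint t0 r \<longrightarrow>
        ennreal (tnorm N (\<lambda>i. u (x, t) i - u (x, s) i) / \<bar>t - s\<bar> powr (1 / 2))
        \<le> ennreal c * (g_bound N p x0 t0 r F u Du (x, t) + g_bound N p x0 t0 r F u Du (x, s))"
    proof eventually_elim
      case (elim w)
      obtain x t s where w: "w = (x, t, s)" by (metis prod_cases3)
      have "ennreal (tnorm N (\<lambda>i. u (x, t) i - u (x, s) i) / \<bar>t - s\<bar> powr (1 / 2))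
        \<le> ennreal c * (g_bound N p x0 t0 r F u Du (x, t) + g_bound N p x0 t0 r F u Du (x, s))"
        if *: "P (x, t)" "P (x, s)" "x \<in> ball x0 r" "t \<in> pint t0 r" "s \<in> pint t0 r" "s < t" for t s
      proof -
        define H where "H \<zeta> = tnorm N (Du \<zeta>) + tnorm N (F \<zeta>) + (if p < 2 then 0 else tnorm N (u \<zeta>) / r)" for \<zeta>
        define f where "f \<zeta> = H \<zeta> powr q * indicator C0 \<zeta>" for \<zeta>
        define S where "S z = strong_maximal f z + 1" for z
        have H0: "0 \<le> H z" for z using r by (simp add: H_def tnorm_nonneg)
        have gS: "g_bound N p x0 t0 r F u Du z = ennpowr (S z) (1 / q * (p/2))" for z
          unfolding S_def f_def[abs_def] H_def q_def C0_def by (rule g_bound_eq_ennpowr[OF assms(1,2)])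
        have g: "g_bound N p x0 t0 r F u Du z = ennreal ((l powr (1 / q)) powr (p/2))" if "S z = ennreal l" "1 \<le> l" for z l
          unfolding gS powr_powr using that by (simp add: ennpowr_def)
        show ?thesis
        proof (cases "S (x, t) = \<infinity> \<or> S (x, s) = \<infinity>")
          case True
          have "g_bound N p x0 t0 r F u Du z = \<infinity>" if "S z = \<infinity>" for z
            unfolding gS that by (simp add: ennpowr_def)
          then have top: "g_bound N p x0 t0 r F u Du (x, t) + g_bound N p x0 t0 r F u Du (x, s) = \<infinity>" using True by auto
          show ?thesis unfolding top using c0 by (simp add: ennreal_mult_top)
        next
          case False
          have ex: "\<exists>l\<ge>1. S z = ennreal l" if "S z \<noteq> \<infinity>" for z
          proof -
            have S1: "1 \<le> S z" unfolding S_def by simp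
            obtain l where l: "0 \<le> l" "S z = ennreal l" using \<open>S z \<noteq> \<infinity>\<close> by (cases "S z") auto
            have "1 \<le> l" using S1 l by (simp add: ennreal_1[symmetric] del: ennreal_1)
            with l show ?thesis by blast
          qed
          obtain lt ls where lt: "1 \<le> lt" "S (x, t) = ennreal lt" and ls: "1 \<le> ls" "S (x, s) = ennreal ls"
            using ex[of "(x, t)"] ex[of "(x, s)"] False by blast
          \<comment> \<open>The maximal function at either point is then at most \<open>l powr q\<close>.\<close>
          define l where "l = max (lt powr (1/q)) (ls powr (1/q))"
          have l1: "1 \<le> l" unfolding l_def using lt ls q1 by (simp add: le_max_iff_disj ge_one_powr_ge_zero)
          have lq: "lt \<le> l powr q" "ls \<le> l powr q"
          proof -
            have "(lt powr (1/q)) powr q \<le> l powr q" "(ls powr (1/q)) powr q \<le> l powr q"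
              using q1 by (auto simp: l_def intro!: powr_mono2)
            then show "lt \<le> l powr q" "ls \<le> l powr q" using lt ls q1 by (simp_all add: powr_powr)
          qed
          have Hm: "(\<lambda>z. H z * indicator C0 z) \<in> borel_measurable lebesgue"
          proof -
            note [measurable] = measurable_tnorm_powr(2)[OF Dm U C0s C0U] measurable_tnorm_powr(2)[OF Fm U C0s C0U] measurable_tnorm_powr(2)[OF um U C0s C0U]
            have eq: "H z * indicator C0 z = tnorm N (Du z) * indicator C0 z + tnorm N (F z) * indicator C0 z
                + (if p < 2 then 0 else tnorm N (u z) * indicator C0 z / r)" for z
              by (simp add: H_def distrib_right)
            show ?thesis unfolding eq by measurable
          qed
          have main: "mass * tnorm N (\<lambda>i. u (x, t) i - u (x, s) i) \<le> \<omega> * (8 + 8 * M * (L + 1)) * (sqrt (t - s) * l powr (p/2))"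
            unfolding \<omega>_def
          proof (rule pointwise_estimate[OF U assms(1,3) car str sol Dm Fm r C0U[unfolded C0_def] iu[unfolded C0_def] iG[unfolded C0_def] wg *(3-6) _ H0 Hm[unfolded C0_def] _ _ _ l1])
            fix i \<tau> assume i: "i < N" "\<tau> \<in> {s, t}"
            have "r\<^sup>2 \<le> (2*r)\<^sup>2" using r by (simp add: power_mult_distrib)
            then have "(x, \<tau>) \<in> C0" using *(3-5) i(2) r by (auto simp: C0_def pcyl_def pint_def)
            then show "((\<lambda>\<epsilon>. mean (\<lambda>z. indicator (pcyl x0 t0 (2*r)) z * u z i) \<epsilon> \<epsilon> x \<tau>) \<longlongrightarrow> mass * u (x, \<tau>) i) (at_right 0)"
              using *(1,2) i unfolding P_def C0_def[symmetric] by auto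
          next
            show "tnorm N (Du z) \<le> H z" for z unfolding H_def using r by (simp add: tnorm_nonneg)
            show "tnorm N (F z) \<le> H z" for z unfolding H_def using r by (simp add: tnorm_nonneg)
            show "tnorm N (u z) \<le> r * H z" if "2 < p" for z
            proof -
              have "tnorm N (u z) / r \<le> H z" unfolding H_def using that by (simp add: tnorm_nonneg)
              then show ?thesis using r by (simp add: field_simps)
            qed
          next
            fix y \<sigma> a b
            let ?C = "ball y \<sigma> \<times> {a<..<b} :: ((real^'n) \<times> real) set"
            assume C: "0 \<le> \<sigma>" "a \<le> b" "?C \<subseteq> pcyl x0 t0 (2*r)" "(x, t) \<in> ?C \<or> (x, s) \<in> ?C"
            have pos: "0 < \<sigma>" "a < b" using C(4) by (auto intro: le_less_trans[OF zero_le_dist])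
            have fC: "ennreal \<bar>f \<zeta>\<bar> * indicator ?C \<zeta> = ennreal (H \<zeta> powr q * indicator ?C \<zeta>)" for \<zeta>
              using C(3) H0 by (auto simp: f_def C0_def indicator_def)
            have Sb: "strong_maximal f z \<le> ennreal l'" if "S z = ennreal l'" for z l'
              unfolding that[symmetric] S_def by (rule add_increasing2) auto
            have "\<exists>z. z \<in> ?C \<and> strong_maximal f z \<le> ennreal (l powr q)"
            proof (cases "(x, t) \<in> ?C")
              case True
              have "strong_maximal f (x, t) \<le> ennreal (l powr q)"
                using Sb[OF lt(2)] ennreal_leI[OF lq(1)] by (rule order_trans)
              with True show ?thesis by blast
            next
              case False
              have "strong_maximal f (x, s) \<le> ennreal (l powr q)"
                using Sb[OF ls(2)] ennreal_leI[OF lq(2)] by (rule order_trans)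
              with False C(4) show ?thesis by blast
            qed
            then obtain z where z: "z \<in> ?C" "strong_maximal f z \<le> ennreal (l powr q)" by blast
            have "(\<integral>\<^sup>+\<zeta>. ennreal (H \<zeta> powr q * indicator ?C \<zeta>) \<partial>lebesgue) \<le> strong_maximal f z * emeasure lebesgue ?C"
              using strong_maximal_bound[OF pos z(1), of f] unfolding fC .
            also have "\<dots> \<le> ennreal (l powr q) * emeasure lebesgue ?C" by (rule mult_right_mono[OF z(2)]) simp
            also have "\<dots> = ennreal (l powr q * (measure lborel (ball (0::real^'n) 1) * \<sigma> ^ DIM(real^'n) * (b - a)))"
              using emeasure_cylinder[OF C(1,2), of y] by (simp add: ennreal_mult'[symmetric])
            finally show "(\<integral>\<^sup>+z. ennreal (H z powr (max 1 (p-1)) * indicator ?C z) \<partial>lebesgue)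
              \<le> ennreal (l powr (max 1 (p-1)) * (measure lborel (ball (0::real^'n) 1) * \<sigma> ^ DIM(real^'n) * (b - a)))"
              unfolding q_def .
          qed
          have lmax: "l powr (p/2) \<le> (lt powr (1/q)) powr (p/2) + (ls powr (1/q)) powr (p/2)"
            unfolding l_def max_def by (auto simp: add_increasing add_increasing2)
          have ts: "0 < sqrt (t - s)" "\<bar>t - s\<bar> powr (1/2) = sqrt (t - s)" using *(6) by (auto simp: powr_half_sqrt)
          have "tnorm N (\<lambda>i. u (x, t) i - u (x, s) i) \<le> c * (sqrt (t - s) * l powr (p/2))"
            unfolding c_def using main mass_pos by (simp add: field_simps)
          then have "tnorm N (\<lambda>i. u (x, t) i - u (x, s) i) / \<bar>t - s\<bar> powr (1/2) \<le> c * l powr (p/2)"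
            unfolding ts(2) using ts(1) by (simp add: field_simps)
          also have "\<dots> \<le> c * ((lt powr (1/q)) powr (p/2) + (ls powr (1/q)) powr (p/2))"
            using c0 by (intro mult_left_mono lmax) auto
          finally show ?thesis
            unfolding g[OF lt(2,1)] g[OF ls(2,1)] using c0
            by (subst ennreal_plus[symmetric], simp, simp, subst ennreal_mult'[symmetric]) (auto intro: ennreal_leI)
        qed
      qed
      note ordered = this
      show ?case unfolding w
      proof (clarsimp)
        assume a: "dist x0 x < r" "t \<in> pint t0 r" "s \<in> pint t0 r"
        have P: "P (x, t)" "P (x, s)" using elim w by auto
        have x: "x \<in> ball x0 r" using a by simp
        have sym: "tnorm N (\<lambda>i. u (x, t) i - u (x, s) i) = tnorm N (\<lambda>i. u (x, s) i - u (x, t) i)"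
          unfolding tnorm_def real_norm_def by (intro L2_set_cong refl abs_minus_commute)
        consider "s < t" | "t < s" | "s = t" by linarith
        then show "ennreal (tnorm N (\<lambda>i. u (x, t) i - u (x, s) i) / \<bar>t - s\<bar> powr (1 / 2))
          \<le> ennreal c * (g_bound N p x0 t0 r F u Du (x, t) + g_bound N p x0 t0 r F u Du (x, s))"
        proof cases
          case 1 then show ?thesis using ordered[OF P x a(2,3)] by simp
        next
          case 2 then show ?thesis using ordered[OF P(2,1) x a(3,2)] by (simp add: sym abs_minus_commute add.commute)
        next
          case 3 then show ?thesis by simp
        qed
      qed
    qed
  qed
qed

end
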